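(* Let $G$, $H_0$, $V$, $H=H_0+V$, $R(\kappa)=(H+\kappa^2)^{-1}$ be as in the context, and assume that $V$ satisfies the assumption $(\mathrm A_\beta)$ of the context for some integer $\beta\ge 2$. Assume that the threshold $0$ is a regular point, i.e. $\mathcal E=\mathsf E=\{0\}$. Then, as $\kappa\to0$ with $\mathop{\mathrm{Re}}\kappa>0$, $$R(\kappa)=\sum_{j=0}^{\beta-2}\kappa^jG_j+\mathcal O(\kappa^{\beta-1})\quad\text{in }\mathcal B^{\beta},$$ with $G_j\in\mathcal B^{j+1}$ for $j$ even and $G_j\in\mathcal B^{j}$ for $j$ odd. In particular, the coefficients $G_{-2}$ and $G_{-1}$ of $\kappa^{-2}$ and $\kappa^{-1}$ satisfy $G_{-2}=\mathsf P=0$ and $G_{-1}=\mathcal P=0$.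
   Context: Graph. Let $(K,E_0)$ be a connected, finite, undirected, simple graph (no loops, no multiple edges), and for $\alpha=1,\dots,N$ let $(L_\alpha,E_\alpha)$ be a copy of the discrete half-line, $L_\alpha=\{1,2,\dots\}$, $E_\alpha=\{\{n,n+1\}: n\in L_\alpha\}$. Fix vertices $x_1,\dots,x_N\in K$ (not necessarily distinct). Let $G=K\cup L_1\cup\dots\cup L_N$ (disjoint union), with edges those of $E_0,E_1,\dots,E_N$ together with $\{x_\alpha,1^{(\alpha)}\}$, $\alpha=1,\dots,N$, where $1^{(\alpha)}$ is the point $1\in L_\alpha$. Free operator. For $u\colon K\to\mathbb C$ set $(h_0u)[x]=\sum_{y\in K,\{x,y\}\in E_0}(u[x]-u[y])+\sum_{\alpha=1}^Ns_\alpha[x]u[x]$, where $s_\alpha[x]=1$ if $x=x_\alpha$ and $0$ otherwise. For $u\colon L_\alpha\to\mathbb C$ set $(h_\alpha u)[1]=2u[1]-u[2]$ and $(h_\alpha u)[n]=2u[n]-u[n+1]-u[n-1]$ for $n\ge2$. Let $H_0=h_0\oplus h_1\oplus\dots\oplus h_N$, acting on all functions on $G$ decomposed as functions on $K,L_1,\dots,L_N$; on $\mathcal H=\ell^2(G)$ it is bounded and self-adjoint. Spaces. For $s\in\mathbb R$, $\mathcal L^s=\ell^{1,s}(G)$ is the space of $u\colon G\to\mathbb C$ with $\sum_{x\in K}|u[x]|+\sum_{\alpha}\sum_{n\in L_\alpha}(1+n^2)^{s/2}|u[n]|<\infty$; its dual $(\mathcal L^s)^*=\ell^{\infty,-s}(G)$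 is the space of $u$ with $\sup_{x\in K}|u[x]|<\infty$ and $\sup_{n\in L_\alpha}(1+n^2)^{-s/2}|u[n]|<\infty$ for all $\alpha$. Put $\mathcal B^s=\mathcal B(\mathcal L^s,(\mathcal L^s)^* )$. $\langle u,w\rangle=\sum_{x\in G}\overline{u[x]}w[x]$ whenever this converges absolutely, and $|\Psi\rangle\langle\Phi|$ is the operator $u\mapsto\langle\Phi,u\rangle\Psi$. $(\Phi\cdot\Psi)[x]=\Phi[x]\Psi[x]$ is the pointwise product. Assumption $(\mathrm A_\beta)$, $\beta\ge1$: $V\in\mathcal B(\mathcal H)$ is self-adjoint, and there exist a Hilbert space $\mathcal K$, an injective operator $v\in\mathcal B(\mathcal K,\mathcal L^\beta)$ and a self-adjoint unitary operator $U\in\mathcal B(\mathcal K)$ such that $V=vUv^*\in\mathcal B((\mathcal L^\beta)^*,\mathcal L^\beta)$. Put $H=H_0+V$ and $R(\kappa)=(H+\kappa^2)^{-1}$ for $-\kappa^2\notin\sigma(H)$. Eigenspaces. Let $\mathbf n^{(\alpha)}[x]=m$ if $x=m\in L_\alpha$ and $0$ otherwise; $\mathbf 1^{(\alpha)}[x]=1$ if $x\in L_\alpha$ and $0$ otherwise; $\mathbb C\mathbf n=\bigoplus_\alpha\mathbb C\mathbf n^{(\alpha)}$, $\mathbb C\mathbf 1=\bigoplus_\alpha\mathbb C\mathbf 1^{(\alpha)}$. Define $\widetilde{\mathcal E}=\{\Psi\in(\mathcal L^\beta)^*: H\Psi=0\}$, $\mathcal E=\widetilde{\mathcal E}\cap(\mathbb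 C\mathbf 1\oplus\mathcal L^{\beta-2})$, $\mathsf E=\widetilde{\mathcal E}\cap\mathcal L^{\beta-2}$. Projections. A set $\{\Psi_\gamma\}\subset\mathcal E$ is an orthonormal resonance basis if the classes $[\Psi_\gamma]$ form a basis of $\mathcal E/\mathsf E$, for every $\gamma$ and $\Psi\in\mathsf E$ one has $\overline\Psi\cdot\Psi_\gamma\in\mathcal L^0$ and $\langle\Psi,\Psi_\gamma\rangle=0$, and there is an orthonormal system $\{c^{(\gamma)}\}\subset\mathbb C^N$ with $\Psi_\gamma-\sum_\alpha c^{(\gamma)}_\alpha\mathbf 1^{(\alpha)}\in\mathcal L^{\beta-2}$ for every $\gamma$. The orthogonal resonance projection is $\mathcal P=\sum_\gamma|\Psi_\gamma\rangle\langle\Psi_\gamma|$. A basis $\{\Psi_\gamma\}$ of $\mathsf E$ is an orthonormal bound basis if $\overline{\Psi_{\gamma'}}\cdot\Psi_\gamma\in\mathcal L^0$ and $\langle\Psi_{\gamma'},\Psi_\gamma\rangle=\delta_{\gamma\gamma'}$; the orthogonal bound projection is $\mathsf P=\sum_\gamma|\Psi_\gamma\rangle\langle\Psi_\gamma|$. Both are independent of the choice of bases (and are $0$ if the corresponding basis is empty). Coefficients of powers of $\kappa$ not occurring in the expansion are by convention $0$. *)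

theory Defs
  imports
    "HOL-Analysis.Analysis"
    "HOL-Library.Function_Algebras"
    "HOL-Library.Landau_Symbols"
begin

text \<open>
  Sums, differences and \<open>0\<close> of functions (and of operators between function spaces) are the
  pointwise ones of \<^theory>\<open>HOL-Library.Function_Algebras\<close>; there \<open>*\<close> on functions is the
  pointwise product.
\<close>

subsection \<open>Complex Hilbert spaces\<close>

text \<open>The real structure, norm and completeness come from \<^class>\<open>real_inner\<close> and
  \<^class>\<open>complete_space\<close>. The inner product is linear in its second argument.\<close>

class complex_hilbert = real_inner + complete_space +
  fixes scaleC :: "complex \<Rightarrow> 'a \<Rightarrow> 'a"
    and cinner :: "'a \<Rightarrow> 'a \<Rightarrow> complex"
  assumes scaleC_add_right: "scaleC a (x + y) = scaleC a x + scaleC a y"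
    and scaleC_add_left: "scaleC (a + b) x = scaleC a x + scaleC b x"
    and scaleC_scaleC: "scaleC a (scaleC b x) = scaleC (a * b) x"
    and scaleR_eq_scaleC: "scaleR r x = scaleC (complex_of_real r) x"
    and cinner_commute: "cinner x y = cnj (cinner y x)"
    and cinner_add_right: "cinner x (y + z) = cinner x y + cinner x z"
    and cinner_scaleC_right: "cinner x (scaleC a y) = a * cinner x y"
    and inner_eq_Re_cinner: "inner x y = Re (cinner x y)"

subsection \<open>The graph and the free operator\<close>

definition simple_graph :: "'k set set \<Rightarrow> bool" where
  "simple_graph E \<longleftrightarrow> (\<forall>e\<in>E. card e = 2)"

definition connected_graph :: "'k set set \<Rightarrow> bool" where
  "connected_graph E \<longleftrightarrow> (\<forall>x y. (x, y) \<in> {(a, b). {a, b} \<in> E}\<^sup>*)"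

text \<open>
  The vertices of \<open>G\<close>: the core \<open>K\<close> is a finite type \<open>'k\<close>, the half-lines are indexed by a
  finite type \<open>'n\<close> with \<open>N = CARD('n)\<close>. Since \<open>L\<^sub>\<alpha>\<close> starts at \<open>1\<close>, \<open>Ray \<alpha> m\<close> is the point
  \<open>n = m + 1\<close> of \<open>L\<^sub>\<alpha>\<close>. The operator below decouples the core and the half-lines, so
  the edges of the half-lines and the connecting edges \<open>{x\<^sub>\<alpha>, 1}\<close> enter only through the formulas
  for \<open>h_ray\<close> and \<open>h_core\<close>.
\<close>

datatype ('k, 'n) vertex = Core 'k | Ray 'n nat

type_synonym ('k, 'n) state = "('k, 'n) vertex \<Rightarrow> complex"
type_synonym ('k, 'n) oper = "('k, 'n) state \<Rightarrow> ('k, 'n) state"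

definition h_core ::
    "'k::finite set set \<Rightarrow> ('n::finite \<Rightarrow> 'k) \<Rightarrow> ('k \<Rightarrow> complex) \<Rightarrow> 'k \<Rightarrow> complex" where
  "h_core E xs u x =
     (\<Sum>y\<in>{y. {x, y} \<in> E}. u x - u y) + (\<Sum>\<alpha>\<in>UNIV. (if x = xs \<alpha> then 1 else 0) * u x)"

fun h_ray :: "(nat \<Rightarrow> complex) \<Rightarrow> nat \<Rightarrow> complex" where
  "h_ray u 0 = 2 * u 0 - u 1"
| "h_ray u (Suc m) = 2 * u (Suc m) - u (Suc (Suc m)) - u m"

definition H0 :: "'k::finite set set \<Rightarrow> ('n::finite \<Rightarrow> 'k) \<Rightarrow> ('k, 'n) oper" where
  "H0 E xs u = (\<lambda>p. case p of
       Core x \<Rightarrow> h_core E xs (\<lambda>y. u (Core y)) x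
     | Ray \<alpha> m \<Rightarrow> h_ray (\<lambda>l. u (Ray \<alpha> l)) m)"

definition Hop :: "'k::finite set set \<Rightarrow> ('n::finite \<Rightarrow> 'k) \<Rightarrow> ('k, 'n) oper \<Rightarrow> ('k, 'n) oper" where
  "Hop E xs V u = H0 E xs u + V u"

subsection \<open>Function spaces and operators\<close>

definition smul :: "complex \<Rightarrow> ('k, 'n) state \<Rightarrow> ('k, 'n) state" where
  "smul c u = (\<lambda>p. c * u p)"

definition conj_fun :: "('k, 'n) state \<Rightarrow> ('k, 'n) state" where
  "conj_fun u = (\<lambda>p. cnj (u p))"

definition pairing :: "('k, 'n) state \<Rightarrow> ('k, 'n) state \<Rightarrow> complex" where
  "pairing u w = (\<Sum>\<^sub>\<infinity>p. cnj (u p) * w p)"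

fun weight :: "real \<Rightarrow> ('k, 'n) vertex \<Rightarrow> real" where
  "weight s (Core x) = 1"
| "weight s (Ray \<alpha> m) = (1 + (real (m + 1))\<^sup>2) powr (s / 2)"

definition ell2 :: "('k, 'n) state set" where
  "ell2 = {u. (\<lambda>p. (cmod (u p))\<^sup>2) summable_on UNIV}"

definition norm2 :: "('k, 'n) state \<Rightarrow> real" where
  "norm2 u = sqrt (\<Sum>\<^sub>\<infinity>p. (cmod (u p))\<^sup>2)"

definition Lsp :: "real \<Rightarrow> ('k, 'n) state set" where
  "Lsp s = {u. (\<lambda>p. weight s p * cmod (u p)) summable_on UNIV}"

definition normL :: "real \<Rightarrow> ('k, 'n) state \<Rightarrow> real" where
  "normL s u = (\<Sum>\<^sub>\<infinity>p. weight s p * cmod (u p))"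

definition Ldual :: "real \<Rightarrow> ('k, 'n) state set" where
  "Ldual s = {u. bdd_above (range (\<lambda>p. weight (- s) p * cmod (u p)))}"

definition normLdual :: "real \<Rightarrow> ('k, 'n) state \<Rightarrow> real" where
  "normLdual s u = (SUP p. weight (- s) p * cmod (u p))"

definition bounded_op ::
    "('k, 'n) state set \<Rightarrow> (('k, 'n) state \<Rightarrow> real) \<Rightarrow>
     ('k, 'n) state set \<Rightarrow> (('k, 'n) state \<Rightarrow> real) \<Rightarrow> ('k, 'n) oper \<Rightarrow> bool" where
  "bounded_op S nS T nT A \<longleftrightarrow>
     (\<forall>u\<in>S. A u \<in> T) \<and>
     (\<forall>u\<in>S. \<forall>w\<in>S. A (u + w) = A u + A w) \<and>
     (\<forall>c. \<forall>u\<in>S. A (smul c u) = smul c (A u)) \<and>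
     (\<exists>C. \<forall>u\<in>S. nT (A u) \<le> C * nS u)"

text \<open>Operators are total functions; only their values on \<open>Lsp s\<close> matter for the following two
  notions. The norm follows the pattern of \<^const>\<open>onorm\<close>, with \<open>0 / 0 = 0\<close>.\<close>

definition Bsp :: "real \<Rightarrow> ('k, 'n) oper set" where
  "Bsp s = {A. bounded_op (Lsp s) (normL s) (Ldual s) (normLdual s) A}"

definition normB :: "real \<Rightarrow> ('k, 'n) oper \<Rightarrow> real" where
  "normB s A = (SUP u\<in>Lsp s. normLdual s (A u) / normL s u)"

definition l2_spectrum :: "('k, 'n) oper \<Rightarrow> complex set" where
  "l2_spectrum T = {z. \<not> (bij_betw (\<lambda>u. T u - smul z u) ell2 ell2 \<and>
      bounded_op ell2 norm2 ell2 norm2 (the_inv_into ell2 (\<lambda>u. T u - smul z u)))}"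

definition resolvent :: "('k, 'n) oper \<Rightarrow> complex \<Rightarrow> ('k, 'n) oper" where
  "resolvent T \<kappa> = the_inv_into ell2 (\<lambda>u. T u + smul (\<kappa>\<^sup>2) u)"

subsection \<open>The class of perturbations\<close>

text \<open>\<open>adj v\<close> is \<open>v\<^sup>*\<close>, the adjoint for the sesquilinear duality \<^const>\<open>pairing\<close>. By the Riesz
  theorem the description denotes whenever \<open>v\<close> is bounded into \<open>Lsp \<beta>\<close> and \<open>u \<in> Ldual \<beta>\<close>.\<close>

definition adj :: "('h::complex_hilbert \<Rightarrow> ('k, 'n) state) \<Rightarrow> ('k, 'n) state \<Rightarrow> 'h" where
  "adj v u = (THE g. \<forall>f. cinner g f = pairing u (v f))"

text \<open>The Hilbert space \<open>'h\<close> and the operators \<open>v\<close>, \<open>U\<close>, existentially quantified in the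
  assumption on \<open>V\<close>, are parameters here.\<close>

definition assumption_A ::
    "real \<Rightarrow> ('k, 'n) oper \<Rightarrow> ('h::complex_hilbert \<Rightarrow> ('k, 'n) state) \<Rightarrow> ('h \<Rightarrow> 'h) \<Rightarrow> bool" where
  "assumption_A \<beta> V v U \<longleftrightarrow>
     \<beta> \<ge> 1 \<and>
     bounded_op ell2 norm2 ell2 norm2 V \<and>
     (\<forall>u\<in>ell2. \<forall>w\<in>ell2. pairing (V u) w = pairing u (V w)) \<and>
     range v \<subseteq> Lsp \<beta> \<and>
     (\<forall>f g. v (f + g) = v f + v g) \<and> (\<forall>c f. v (scaleC c f) = smul c (v f)) \<and>
     (\<exists>C. \<forall>f. normL \<beta> (v f) \<le> C * norm f) \<and>
     inj v \<and>
     bounded_linear U \<and> (\<forall>c f. U (scaleC c f) = scaleC c (U f)) \<and>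
     (\<forall>f g. cinner (U f) g = cinner f (U g)) \<and>
     bij U \<and> (\<forall>f g. cinner (U f) (U g) = cinner f g) \<and>
     (\<forall>u\<in>Ldual \<beta>. V u = v (U (adj v u))) \<and>
     bounded_op (Ldual \<beta>) (normLdual \<beta>) (Lsp \<beta>) (normL \<beta>) V"

subsection \<open>Threshold eigenspaces and projections\<close>

definition one_ray :: "'n \<Rightarrow> ('k, 'n) state" where
  "one_ray \<alpha> = (\<lambda>p. case p of Core x \<Rightarrow> 0 | Ray \<alpha>' m \<Rightarrow> if \<alpha>' = \<alpha> then 1 else 0)"

definition gen_eigenspace ::
    "'k::finite set set \<Rightarrow> ('n::finite \<Rightarrow> 'k) \<Rightarrow> ('k, 'n) oper \<Rightarrow> real \<Rightarrow> ('k, 'n) state set" where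
  "gen_eigenspace E xs V \<beta> = {\<Psi> \<in> Ldual \<beta>. Hop E xs V \<Psi> = 0}"

definition res_space ::
    "'k::finite set set \<Rightarrow> ('n::finite \<Rightarrow> 'k) \<Rightarrow> ('k, 'n) oper \<Rightarrow> real \<Rightarrow> ('k, 'n) state set" where
  "res_space E xs V \<beta> = gen_eigenspace E xs V \<beta> \<inter>
     {(\<Sum>\<alpha>\<in>UNIV. smul (c \<alpha>) (one_ray \<alpha>)) + w | c w. w \<in> Lsp (\<beta> - 2)}"

definition bound_space ::
    "'k::finite set set \<Rightarrow> ('n::finite \<Rightarrow> 'k) \<Rightarrow> ('k, 'n) oper \<Rightarrow> real \<Rightarrow> ('k, 'n) state set" where
  "bound_space E xs V \<beta> = gen_eigenspace E xs V \<beta> \<inter> Lsp (\<beta> - 2)"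

text \<open>The first three conjuncts say that \<open>\<Psi> \<mapsto> [\<Psi>]\<close> is injective on \<open>B\<close> and that its image is a
  basis of the quotient space.\<close>

definition resonance_basis ::
    "'k::finite set set \<Rightarrow> ('n::finite \<Rightarrow> 'k) \<Rightarrow> ('k, 'n) oper \<Rightarrow> real \<Rightarrow> ('k, 'n) state set \<Rightarrow> bool"
  where
  "resonance_basis E xs V \<beta> B \<longleftrightarrow>
     B \<subseteq> res_space E xs V \<beta> \<and>
     (\<forall>F a. finite F \<longrightarrow> F \<subseteq> B \<longrightarrow> (\<Sum>\<Psi>\<in>F. smul (a \<Psi>) \<Psi>) \<in> bound_space E xs V \<beta> \<longrightarrow>
        (\<forall>\<Psi>\<in>F. a \<Psi> = 0)) \<and>
     (\<forall>\<Phi>\<in>res_space E xs V \<beta>. \<exists>F a. finite F \<and> F \<subseteq> B \<and>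
        \<Phi> - (\<Sum>\<Psi>\<in>F. smul (a \<Psi>) \<Psi>) \<in> bound_space E xs V \<beta>) \<and>
     (\<forall>\<Phi>\<in>B. \<forall>\<Psi>\<in>bound_space E xs V \<beta>.
        conj_fun \<Psi> * \<Phi> \<in> Lsp 0 \<and> pairing \<Psi> \<Phi> = 0) \<and>
     (\<exists>c :: ('k, 'n) state \<Rightarrow> 'n \<Rightarrow> complex.
        (\<forall>\<Phi>\<in>B. \<forall>\<Psi>\<in>B. (\<Sum>\<alpha>\<in>UNIV. cnj (c \<Phi> \<alpha>) * c \<Psi> \<alpha>) = (if \<Phi> = \<Psi> then 1 else 0)) \<and>
        (\<forall>\<Phi>\<in>B. \<Phi> - (\<Sum>\<alpha>\<in>UNIV. smul (c \<Phi> \<alpha>) (one_ray \<alpha>)) \<in> Lsp (\<beta> - 2)))"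

definition bound_basis ::
    "'k::finite set set \<Rightarrow> ('n::finite \<Rightarrow> 'k) \<Rightarrow> ('k, 'n) oper \<Rightarrow> real \<Rightarrow> ('k, 'n) state set \<Rightarrow> bool"
  where
  "bound_basis E xs V \<beta> B \<longleftrightarrow>
     \<not> module.dependent smul B \<and> module.span smul B = bound_space E xs V \<beta> \<and>
     (\<forall>\<Phi>\<in>B. \<forall>\<Psi>\<in>B. conj_fun \<Phi> * \<Psi> \<in> Lsp 0 \<and> pairing \<Phi> \<Psi> = (if \<Phi> = \<Psi> then 1 else 0))"

definition ketbra :: "('k, 'n) state \<Rightarrow> ('k, 'n) state \<Rightarrow> ('k, 'n) oper" where
  "ketbra \<Psi> \<Phi> u = smul (pairing \<Phi> u) \<Psi>"

text \<open>The projections do not depend on the basis, so an arbitrary one is selected. Orthonormal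
  resonance and bound bases are finite, so the sums below are not degenerate.\<close>

definition resonance_projection ::
    "'k::finite set set \<Rightarrow> ('n::finite \<Rightarrow> 'k) \<Rightarrow> ('k, 'n) oper \<Rightarrow> real \<Rightarrow> ('k, 'n) oper" where
  "resonance_projection E xs V \<beta> = (\<Sum>\<Psi>\<in>(SOME B. resonance_basis E xs V \<beta> B). ketbra \<Psi> \<Psi>)"

definition bound_projection ::
    "'k::finite set set \<Rightarrow> ('n::finite \<Rightarrow> 'k) \<Rightarrow> ('k, 'n) oper \<Rightarrow> real \<Rightarrow> ('k, 'n) oper" where
  "bound_projection E xs V \<beta> = (\<Sum>\<Psi>\<in>(SOME B. bound_basis E xs V \<beta> B). ketbra \<Psi> \<Psi>)"

end

theory Submission
  imports Defs "HOL-Complex_Analysis.Complex_Analysis"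
begin

text \<open>
  Write \<open>H = H' + W\<close>, where \<open>H'\<close> is the identity on the core and the Dirichlet operator on every ray, so that
  \<open>R\<^sub>0(\<kappa>) = (H' + \<kappa>\<^sup>2)\<^sup>-\<^sup>1\<close> has an explicit kernel up to the factor \<open>1 / (1 + \<kappa>\<^sup>2)\<close> on the core. With
  \<open>\<eta>\<^sup>2 = 1 - \<kappa> \<eta>\<close> this kernel is a sum of powers of \<open>\<eta>\<^sup>2\<close>, and the \<open>j\<close>-th coefficient and remainder of \<open>\<eta>\<^sup>m\<close>
  grow at most like \<open>m\<^sup>j\<close>; this gives the expansion of \<open>R\<^sub>0(\<kappa>)\<close> in the weighted spaces. The resolvent
  solves \<open>(1 + R\<^sub>0(\<kappa>) W) R(\<kappa>) = R\<^sub>0(\<kappa>)\<close> on the dual space of weight \<open>\<beta>\<close>. There \<open>W\<close> is compact, because a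
  bounded operator from a Hilbert space to \<open>\<ell>\<^sup>1\<close> is compact, so \<open>1 + R\<^sub>0(0) W\<close> is invertible as soon
  as it is injective. An element \<open>\<Psi>\<close> of its kernel satisfies \<open>H \<Psi> = 0\<close> and is a
  constant on each ray up to a summable error, hence vanishes at a regular point. Invertibility persists for
  small \<open>\<kappa>\<close>, and the coefficients follow by comparing powers of \<open>\<kappa>\<close>.
\<close>

subsection \<open>Riesz representation\<close>

text \<open>Compactness is used only in this form: \<open>W\<close> has small norm on functions that
  vanish on a suitable finite set \<open>F\<close>. Splitting off the values on \<open>F\<close>
  makes \<open>1 + R_0(0) W\<close> an operator invertible by a Neumann argument plus one of finite
  rank, so injectivity only has to be turned into solvability of a square linear system.

  The weights come from the kernel. At \<open>(n, m)\<close> it is a sum of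
  \<open>min n m + 1\<close> powers of \<open>eta\<close> with exponents of order
  \<open>max n m\<close>, so its \<open>j\<close>-th coefficient has size at most
  \<open>min * max ^ j\<close> up to a constant and an index shift by 1, and weights of exponent
  \<open>max 1 j\<close> in each variable dominate it. Since \<open>W\<close> maps weight \<beta> to
  weight \<beta>, the coefficients of the full resolvent inherit this exponent, which yields both
  the even and the odd bound of the theorem.

  Working with \<open>eta\<close>, a square root of \<zeta>, replaces the second-order recursion of
  the powers of \<zeta> by one in which each factor \<kappa> costs exactly one power of
  \<open>m\<close>.

  Two settings have to be linked: the resolvent is defined on \<open>ell2\<close>, where its norm
  blows up at the threshold, while all uniform estimates live in the weighted spaces.\<close>

lemma riesz_representation:
  fixes f :: "'a::{real_inner,complete_space} \<Rightarrow> real"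
  assumes "bounded_linear f"
  shows "\<exists>g. \<forall>x. f x = inner g x"
proof -
  interpret f: bounded_linear f by fact
  obtain K where K: "\<And>x. norm (f x) \<le> norm x * K" "K \<ge> 0"
    using f.nonneg_bounded by blast
  \<comment> \<open>The representing vector is the minimizer of \<open>J\<close>. In the
    parallelogram identity \<open>par\<close> the linear terms cancel, so every minimizing sequence
    is Cauchy.\<close>
  define J where "J x = (norm x)\<^sup>2 - 2 * f x" for x
  have J_ge: "J x \<ge> - K\<^sup>2" for x
  proof -
    have "f x \<le> norm x * K" using K(1)[of x] by auto
    moreover have "(norm x - K)\<^sup>2 \<ge> 0" by simp
    ultimately show ?thesis unfolding J_def power2_diff by (simp add: mult.commute)
  qed
  have bdd: "bdd_below (range J)" using J_ge by (auto intro!: bdd_belowI)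
  define d where "d = Inf (range J)"
  have d_le: "d \<le> J x" for x unfolding d_def using bdd by (simp add: cInf_lower)
  have "\<exists>x. J x < d + 1 / real (Suc n)" for n
  proof -
    have "Inf (range J) < d + 1 / real (Suc n)" unfolding d_def by simp
    then show ?thesis using cInf_lessD[of "range J"] by auto
  qed
  then obtain X where X: "\<And>n. J (X n) < d + 1 / real (Suc n)" by metis
  have par: "(norm (x - y))\<^sup>2 = 2 * J x + 2 * J y - 4 * J ((1/2) *\<^sub>R (x + y))" for x y
    unfolding J_def power2_norm_eq_inner f.scaleR f.add
    by (simp add: inner_diff_left inner_diff_right inner_add_left inner_add_right inner_commute algebra_simps)
  have dist_le: "(norm (x - y))\<^sup>2 \<le> 2 * (J x - d) + 2 * (J y - d)" for x y
    using par[of x y] d_le[of "(1/2) *\<^sub>R (x + y)"] by simp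
  have "Cauchy X"
  proof (rule metric_CauchyI)
    fix e :: real assume e: "e > 0"
    then obtain N where N: "1 / real (Suc N) < e\<^sup>2 / 4"
      using nat_approx_posE[of "e\<^sup>2 / 4"] by auto
    have "dist (X m) (X n) < e" if "m \<ge> N" "n \<ge> N" for m n
    proof -
      have le: "1 / real (Suc k) \<le> 1 / real (Suc N)" if "k \<ge> N" for k
        using that by (simp add: frac_le)
      have "(norm (X m - X n))\<^sup>2 < e\<^sup>2"
        using dist_le[of "X m" "X n"] X[of m] X[of n] le[OF that(1)] le[OF that(2)] N by argo
      then show ?thesis using e by (simp add: dist_norm power2_less_imp_less)
    qed
    then show "\<exists>M. \<forall>m\<ge>M. \<forall>n\<ge>M. dist (X m) (X n) < e" by blast
  qed
  then obtain x where x: "X \<longlonglongrightarrow> x" using Cauchy_convergent convergent_def by blast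
  have "(\<lambda>n. J (X n)) \<longlonglongrightarrow> J x" unfolding J_def
    by (intro tendsto_intros x f.tendsto)
  moreover have "(\<lambda>n. d + 1 / real (Suc n)) \<longlonglongrightarrow> d"
    using LIMSEQ_Suc[OF lim_1_over_n] tendsto_add[OF tendsto_const] by fastforce
  ultimately have "J x \<le> d" using X by (meson LIMSEQ_le less_imp_le)
  have min: "J x \<le> J y" for y using \<open>J x \<le> d\<close> d_le[of y] by simp
  have "f y = inner x y" for y
  proof (cases "y = 0")
    case False
    define a where "a = f y - inner x y"
    \<comment> \<open>This \<open>t\<close> minimizes the quadratic polynomial
      \<open>J (x + t y)\<close>; the minimum lies below \<open>J x\<close> by
      \<open>a^2 / |y|^2\<close>, which forces \<open>a = 0\<close>.\<close>
    define t where "t = a / (norm y)\<^sup>2"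
    have ny: "(norm y)\<^sup>2 > 0" using False by simp
    have "J (x + t *\<^sub>R y) = J x + t\<^sup>2 * (norm y)\<^sup>2 - 2 * t * a"
      unfolding J_def power2_norm_eq_inner f.scaleR f.add a_def
      by (simp add: inner_diff_left inner_diff_right inner_add_left inner_add_right inner_commute algebra_simps power2_eq_square)
    also have "\<dots> = J x - a\<^sup>2 / (norm y)\<^sup>2"
      using ny unfolding t_def by (simp add: field_simps power2_eq_square)
    finally have "a\<^sup>2 / (norm y)\<^sup>2 \<le> 0" using min[of "x + t *\<^sub>R y"] by simp
    then have "a = 0" using ny by (simp add: divide_le_0_iff)
    then show ?thesis by (simp add: a_def)
  qed simp
  then show ?thesis by blast
qed


text \<open>Multiplying \<open>y\<close> by a unimodular factor makes the inner product real and
  nonnegative, and the real Cauchy-Schwarz inequality applies.\<close>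

lemma cmod_cinner_le:
  fixes x y :: "'h::complex_hilbert"
  shows "cmod (cinner x y) \<le> norm x * norm y"
proof (cases "cinner x y = 0")
  case False
  define c where "c = cnj (cinner x y) / cmod (cinner x y)"
  have c: "cmod c = 1" using False by (simp add: c_def norm_divide)
  have "norm (scaleC c y) = norm y"
  proof -
    have "cinner (scaleC c y) (scaleC c y) = (c * cnj c) * cinner y y"
      by (metis cinner_commute cinner_scaleC_right complex_cnj_mult mult.assoc)
    then have "inner (scaleC c y) (scaleC c y) = inner y y"
      using c by (simp add: inner_eq_Re_cinner complex_norm_square[symmetric])
    then show ?thesis by (simp add: norm_eq_sqrt_inner)
  qed
  moreover have "inner x (scaleC c y) = cmod (cinner x y)"
    using False by (simp add: inner_eq_Re_cinner cinner_scaleC_right c_def mult.commute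
        complex_norm_square[symmetric] power2_eq_square)
  ultimately show ?thesis using norm_cauchy_schwarz[of x "scaleC c y"] by simp
qed simp

text \<open>Only the real part of \<open>f\<close> is represented by the real theorem; complex
  linearity recovers the imaginary part by evaluating at \<i> times \<open>x\<close>.\<close>

lemma complex_riesz_representation:
  fixes f :: "'h::complex_hilbert \<Rightarrow> complex"
  assumes add: "\<And>x y. f (x + y) = f x + f y"
    and scale: "\<And>c x. f (scaleC c x) = c * f x"
    and bound: "\<And>x. cmod (f x) \<le> K * norm x"
  shows "\<exists>g. \<forall>x. cinner g x = f x"
proof -
  have "bounded_linear (\<lambda>x. Re (f x))"
  proof (rule bounded_linear_intro)
    show "norm (Re (f x)) \<le> norm x * K" for x
      using bound[of x] abs_Re_le_cmod[of "f x"] by (simp add: mult.commute)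
  qed (simp_all add: add scale scaleR_eq_scaleC)
  from riesz_representation[OF this] obtain g where g: "\<And>x. Re (f x) = inner g x" by blast
  have "cinner g x = f x" for x
  proof (rule complex_eqI)
    show "Re (cinner g x) = Re (f x)" using g[of x] by (simp add: inner_eq_Re_cinner)
    have "Re (cinner g (scaleC \<i> x)) = Re (f (scaleC \<i> x))"
      using g by (simp add: inner_eq_Re_cinner)
    then show "Im (cinner g x) = Im (f x)" by (simp add: cinner_scaleC_right scale)
  qed
  then show ?thesis by blast
qed

subsection \<open>Weighted spaces and the compactness of the perturbation\<close>

lemma weight_pos [simp]: "weight s p > 0"
proof (cases p)
  case (Ray a m)
  have "1 + (1 + real m)\<^sup>2 > 0" by (simp add: add_pos_nonneg)
  then show ?thesis using Ray by simp
qed simp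

lemma weight_nonneg [simp]: "weight s p \<ge> 0"
  using weight_pos less_imp_le by blast

lemma weight_neq_0 [simp]: "weight s p \<noteq> 0"
  using weight_pos[of s p] by linarith

lemma weight_minus: "weight (- s) p = inverse (weight s p)"
  by (cases p) (auto simp: powr_minus)

lemma weight_mono: "s \<le> t \<Longrightarrow> weight s p \<le> weight t p"
  by (cases p) (auto intro!: powr_mono)

lemma weight_ge_1: "s \<ge> 0 \<Longrightarrow> weight s p \<ge> 1"
  by (cases p) (auto intro!: ge_one_powr_ge_zero)

lemma smul_apply [simp]: "smul c u p = c * u p"
  by (simp add: smul_def)

lemma LdualI:
  assumes "\<And>p. cmod (u p) \<le> C * weight s p"
  shows "u \<in> Ldual s" and "normLdual s u \<le> C"
proof -
  have *: "weight (- s) p * cmod (u p) \<le> C" for p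
    using assms[of p] by (simp add: weight_minus field_simps)
  show "u \<in> Ldual s" unfolding Ldual_def using * by (auto intro!: bdd_aboveI)
  show "normLdual s u \<le> C" unfolding normLdual_def using * by (auto intro: cSUP_least)
qed

lemma Ldual_bound:
  assumes "u \<in> Ldual s"
  shows "cmod (u p) \<le> normLdual s u * weight s p"
proof -
  have "weight (- s) p * cmod (u p) \<le> normLdual s u"
    unfolding normLdual_def using assms by (intro cSUP_upper) (auto simp: Ldual_def)
  then show ?thesis by (simp add: weight_minus field_simps)
qed

lemma normLdual_nonneg: "u \<in> Ldual s \<Longrightarrow> normLdual s u \<ge> 0"
  using Ldual_bound[of u s undefined] weight_pos[of s undefined]
  by (smt (verit) mult_neg_pos norm_ge_zero)

lemma Ldual_zero [simp]: "0 \<in> Ldual s" "normLdual s 0 = 0"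
proof -
  show "0 \<in> Ldual s" by (rule LdualI[of _ 0]) auto
  moreover have "normLdual s 0 \<le> 0" by (rule LdualI(2)) auto
  ultimately show "normLdual s 0 = 0" using normLdual_nonneg by (metis order_antisym)
qed

lemma Ldual_add:
  assumes "u \<in> Ldual s" "w \<in> Ldual s"
  shows "u + w \<in> Ldual s" and "normLdual s (u + w) \<le> normLdual s u + normLdual s w"
proof -
  have *: "cmod ((u + w) p) \<le> (normLdual s u + normLdual s w) * weight s p" for p
    using norm_triangle_ineq[of "u p" "w p"] Ldual_bound[OF assms(1), of p] Ldual_bound[OF assms(2), of p]
    by (simp add: algebra_simps)
  show "u + w \<in> Ldual s" "normLdual s (u + w) \<le> normLdual s u + normLdual s w"
    by (rule LdualI, rule *)+
qed

lemma Ldual_smul: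
  assumes "u \<in> Ldual s"
  shows "smul c u \<in> Ldual s" and "normLdual s (smul c u) \<le> cmod c * normLdual s u"
proof -
  have *: "cmod (smul c u p) \<le> (cmod c * normLdual s u) * weight s p" for p
    using mult_left_mono[OF Ldual_bound[OF assms, of p] norm_ge_zero[of c]]
    by (simp add: norm_mult algebra_simps)
  show "smul c u \<in> Ldual s" "normLdual s (smul c u) \<le> cmod c * normLdual s u"
    by (rule LdualI, rule *)+
qed

lemma smul_minus_one: "smul (-1) u = - u"
  by (auto simp: fun_eq_iff)

lemma Ldual_uminus:
  assumes "u \<in> Ldual s"
  shows "- u \<in> Ldual s" and "normLdual s (- u) \<le> normLdual s u"
  using Ldual_smul[OF assms, of "-1"] by (auto simp: smul_minus_one)

lemma Ldual_diff:
  assumes "u \<in> Ldual s" "w \<in> Ldual s"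
  shows "u - w \<in> Ldual s" and "normLdual s (u - w) \<le> normLdual s u + normLdual s w"
  using Ldual_add[OF assms(1) Ldual_uminus(1)[OF assms(2)]] Ldual_uminus(2)[OF assms(2)] by auto

lemma Ldual_sum:
  assumes "finite F" "\<And>i. i \<in> F \<Longrightarrow> u i \<in> Ldual s"
  shows "(\<Sum>i\<in>F. u i) \<in> Ldual s"
    and "normLdual s (\<Sum>i\<in>F. u i) \<le> (\<Sum>i\<in>F. normLdual s (u i))"
proof -
  have "(\<Sum>i\<in>F. u i) \<in> Ldual s \<and> normLdual s (\<Sum>i\<in>F. u i) \<le> (\<Sum>i\<in>F. normLdual s (u i))"
    using assms by (induction F rule: finite_induct) (auto intro: Ldual_add order_trans[OF Ldual_add(2)])
  then show "(\<Sum>i\<in>F. u i) \<in> Ldual s"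
    and "normLdual s (\<Sum>i\<in>F. u i) \<le> (\<Sum>i\<in>F. normLdual s (u i))" by auto
qed

lemma Ldual_mono:
  assumes "s \<le> t" "u \<in> Ldual s"
  shows "u \<in> Ldual t" and "normLdual t u \<le> normLdual s u"
proof -
  have *: "cmod (u p) \<le> normLdual s u * weight t p" for p
    using Ldual_bound[OF assms(2), of p] mult_left_mono[OF weight_mono[OF assms(1), of p] normLdual_nonneg[OF assms(2)]]
    by linarith
  show "u \<in> Ldual t" "normLdual t u \<le> normLdual s u" by (rule LdualI, rule *)+
qed

lemma LspI:
  assumes "\<And>F. finite F \<Longrightarrow> (\<Sum>p\<in>F. weight s p * cmod (u p)) \<le> C"
  shows "u \<in> Lsp s" and "normL s u \<le> C"
proof -
  have "(\<lambda>p. weight s p * cmod (u p)) summable_on UNIV"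
    by (rule nonneg_bdd_above_summable_on) (auto intro!: bdd_aboveI[of _ C] assms)
  then show "u \<in> Lsp s" "normL s u \<le> C"
    unfolding Lsp_def normL_def using assms by (auto intro!: infsum_le_finite_sums)
qed

lemma Lsp_sum_le:
  assumes "u \<in> Lsp s" "finite F"
  shows "(\<Sum>p\<in>F. weight s p * cmod (u p)) \<le> normL s u"
  unfolding normL_def using assms by (intro finite_sum_le_infsum) (auto simp: Lsp_def)

lemma normL_nonneg: "normL s u \<ge> 0"
  unfolding normL_def by (intro infsum_nonneg) auto

lemma Lsp_zero [simp]: "0 \<in> Lsp s" "normL s 0 = 0"
  by (auto simp: Lsp_def normL_def)

lemma Lsp_add:
  assumes "u \<in> Lsp s" "w \<in> Lsp s"
  shows "u + w \<in> Lsp s" and "normL s (u + w) \<le> normL s u + normL s w"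
proof -
  have *: "(\<Sum>p\<in>F. weight s p * cmod ((u + w) p)) \<le> normL s u + normL s w" if "finite F" for F
  proof -
    have "(\<Sum>p\<in>F. weight s p * cmod ((u + w) p)) \<le>
        (\<Sum>p\<in>F. weight s p * cmod (u p) + weight s p * cmod (w p))"
      unfolding plus_fun_apply distrib_left[symmetric]
      by (intro sum_mono mult_left_mono norm_triangle_ineq) auto
    also have "\<dots> \<le> normL s u + normL s w"
      using Lsp_sum_le[OF assms(1) that] Lsp_sum_le[OF assms(2) that] by (simp add: sum.distrib)
    finally show ?thesis .
  qed
  show "u + w \<in> Lsp s" "normL s (u + w) \<le> normL s u + normL s w" by (rule LspI, erule *)+
qed

lemma Lsp_smul:
  assumes "u \<in> Lsp s"
  shows "smul c u \<in> Lsp s" and "normL s (smul c u) \<le> cmod c * normL s u"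
proof -
  have *: "(\<Sum>p\<in>F. weight s p * cmod (smul c u p)) \<le> cmod c * normL s u" if "finite F" for F
  proof -
    have "(\<Sum>p\<in>F. weight s p * cmod (smul c u p)) = cmod c * (\<Sum>p\<in>F. weight s p * cmod (u p))"
      by (simp add: norm_mult sum_distrib_left algebra_simps)
    then show ?thesis using mult_left_mono[OF Lsp_sum_le[OF assms that] norm_ge_zero[of c]] by simp
  qed
  show "smul c u \<in> Lsp s" "normL s (smul c u) \<le> cmod c * normL s u" by (rule LspI, erule *)+
qed

lemma Lsp_uminus: "u \<in> Lsp s \<Longrightarrow> - u \<in> Lsp s"
  using Lsp_smul(1)[of u s "-1"] by (simp add: smul_minus_one)

lemma Lsp_mono:
  assumes "s \<le> t" "u \<in> Lsp t"
  shows "u \<in> Lsp s" and "normL s u \<le> normL t u"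
proof -
  have *: "(\<Sum>p\<in>F. weight s p * cmod (u p)) \<le> normL t u" if "finite F" for F
    using Lsp_sum_le[OF assms(2) that]
      sum_mono[of F "\<lambda>p. weight s p * cmod (u p)" "\<lambda>p. weight t p * cmod (u p)"]
      mult_right_mono[OF weight_mono[OF assms(1)] norm_ge_zero] by force
  show "u \<in> Lsp s" "normL s u \<le> normL t u" by (rule LspI, erule *)+
qed

lemma Lsp_comparison:
  assumes "u \<in> Lsp s" "\<And>p. cmod (a p) \<le> C * weight s p"
  shows "(\<lambda>p. a p * u p) summable_on UNIV"
    and "cmod (\<Sum>\<^sub>\<infinity>p. a p * u p) \<le> C * normL s u"
proof -
  have le: "norm (a p * u p) \<le> C * (weight s p * cmod (u p))" for p
    using mult_right_mono[OF assms(2)[of p] norm_ge_zero[of "u p"]] by (simp add: norm_mult algebra_simps)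
  have sum: "(\<lambda>p. C * (weight s p * cmod (u p))) summable_on UNIV"
    using assms(1) unfolding Lsp_def by (intro summable_on_cmult_right) auto
  have abs: "(\<lambda>p. norm (a p * u p)) summable_on UNIV"
    by (rule summable_on_comparison_test[OF sum]) (use le in auto)
  then show "(\<lambda>p. a p * u p) summable_on UNIV" by (rule abs_summable_summable)
  have "cmod (\<Sum>\<^sub>\<infinity>p. a p * u p) \<le> (\<Sum>\<^sub>\<infinity>p. norm (a p * u p))" using abs by (rule norm_infsum_bound)
  also have "\<dots> \<le> (\<Sum>\<^sub>\<infinity>p. C * (weight s p * cmod (u p)))" by (rule infsum_mono[OF abs sum le])
  also have "\<dots> = C * normL s u" unfolding normL_def
    by (rule infsum_cmult_right) (use assms(1) in \<open>simp add: Lsp_def\<close>)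
  finally show "cmod (\<Sum>\<^sub>\<infinity>p. a p * u p) \<le> C * normL s u" .
qed

lemma pairing_summable:
  assumes "u \<in> Ldual s" "w \<in> Lsp s"
  shows "(\<lambda>p. cnj (u p) * w p) summable_on UNIV"
    and "cmod (pairing u w) \<le> normLdual s u * normL s w"
  unfolding pairing_def using Lsp_comparison[OF assms(2), of "\<lambda>p. cnj (u p)"] Ldual_bound[OF assms(1)] by auto

section \<open>The factored perturbation: smallness off a finite set\<close>

locale factored_perturbation =
  fixes \<beta> :: real and V :: "('k::finite, 'n::finite) oper"
    and v :: "'h::complex_hilbert \<Rightarrow> ('k, 'n) state" and U :: "'h \<Rightarrow> 'h"
  assumes asm_A: "assumption_A \<beta> V v U"
begin

lemma v_props:
  "v f \<in> Lsp \<beta>" "v (f + g) = v f + v g" "v (scaleC c f) = smul c (v f)"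
  using asm_A by (auto simp: assumption_A_def)

definition v_bound :: real where
  "v_bound = (SOME C. C \<ge> 0 \<and> (\<forall>f. normL \<beta> (v f) \<le> C * norm f))"

lemma v_bound: "v_bound \<ge> 0" "normL \<beta> (v f) \<le> v_bound * norm f"
proof -
  obtain C where C: "\<And>f. normL \<beta> (v f) \<le> C * norm f" using asm_A by (auto simp: assumption_A_def)
  have "normL \<beta> (v f) \<le> max C 0 * norm f" for f
    using C[of f] by (smt (verit, best) mult_right_mono norm_ge_zero)
  then have "\<exists>C\<ge>0. \<forall>f. normL \<beta> (v f) \<le> C * norm f" by (intro exI[of _ "max C 0"]) auto
  from someI_ex[OF this] show "v_bound \<ge> 0" "normL \<beta> (v f) \<le> v_bound * norm f"
    by (auto simp: v_bound_def)
qed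

text \<open>This shows that the description defining \<open>adj\<close> denotes: pairing with
  \<open>u\<close> is bounded on \<open>Lsp \<beta>\<close>, so its composition with
  \<open>v\<close> is a bounded functional, and the inner product separates vectors.\<close>

lemma adj_eq:
  assumes u: "u \<in> Ldual \<beta>"
  shows "cinner (adj v u) f = pairing u (v f)"
proof -
  have "\<exists>g. \<forall>f. cinner g f = pairing u (v f)"
  proof (rule complex_riesz_representation)
    fix f g c
    show "pairing u (v (f + g)) = pairing u (v f) + pairing u (v g)"
      unfolding v_props pairing_def plus_fun_apply distrib_left
      by (rule infsum_add) (use pairing_summable(1)[OF u] v_props in auto)
    show "pairing u (v (scaleC c f)) = c * pairing u (v f)"
    proof -
      have "pairing u (v (scaleC c f)) = (\<Sum>\<^sub>\<infinity>p. c * (cnj (u p) * v f p))"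
        unfolding v_props pairing_def smul_apply by (simp add: algebra_simps)
      also have "\<dots> = c * pairing u (v f)" unfolding pairing_def
        by (rule infsum_cmult_right) (use pairing_summable(1)[OF u] v_props in auto)
      finally show ?thesis .
    qed
    show "cmod (pairing u (v f)) \<le> (normLdual \<beta> u * v_bound) * norm f"
      using pairing_summable(2)[OF u v_props(1), of f] mult_left_mono[OF v_bound(2)[of f] normLdual_nonneg[OF u]]
      by (simp add: algebra_simps)
  qed
  moreover have "g = g'" if "\<forall>f. cinner g f = pairing u (v f)" "\<forall>f. cinner g' f = pairing u (v f)" for g g' :: 'h
  proof -
    have "inner g (g - g') = inner g' (g - g')" using that by (simp add: inner_eq_Re_cinner)
    then have "inner (g - g') (g - g') = 0" by (simp add: inner_diff_left)
    then show ?thesis by simp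
  qed
  ultimately have "\<exists>!g. \<forall>f. cinner g f = pairing u (v f)" by blast
  from theI'[OF this] show ?thesis unfolding adj_def by blast
qed

lemma inner_adj: "u \<in> Ldual \<beta> \<Longrightarrow> inner (adj v u) f = Re (pairing u (v f))"
  by (simp add: inner_eq_Re_cinner adj_eq)

lemma norm_adj_le:
  assumes u: "u \<in> Ldual \<beta>" and "C \<ge> 0" and C: "\<And>f. cmod (pairing u (v f)) \<le> C * norm f"
  shows "norm (adj v u) \<le> C"
proof (cases "adj v u = 0")
  case False
  have "(norm (adj v u))\<^sup>2 = Re (pairing u (v (adj v u)))"
    using inner_adj[OF u] by (simp add: power2_norm_eq_inner)
  also have "\<dots> \<le> C * norm (adj v u)" using C complex_Re_le_cmod order_trans by blast
  finally show ?thesis using False by (simp add: power2_eq_square)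
qed (use assms in simp)

lemma norm_adj: 
  assumes u: "u \<in> Ldual \<beta>"
  shows "norm (adj v u) \<le> v_bound * normLdual \<beta> u"
proof (rule norm_adj_le[OF u])
  show "cmod (pairing u (v f)) \<le> v_bound * normLdual \<beta> u * norm f" for f
    using pairing_summable(2)[OF u v_props(1), of f] mult_left_mono[OF v_bound(2)[of f] normLdual_nonneg[OF u]]
    by (simp add: algebra_simps)
qed (use v_bound normLdual_nonneg[OF u] in auto)

lemma adj_additive:
  assumes u: "u \<in> Ldual \<beta>" and w: "w \<in> Ldual \<beta>"
  shows "adj v (u + w) = adj v u + adj v w" and "adj v (- u) = - adj v u"
proof -
  have "inner (adj v (u + w)) f = inner (adj v u + adj v w) f" for f
    using u w unfolding inner_add_left inner_adj[OF u] inner_adj[OF w] inner_adj[OF Ldual_add(1)[OF u w]]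
      pairing_def plus_fun_apply complex_cnj_add distrib_right
    by (subst infsum_add) (auto intro!: pairing_summable(1) v_props)
  then show "adj v (u + w) = adj v u + adj v w" using vector_eq_rdot by blast
  have "inner (adj v (- u)) f = inner (- adj v u) f" for f
    using u unfolding inner_minus_left inner_adj[OF u] inner_adj[OF Ldual_uminus(1)[OF u]] pairing_def
    using infsum_uminus[of "\<lambda>p. cnj (u p) * v f p" UNIV] by simp
  then show "adj v (- u) = - adj v u" using vector_eq_rdot by blast
qed

text \<open>In a Hilbert space one of the two signs gives
  \<open>\<parallel>a \<plusminus> b\<parallel>\<^sup>2 \<ge> \<parallel>a\<parallel>\<^sup>2 + \<parallel>b\<parallel>\<^sup>2\<close>. If arbitrarily remote functions in the unit ball had images
  of norm \<open>> e\<close> under \<open>v\<^sup>*\<close>, adding them up greedily with suitable signs would contradict the boundedness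
  of \<open>v\<^sup>*\<close>.\<close>

lemma adj_small_of_finite_support:
  assumes e: "e > 0"
  shows "\<exists>F. finite F \<and> (\<forall>u. finite {p. u p \<noteq> 0} \<longrightarrow> (\<forall>p\<in>F. u p = 0) \<longrightarrow>
    (\<forall>p. cmod (u p) \<le> weight \<beta> p) \<longrightarrow> norm (adj v u) \<le> e)"
proof (rule ccontr)
  assume neg: "\<not> ?thesis"
  have ex: "\<exists>u. finite {p. u p \<noteq> 0} \<and> (\<forall>p. cmod (u p) \<le> weight \<beta> p) \<and> (norm (adj v u))\<^sup>2 \<ge> n * e\<^sup>2" for n :: nat
  proof (induction n)
    case 0
    show ?case by (intro exI[of _ 0]) auto
  next
    case (Suc n)
    then obtain u where u: "finite {p. u p \<noteq> 0}" "\<And>p. cmod (u p) \<le> weight \<beta> p" "(norm (adj v u))\<^sup>2 \<ge> n * e\<^sup>2"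
      by blast
    obtain w where w: "finite {p. w p \<noteq> 0}" "\<And>p. u p \<noteq> 0 \<Longrightarrow> w p = 0" "\<And>p. cmod (w p) \<le> weight \<beta> p"
      "norm (adj v w) > e"
    proof -
      have "\<exists>w. finite {p. w p \<noteq> 0} \<and> (\<forall>p\<in>{p. u p \<noteq> 0}. w p = 0) \<and>
          (\<forall>p. cmod (w p) \<le> weight \<beta> p) \<and> \<not> norm (adj v w) \<le> e"
        using neg u(1) by blast
      then show ?thesis using that by (auto simp: not_le)
    qed
    have uL: "u \<in> Ldual \<beta>" and wL: "w \<in> Ldual \<beta>" 
      using u(2) w(3) by (auto intro!: LdualI[where C = 1])
    have sq: "(norm (adj v u))\<^sup>2 + (norm (adj v w))\<^sup>2 \<ge> Suc n * e\<^sup>2"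
    proof -
      have "(norm (adj v w))\<^sup>2 \<ge> e\<^sup>2" using w(4) e by (intro power_mono) auto
      then show ?thesis using u(3) by (simp add: algebra_simps)
    qed
    \<comment> \<open>The negated claim was applied with \<open>F\<close> the support of
      \<open>u\<close>, so the supports of \<open>u\<close> and \<open>w\<close> are disjoint and no
      combination with unimodular coefficients leaves the unit ball of the weighted sup
      norm.\<close>
    have wt: "cmod (u p + c * w p) \<le> weight \<beta> p" if "cmod c = 1" for c p
      using u(2)[of p] w(2)[of p] w(3)[of p] that by (cases "u p = 0") (auto simp: norm_mult)
    show ?case
    proof (cases "inner (adj v u) (adj v w) \<ge> 0")
      case True
      then have "Suc n * e\<^sup>2 \<le> (norm (adj v (u + w)))\<^sup>2"
        using sq unfolding adj_additive(1)[OF uL wL] power2_norm_eq_inner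
        by (simp add: inner_add_left inner_add_right inner_commute)
      moreover have "finite {p. (u + w) p \<noteq> 0}"
        by (rule finite_subset[OF _ finite_UnI[OF u(1) w(1)]]) auto
      moreover have "\<forall>p. cmod ((u + w) p) \<le> weight \<beta> p" using wt[of 1] by simp
      ultimately show ?thesis by blast
    next
      case False
      then have "Suc n * e\<^sup>2 \<le> (norm (adj v (u + - w)))\<^sup>2"
        using sq unfolding adj_additive(1)[OF uL Ldual_uminus(1)[OF wL]] adj_additive(2)[OF wL uL] power2_norm_eq_inner
        by (simp add: inner_diff_left inner_diff_right inner_commute)
      moreover have "finite {p. (u + - w) p \<noteq> 0}"
        by (rule finite_subset[OF _ finite_UnI[OF u(1) w(1)]]) auto
      moreover have "\<forall>p. cmod ((u + - w) p) \<le> weight \<beta> p" using wt[of "-1"] by simp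
      ultimately show ?thesis by blast
    qed
  qed
  obtain n :: nat where n: "v_bound\<^sup>2 < n * e\<^sup>2"
    using e reals_Archimedean3[of "e\<^sup>2"] by auto
  from ex[of n] obtain u where u: "\<And>p. cmod (u p) \<le> weight \<beta> p" "(norm (adj v u))\<^sup>2 \<ge> n * e\<^sup>2" by blast
  have uL: "u \<in> Ldual \<beta>" "normLdual \<beta> u \<le> 1" using u(1) by (auto intro!: LdualI[where C = 1])
  have "norm (adj v u) \<le> v_bound"
    using norm_adj[OF uL(1)] mult_left_mono[OF uL(2) v_bound(1)] by simp
  then have "(norm (adj v u))\<^sup>2 \<le> v_bound\<^sup>2" by (intro power_mono) auto
  then show False using n u(2) by linarith
qed

text \<open>Finite truncations need not approximate \<open>u\<close> in the weighted sup norm. For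
  each fixed \<open>f\<close>, however, the pairing with \<open>v f\<close> is the limit of the
  pairings with truncations, and the bound for these is uniform enough to survive the limit.\<close>

lemma adj_small:
  assumes e: "e > 0"
  shows "\<exists>F. finite F \<and> (\<forall>u\<in>Ldual \<beta>. (\<forall>p\<in>F. u p = 0) \<longrightarrow> norm (adj v u) \<le> e * normLdual \<beta> u)"
proof -
  obtain F where F: "finite F" "\<And>u. finite {p. u p \<noteq> 0} \<Longrightarrow> (\<forall>p\<in>F. u p = 0) \<Longrightarrow>
    (\<forall>p. cmod (u p) \<le> weight \<beta> p) \<Longrightarrow> norm (adj v u) \<le> e"
    using adj_small_of_finite_support[OF e] by blast
  have "norm (adj v u) \<le> e * normLdual \<beta> u" if u: "u \<in> Ldual \<beta>" "\<forall>p\<in>F. u p = 0" for u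
  proof (cases "normLdual \<beta> u = 0")
    case True
    then show ?thesis using norm_adj[OF u(1)] by simp
  next
    case False
    define c where "c = normLdual \<beta> u"
    have c: "c > 0" using False normLdual_nonneg[OF u(1)] by (simp add: c_def)
    show ?thesis
    proof (rule norm_adj_le[OF u(1)])
      fix f
      have fin: "cmod (\<Sum>p\<in>B. cnj (u p) * v f p) \<le> e * c * norm f" if B: "finite B" for B
      proof -
        define w where "w p = (if p \<in> B then u p / c else 0)" for p
        have w1: "cmod (w p) \<le> weight \<beta> p" for p
        proof -
          have "cmod (u p) / c \<le> weight \<beta> p"
            using Ldual_bound[OF u(1), of p] c by (simp add: c_def[symmetric] field_simps)
          then show ?thesis using c by (simp add: w_def norm_divide)
        qed
        have wL: "w \<in> Ldual \<beta>" using w1 by (auto intro!: LdualI[where C = 1])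
        have "norm (adj v w) \<le> e"
        proof (rule F(2))
          show "finite {p. w p \<noteq> 0}" by (rule finite_subset[OF _ B]) (auto simp: w_def)
          show "\<forall>p\<in>F. w p = 0" using u(2) by (simp add: w_def)
        qed (use w1 in blast)
        moreover have "cmod (cinner (adj v w) f) \<le> norm (adj v w) * norm f"
          by (rule cmod_cinner_le)
        ultimately have "cmod (pairing w (v f)) \<le> e * norm f"
          using adj_eq[OF wL] by (metis mult_right_mono norm_ge_zero order_trans)
        moreover have "(\<Sum>p\<in>B. cnj (u p) * v f p) = c * pairing w (v f)"
        proof -
          have "pairing w (v f) = (\<Sum>\<^sub>\<infinity>p\<in>B. cnj (w p) * v f p)"
            unfolding pairing_def by (rule infsum_cong_neutral) (auto simp: w_def)
          also have "\<dots> = (\<Sum>p\<in>B. cnj (u p) * v f p / c)"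
            using B by (simp add: w_def)
          finally show ?thesis using c by (simp add: sum_distrib_left)
        qed
        ultimately show ?thesis using c by (simp add: norm_mult)
      qed
      have "((\<lambda>p. cnj (u p) * v f p) has_sum pairing u (v f)) UNIV"
        unfolding pairing_def by (intro has_sum_infsum pairing_summable(1)[OF u(1) v_props(1)])
      then have "((\<lambda>B. cmod (\<Sum>p\<in>B. cnj (u p) * v f p)) \<longlongrightarrow> cmod (pairing u (v f))) (finite_subsets_at_top UNIV)"
        unfolding has_sum_def by (rule tendsto_norm)
      then show "cmod (pairing u (v f)) \<le> e * normLdual \<beta> u * norm f"
        by (rule tendsto_upperbound)
          (auto intro!: eventually_finite_subsets_at_top_weakI fin simp: c_def[symmetric])
    qed (use e c in \<open>auto simp: c_def\<close>)
  qed
  then show ?thesis using F(1) by blast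
qed

lemma norm_U: "norm (U f) = norm f"
proof -
  have "cinner (U f) (U f) = cinner f f" using asm_A unfolding assumption_A_def by blast
  then show ?thesis by (simp add: norm_eq_sqrt_inner inner_eq_Re_cinner)
qed

lemma V_eq: "u \<in> Ldual \<beta> \<Longrightarrow> V u = v (U (adj v u))"
  using asm_A by (simp add: assumption_A_def)

lemma V_small:
  assumes e: "e > 0"
  shows "\<exists>F. finite F \<and> (\<forall>u\<in>Ldual \<beta>. (\<forall>p\<in>F. u p = 0) \<longrightarrow> normL \<beta> (V u) \<le> e * normLdual \<beta> u)"
proof -
  \<comment> \<open>Adding 1 keeps the divisor positive when \<open>v_bound\<close> is 0.\<close>
  have e': "e / (v_bound + 1) > 0" using e v_bound(1) by simp
  from adj_small[OF e'] obtain F where F: "finite F"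
    "\<And>u. u \<in> Ldual \<beta> \<Longrightarrow> \<forall>p\<in>F. u p = 0 \<Longrightarrow> norm (adj v u) \<le> e / (v_bound + 1) * normLdual \<beta> u" by blast
  have "normL \<beta> (V u) \<le> e * normLdual \<beta> u" if u: "u \<in> Ldual \<beta>" "\<forall>p\<in>F. u p = 0" for u
  proof -
    have "normL \<beta> (V u) \<le> v_bound * norm (adj v u)"
      using v_bound(2)[of "U (adj v u)"] by (simp add: V_eq[OF u(1)] norm_U)
    also have "\<dots> \<le> (v_bound + 1) * (e / (v_bound + 1) * normLdual \<beta> u)"
      using v_bound(1) F(2)[OF u] by (intro mult_mono) auto
    also have "\<dots> = e * normLdual \<beta> u" using v_bound(1) by (simp add: field_simps)
    finally show ?thesis .
  qed
  then show ?thesis using F(1) by blast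
qed

end

subsection \<open>Operators with a kernel\<close>

lemma has_sum_finite_sum:
  fixes f :: "'i \<Rightarrow> 'a \<Rightarrow> 'b::topological_comm_monoid_add"
  assumes "finite F" "\<And>i. i \<in> F \<Longrightarrow> (f i has_sum S i) A"
  shows "((\<lambda>x. \<Sum>i\<in>F. f i x) has_sum (\<Sum>i\<in>F. S i)) A"
  using assms by (induction F rule: finite_induct) (auto intro: has_sum_add)

lemma infsum_finite_sum:
  fixes f :: "'i \<Rightarrow> 'a \<Rightarrow> real"
  assumes "finite F" "\<And>i. f i summable_on A"
  shows "(\<lambda>x. \<Sum>i\<in>F. f i x) summable_on A" and "(\<Sum>\<^sub>\<infinity>x\<in>A. \<Sum>i\<in>F. f i x) = (\<Sum>i\<in>F. \<Sum>\<^sub>\<infinity>x\<in>A. f i x)"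
proof -
  have "((\<lambda>x. \<Sum>i\<in>F. f i x) has_sum (\<Sum>i\<in>F. \<Sum>\<^sub>\<infinity>x\<in>A. f i x)) A"
    by (rule has_sum_finite_sum[OF assms(1)]) (rule has_sum_infsum[OF assms(2)])
  then show "(\<lambda>x. \<Sum>i\<in>F. f i x) summable_on A"
    and "(\<Sum>\<^sub>\<infinity>x\<in>A. \<Sum>i\<in>F. f i x) = (\<Sum>i\<in>F. \<Sum>\<^sub>\<infinity>x\<in>A. f i x)"
    by (auto simp: summable_on_def infsumI)
qed

definition kernel_op :: "(('k, 'n) vertex \<Rightarrow> ('k, 'n) vertex \<Rightarrow> complex) \<Rightarrow> ('k, 'n) oper" where
  "kernel_op k u p = (\<Sum>\<^sub>\<infinity>q. k p q * u q)"

text \<open>From weighted \<ell>-one to its dual, a pointwise bound of the kernel by the product of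
  the weights is already an operator bound with the same constant. Expansions in operator norm thus
  reduce to estimates of single entries.\<close>

definition kernel_bound :: "real \<Rightarrow> real \<Rightarrow> (('k, 'n) vertex \<Rightarrow> ('k, 'n) vertex \<Rightarrow> complex) \<Rightarrow> bool" where
  "kernel_bound s C k \<longleftrightarrow> (\<forall>p q. cmod (k p q) \<le> C * weight s p * weight s q)"

lemma kernel_summable:
  assumes "kernel_bound s C k" "u \<in> Lsp s"
  shows "(\<lambda>q. k p q * u q) summable_on UNIV"
  using Lsp_comparison(1)[OF assms(2), of "k p" "C * weight s p"] assms(1) by (simp add: kernel_bound_def)

lemma kernel_op_Ldual:
  assumes "kernel_bound s C k" "u \<in> Lsp s"
  shows "kernel_op k u \<in> Ldual s" and "normLdual s (kernel_op k u) \<le> C * normL s u"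
proof -
  have *: "cmod (kernel_op k u p) \<le> (C * normL s u) * weight s p" for p
  proof -
    have "cmod (k p q) \<le> (C * weight s p) * weight s q" for q
      using assms(1) by (simp add: kernel_bound_def)
    from Lsp_comparison(2)[OF assms(2) this] show ?thesis by (simp add: kernel_op_def mult.commute mult.left_commute)
  qed
  show "kernel_op k u \<in> Ldual s" "normLdual s (kernel_op k u) \<le> C * normL s u"
    by (rule LdualI, rule *)+
qed

lemma kernel_op_add:
  assumes "kernel_bound s C k" "u \<in> Lsp s" "w \<in> Lsp s"
  shows "kernel_op k (u + w) = kernel_op k u + kernel_op k w"
  using kernel_summable[OF assms(1,2)] kernel_summable[OF assms(1,3)]
  by (auto simp: fun_eq_iff kernel_op_def distrib_left infsum_add)

lemma kernel_op_smul:
  assumes "kernel_bound s C k" "u \<in> Lsp s"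
  shows "kernel_op k (smul c u) = smul c (kernel_op k u)"
proof -
  have "kernel_op k (smul c u) p = c * kernel_op k u p" for p
    unfolding kernel_op_def infsum_cmult_right[OF kernel_summable[OF assms], symmetric]
    by (simp add: algebra_simps)
  then show ?thesis by (auto simp: fun_eq_iff)
qed

lemma kernel_op_kernel_diff:
  assumes "kernel_bound s C k" "kernel_bound s C' k'" "u \<in> Lsp s"
  shows "kernel_op (\<lambda>p q. k p q - c * k' p q) u = kernel_op k u - smul c (kernel_op k' u)"
proof -
  have "kernel_op (\<lambda>p q. k p q - c * k' p q) u p = kernel_op k u p - c * kernel_op k' u p" for p
  proof -
    have "kernel_op (\<lambda>p q. k p q - c * k' p q) u p = (\<Sum>\<^sub>\<infinity>q. k p q * u q + (- c) * (k' p q * u q))"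
      unfolding kernel_op_def by (simp add: algebra_simps)
    also have "\<dots> = kernel_op k u p + (\<Sum>\<^sub>\<infinity>q. (- c) * (k' p q * u q))"
      unfolding kernel_op_def using kernel_summable[OF assms(1,3)] kernel_summable[OF assms(2,3)]
      by (intro infsum_add summable_on_cmult_right)
    also have "(\<Sum>\<^sub>\<infinity>q. (- c) * (k' p q * u q)) = - c * kernel_op k' u p"
      unfolding kernel_op_def by (rule infsum_cmult_right) (use kernel_summable[OF assms(2,3)] in auto)
    finally show ?thesis by simp
  qed
  then show ?thesis by (auto simp: fun_eq_iff)
qed

text \<open>By exchanging sums, an \<ell>-one bound on the image follows from weighted column sums.
  The row condition only makes each value converge, so its constant may depend on
  \<open>p\<close>.\<close>

lemma kernel_op_Lsp:
  assumes rows: "\<And>p. \<exists>C. \<forall>q. cmod (k p q) \<le> C * weight s q"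
    and cols: "\<And>F q. finite F \<Longrightarrow> (\<Sum>p\<in>F. weight t p * cmod (k p q)) \<le> C * weight s q"
    and u: "u \<in> Lsp s"
  shows "kernel_op k u \<in> Lsp t"
proof (rule LspI(1))
  fix F :: "('a, 'b) vertex set" assume F: "finite F"
  have abs: "(\<lambda>q. norm (k p q * u q)) summable_on UNIV" for p
  proof -
    obtain C where "\<And>q. cmod (k p q) \<le> C * weight s q" using rows[of p] by blast
    from Lsp_comparison(1)[OF u this] show ?thesis by (simp add: summable_on_iff_abs_summable_on_complex)
  qed
  have "(\<Sum>p\<in>F. weight t p * cmod (kernel_op k u p)) \<le>
      (\<Sum>p\<in>F. \<Sum>\<^sub>\<infinity>q. weight t p * norm (k p q * u q))"
  proof (rule sum_mono)
    fix p
    have "cmod (kernel_op k u p) \<le> (\<Sum>\<^sub>\<infinity>q. norm (k p q * u q))"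
      unfolding kernel_op_def using abs by (rule norm_infsum_bound)
    then have "weight t p * cmod (kernel_op k u p) \<le> weight t p * (\<Sum>\<^sub>\<infinity>q. norm (k p q * u q))"
      by (intro mult_left_mono) auto
    then show "weight t p * cmod (kernel_op k u p) \<le> (\<Sum>\<^sub>\<infinity>q. weight t p * norm (k p q * u q))"
      by (subst infsum_cmult_right) (auto intro: abs)
  qed
  also have "\<dots> = (\<Sum>\<^sub>\<infinity>q. \<Sum>p\<in>F. weight t p * norm (k p q * u q))"
    by (rule infsum_finite_sum(2)[symmetric]) (intro F summable_on_cmult_right abs)+
  also have "\<dots> \<le> (\<Sum>\<^sub>\<infinity>q. C * (weight s q * cmod (u q)))"
  proof (rule infsum_mono)
    show "(\<lambda>q. \<Sum>p\<in>F. weight t p * norm (k p q * u q)) summable_on UNIV"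
      by (intro infsum_finite_sum(1) F summable_on_cmult_right abs)
    show "(\<lambda>q. C * (weight s q * cmod (u q))) summable_on UNIV"
      using u by (intro summable_on_cmult_right) (auto simp: Lsp_def)
    show "(\<Sum>p\<in>F. weight t p * norm (k p q * u q)) \<le> C * (weight s q * cmod (u q))" for q
      using mult_right_mono[OF cols[OF F, of q] norm_ge_zero[of "u q"]]
      by (simp add: norm_mult sum_distrib_right mult.assoc)
  qed
  finally show "(\<Sum>p\<in>F. weight t p * cmod (kernel_op k u p)) \<le> (\<Sum>\<^sub>\<infinity>q. C * (weight s q * cmod (u q)))" .
qed

section \<open>Square-summable functions and the Schur test\<close>

lemma ell2_sum_le:
  assumes "u \<in> ell2" "finite F"
  shows "(\<Sum>p\<in>F. (cmod (u p))\<^sup>2) \<le> (norm2 u)\<^sup>2"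
proof -
  have "(norm2 u)\<^sup>2 = (\<Sum>\<^sub>\<infinity>p. (cmod (u p))\<^sup>2)"
    unfolding norm2_def by (intro real_sqrt_pow2 infsum_nonneg) auto
  then show ?thesis using assms by (auto simp: ell2_def intro: finite_sum_le_infsum)
qed

lemma norm2_nonneg [simp]: "norm2 u \<ge> 0"
  unfolding norm2_def by (intro real_sqrt_ge_zero infsum_nonneg) auto

lemma ell2I:
  assumes "\<And>F. finite F \<Longrightarrow> (\<Sum>p\<in>F. (cmod (u p))\<^sup>2) \<le> C\<^sup>2" "C \<ge> 0"
  shows "u \<in> ell2" and "norm2 u \<le> C"
proof -
  have s: "(\<lambda>p. (cmod (u p))\<^sup>2) summable_on UNIV"
    by (rule nonneg_bdd_above_summable_on) (auto intro!: bdd_aboveI[of _ "C\<^sup>2"] assms)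
  then show "u \<in> ell2" by (simp add: ell2_def)
  have "(\<Sum>\<^sub>\<infinity>p. (cmod (u p))\<^sup>2) \<le> C\<^sup>2" using s assms by (intro infsum_le_finite_sums) auto
  then show "norm2 u \<le> C" unfolding norm2_def using assms(2) by (simp add: real_le_lsqrt)
qed

lemma ell2_pointwise: "u \<in> ell2 \<Longrightarrow> cmod (u p) \<le> norm2 u"
  using ell2_sum_le[of u "{p}"] power2_le_imp_le[of "cmod (u p)" "norm2 u"] by simp

lemma ell2_Ldual:
  assumes "u \<in> ell2" "s \<ge> 0"
  shows "u \<in> Ldual s" and "normLdual s u \<le> norm2 u"
proof -
  have *: "cmod (u p) \<le> norm2 u * weight s p" for p
    using ell2_pointwise[OF assms(1), of p] mult_left_mono[OF weight_ge_1[OF assms(2), of p] norm2_nonneg[of u]] by simp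
  show "u \<in> Ldual s" "normLdual s u \<le> norm2 u" by (rule LdualI, rule *)+
qed

lemma Lsp_ell2:
  assumes "u \<in> Lsp s" "s \<ge> 0"
  shows "u \<in> ell2" and "norm2 u \<le> normL s u"
proof -
  have *: "(\<Sum>p\<in>F. (cmod (u p))\<^sup>2) \<le> (normL s u)\<^sup>2" if F: "finite F" for F
  proof -
    have "(\<Sum>p\<in>F. (cmod (u p))\<^sup>2) \<le> (\<Sum>p\<in>F. cmod (u p))\<^sup>2"
    proof -
      have "(\<Sum>p\<in>F. (cmod (u p))\<^sup>2) \<le> (\<Sum>p\<in>F. cmod (u p) * (\<Sum>q\<in>F. cmod (u q)))"
        unfolding power2_eq_square using F by (intro sum_mono mult_left_mono member_le_sum) auto
      then show ?thesis by (simp add: power2_eq_square sum_distrib_right)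
    qed
    also have "\<dots> \<le> (normL s u)\<^sup>2"
    proof (rule power_mono)
      have "(\<Sum>p\<in>F. cmod (u p)) \<le> (\<Sum>p\<in>F. weight s p * cmod (u p))"
        using mult_right_mono[OF weight_ge_1[OF assms(2)] norm_ge_zero] by (intro sum_mono) force
      also have "\<dots> \<le> normL s u" by (rule Lsp_sum_le[OF assms(1) F])
      finally show "(\<Sum>p\<in>F. cmod (u p)) \<le> normL s u" .
    qed (simp add: sum_nonneg)
    finally show ?thesis .
  qed
  show "u \<in> ell2" "norm2 u \<le> normL s u" using ell2I[OF *] normL_nonneg by blast+
qed

text \<open>The factor 2 comes from estimating squares by
  \<open>(a + b)^2 \<le> 2 a^2 + 2 b^2\<close>; it is harmless because the bound serves only to show
  boundedness.\<close>

lemma ell2_diff: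
  assumes "u \<in> ell2" "w \<in> ell2"
  shows "u - w \<in> ell2" and "norm2 (u - w) \<le> 2 * (norm2 u + norm2 w)"
proof -
  have *: "(\<Sum>p\<in>F. (cmod ((u - w) p))\<^sup>2) \<le> (2 * (norm2 u + norm2 w))\<^sup>2" if F: "finite F" for F
  proof -
    have "(cmod (u p - w p))\<^sup>2 \<le> 2 * (cmod (u p))\<^sup>2 + 2 * (cmod (w p))\<^sup>2" for p
    proof -
      have "(cmod (u p - w p))\<^sup>2 \<le> (cmod (u p) + cmod (w p))\<^sup>2"
        by (intro power_mono norm_triangle_ineq4) auto
      also have "\<dots> \<le> 2 * (cmod (u p))\<^sup>2 + 2 * (cmod (w p))\<^sup>2"
        using sum_squares_bound[of "cmod (u p)" "cmod (w p)"] by (simp add: power2_sum)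
      finally show ?thesis .
    qed
    then have "(\<Sum>p\<in>F. (cmod ((u - w) p))\<^sup>2) \<le> (\<Sum>p\<in>F. 2 * (cmod (u p))\<^sup>2 + 2 * (cmod (w p))\<^sup>2)"
      by (intro sum_mono) simp
    also have "\<dots> \<le> 2 * (norm2 u)\<^sup>2 + 2 * (norm2 w)\<^sup>2"
      using ell2_sum_le[OF assms(1) F] ell2_sum_le[OF assms(2) F]
      by (simp add: sum.distrib flip: sum_distrib_left)
    also have "\<dots> \<le> (2 * (norm2 u + norm2 w))\<^sup>2"
      by (simp add: power2_eq_square algebra_simps add_nonneg_nonneg)
    finally show ?thesis .
  qed
  show "u - w \<in> ell2" "norm2 (u - w) \<le> 2 * (norm2 u + norm2 w)"
    by (rule ell2I, erule *, simp)+
qed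

text \<open>Writing \<open>|k| |u|\<close> as \<open>sqrt |k|\<close> times
  \<open>sqrt |k| |u|\<close>, Cauchy-Schwarz consumes the row sums; exchanging the order of
  summation in what remains consumes the column sums.\<close>

lemma schur_test:
  assumes rows: "\<And>p F. finite F \<Longrightarrow> (\<Sum>q\<in>F. cmod (k p q)) \<le> M"
    and cols: "\<And>q F. finite F \<Longrightarrow> (\<Sum>p\<in>F. cmod (k p q)) \<le> M"
    and u: "u \<in> ell2"
  shows "(\<lambda>q. k p q * u q) summable_on UNIV"
    and "kernel_op k u \<in> ell2" and "norm2 (kernel_op k u) \<le> M * norm2 u"
proof -
  have M: "M \<ge> 0" using rows[of "{}"] by simp
  have le: "cmod (k p q) \<le> M" for p q using rows[of "{q}" p] by simp
  have S: "(\<lambda>q. cmod (k p q) * (cmod (u q))\<^sup>2) summable_on UNIV" for p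
  proof (rule summable_on_comparison_test)
    show "(\<lambda>q. M * (cmod (u q))\<^sup>2) summable_on UNIV"
      using u by (intro summable_on_cmult_right) (simp add: ell2_def)
  qed (auto intro!: mult_right_mono le)
  define T where "T p = (\<Sum>\<^sub>\<infinity>q. cmod (k p q) * (cmod (u q))\<^sup>2)" for p
  have T0: "T p \<ge> 0" for p unfolding T_def by (intro infsum_nonneg) auto
  have fin: "(\<Sum>q\<in>F. cmod (k p q * u q)) \<le> sqrt (M * T p)" if F: "finite F" for F p
  proof (rule real_le_rsqrt)
    have "(\<Sum>q\<in>F. sqrt (cmod (k p q)) * (sqrt (cmod (k p q)) * cmod (u q)))\<^sup>2 \<le>
       (\<Sum>q\<in>F. (sqrt (cmod (k p q)))\<^sup>2) * (\<Sum>q\<in>F. (sqrt (cmod (k p q)) * cmod (u q))\<^sup>2)"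
      by (rule Cauchy_Schwarz_ineq_sum)
    also have "\<dots> = (\<Sum>q\<in>F. cmod (k p q)) * (\<Sum>q\<in>F. cmod (k p q) * (cmod (u q))\<^sup>2)"
      by (simp add: power_mult_distrib)
    also have "\<dots> \<le> M * T p"
      unfolding T_def by (intro mult_mono rows F finite_sum_le_infsum S M sum_nonneg) auto
    finally show "(\<Sum>q\<in>F. cmod (k p q * u q))\<^sup>2 \<le> M * T p"
      by (simp add: norm_mult mult.assoc[symmetric])
  qed
  have abs: "(\<lambda>q. norm (k p q * u q)) summable_on UNIV" for p
    by (rule nonneg_bdd_above_summable_on) (auto intro!: bdd_aboveI fin)
  then show "(\<lambda>q. k p q * u q) summable_on UNIV" by (rule abs_summable_summable)
  have sq: "(cmod (kernel_op k u p))\<^sup>2 \<le> M * T p" for p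
  proof -
    have "cmod (kernel_op k u p) \<le> (\<Sum>\<^sub>\<infinity>q. norm (k p q * u q))"
      unfolding kernel_op_def using abs by (rule norm_infsum_bound)
    also have "\<dots> \<le> sqrt (M * T p)" by (rule infsum_le_finite_sums[OF abs]) (use fin in auto)
    finally have "(cmod (kernel_op k u p))\<^sup>2 \<le> (sqrt (M * T p))\<^sup>2" by (intro power_mono) auto
    then show ?thesis using M T0[of p] by simp
  qed
  have *: "(\<Sum>p\<in>F. (cmod (kernel_op k u p))\<^sup>2) \<le> (M * norm2 u)\<^sup>2" if F: "finite F" for F
  proof -
    have "(\<Sum>p\<in>F. T p) = (\<Sum>\<^sub>\<infinity>q. \<Sum>p\<in>F. cmod (k p q) * (cmod (u q))\<^sup>2)"
      unfolding T_def by (rule infsum_finite_sum(2)[symmetric]) (intro F S)+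
    also have "\<dots> \<le> (\<Sum>\<^sub>\<infinity>q. M * (cmod (u q))\<^sup>2)"
    proof (rule infsum_mono)
      show "(\<lambda>q. M * (cmod (u q))\<^sup>2) summable_on UNIV"
        using u by (intro summable_on_cmult_right) (simp add: ell2_def)
      show "(\<Sum>p\<in>F. cmod (k p q) * (cmod (u q))\<^sup>2) \<le> M * (cmod (u q))\<^sup>2" for q
        unfolding sum_distrib_right[symmetric] by (intro mult_right_mono cols F) auto
    qed (intro infsum_finite_sum(1) F S)
    also have "\<dots> = M * (norm2 u)\<^sup>2"
      unfolding norm2_def using u
      by (subst infsum_cmult_right) (auto simp: ell2_def real_sqrt_pow2 infsum_nonneg)
    finally have "M * (\<Sum>p\<in>F. T p) \<le> M * (M * (norm2 u)\<^sup>2)" using M by (rule mult_left_mono)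
    moreover have "(\<Sum>p\<in>F. (cmod (kernel_op k u p))\<^sup>2) \<le> M * (\<Sum>p\<in>F. T p)"
      unfolding sum_distrib_left by (intro sum_mono sq)
    ultimately show ?thesis by (simp add: power2_eq_square mult.left_commute mult.assoc)
  qed
  show "kernel_op k u \<in> ell2" "norm2 (kernel_op k u) \<le> M * norm2 u"
    by (rule ell2I, erule *, simp add: M)+
qed

subsection \<open>The free Green function\<close>

lemma has_sum_minus:
  fixes f g :: "'a \<Rightarrow> 'b::{topological_ab_group_add}"
  assumes "(f has_sum a) A" "(g has_sum b) A"
  shows "((\<lambda>x. f x - g x) has_sum a - b) A"
  using has_sum_add[OF assms(1), of "\<lambda>x. - g x" "- b"] assms(2) by (simp add: has_sum_uminus)

text \<open>On the core the free operator is replaced by the identity; the difference is of finite rank and joins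
  \<open>V\<close> in \<open>coupling\<close> below.\<close>

definition decoupled_op :: "('k, 'n) oper" where
  "decoupled_op u = (\<lambda>p. case p of Core x \<Rightarrow> u (Core x) | Ray \<alpha> m \<Rightarrow> h_ray (\<lambda>l. u (Ray \<alpha> l)) m)"

text \<open>For \<open>\<zeta> + \<zeta>\<^sup>-\<^sup>1 = 2 + z\<close> the Green function of \<open>h_ray + z\<close> is \<open>\<zeta>\<^bsup>max\<^esup> (\<zeta>\<^bsup>-min\<^esup> - \<zeta>\<^bsup>min\<^esup>) / (\<zeta>\<^sup>-\<^sup>1 - \<zeta>)\<close> at the
  points \<open>n + 1, m + 1\<close>. Summing the geometric series removes the denominator, which vanishes at the
  threshold \<open>\<zeta> = 1\<close>. The powers \<open>\<zeta>\<^sup>l\<close> enter as \<open>\<phi> (2 * l)\<close>, since \<open>\<zeta>\<close> will be a square.\<close>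

definition ray_kernel :: "(nat \<Rightarrow> complex) \<Rightarrow> nat \<Rightarrow> nat \<Rightarrow> complex" where
  "ray_kernel \<phi> n m = (\<Sum>k\<le>min n m. \<phi> (2 * (max n m - min n m + 1 + 2 * k)))"

fun free_kernel :: "complex \<Rightarrow> (nat \<Rightarrow> complex) \<Rightarrow> ('k, 'n) vertex \<Rightarrow> ('k, 'n) vertex \<Rightarrow> complex" where
  "free_kernel b \<phi> (Core x) (Core y) = (if x = y then b else 0)"
| "free_kernel b \<phi> (Ray \<alpha> n) (Ray \<alpha>' m) = (if \<alpha> = \<alpha>' then ray_kernel \<phi> n m else 0)"
| "free_kernel b \<phi> _ _ = 0"

text \<open>The kernel is linear in the pair of \<open>b\<close> and \<phi>. An expansion of these
  scalars in powers of \<kappa> is therefore an expansion of the kernel.\<close>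

lemma free_kernel_diff:
  "free_kernel b \<phi> p q - c * free_kernel b' \<phi>' p q = free_kernel (b - c * b') (\<lambda>m. \<phi> m - c * \<phi>' m) p q"
  by (cases p; cases q) (auto simp: ray_kernel_def sum_subtractf sum_distrib_left)

lemma weight_ray_ge:
  assumes "real r \<le> s"
  shows "(real n + 1) ^ r \<le> weight s (Ray \<alpha> n)"
proof -
  have "(real n + 1) ^ r = ((real n + 1)\<^sup>2) powr (real r / 2)"
  proof -
    have "(real n + 1)\<^sup>2 = (real n + 1) powr 2" by simp
    then have "((real n + 1)\<^sup>2) powr (real r / 2) = (real n + 1) powr real r" by (simp only: powr_powr) simp
    then show ?thesis by (simp add: powr_realpow)
  qed
  also have "\<dots> \<le> (1 + (real n + 1)\<^sup>2) powr (real r / 2)" by (intro powr_mono2) auto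
  also have "\<dots> \<le> (1 + (real n + 1)\<^sup>2) powr (s / 2)" using assms by (intro powr_mono) auto
  finally show ?thesis by (simp add: add.commute)
qed

text \<open>Each argument of \<phi>, increased by 1, is at most \<open>4 (max n m + 1)\<close>, and
  there are \<open>min n m + 1\<close> summands. The exponent \<open>r\<close>, at least 1 and at
  least \<open>J\<close>, serves both factors, after which minimum and maximum can be exchanged for
  \<open>n\<close> and \<open>m\<close>.\<close>

lemma free_kernel_bound:
  assumes b: "cmod b \<le> C" and \<phi>: "\<And>m. cmod (\<phi> m) \<le> C * (real m + 1) ^ J"
    and s: "1 \<le> s" "real J \<le> s"
  shows "kernel_bound s (C * 4 ^ J) (free_kernel b \<phi>)"
proof -
  have C: "C \<ge> 0" using b norm_ge_zero order_trans by blast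
  define r where "r = max 1 J"
  have r: "r \<ge> 1" "r \<ge> J" "real r \<le> s" using s by (auto simp: r_def max_def)
  have ray: "cmod (ray_kernel \<phi> n m) \<le> C * 4 ^ J * weight s (Ray \<alpha> n) * weight s (Ray \<alpha> m)" for \<alpha> :: 'b and n m
  proof -
    have "cmod (ray_kernel \<phi> n m) \<le> (\<Sum>k\<le>min n m. C * (4 * (real (max n m) + 1)) ^ J)"
      unfolding ray_kernel_def
    proof (rule sum_norm_le)
      fix k assume "k \<in> {..min n m}"
      then have "real (2 * (max n m - min n m + 1 + 2 * k)) + 1 \<le> 4 * (real (max n m) + 1)"
        by (simp add: max_def min_def split: if_splits)
      then have "C * (real (2 * (max n m - min n m + 1 + 2 * k)) + 1) ^ J \<le> C * (4 * (real (max n m) + 1)) ^ J"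
        by (intro mult_left_mono power_mono C) auto
      with \<phi> show "cmod (\<phi> (2 * (max n m - min n m + 1 + 2 * k))) \<le> C * (4 * (real (max n m) + 1)) ^ J"
        using order_trans by blast
    qed
    also have "\<dots> = C * 4 ^ J * ((real (min n m) + 1) * (real (max n m) + 1) ^ J)"
      unfolding power_mult_distrib by simp
    also have "\<dots> \<le> C * 4 ^ J * ((real (min n m) + 1) ^ r * (real (max n m) + 1) ^ r)"
      using r power_increasing[of 1 r "real (min n m) + 1"]
      by (intro mult_left_mono mult_mono power_increasing) (auto simp: C)
    also have "(real (min n m) + 1) ^ r * (real (max n m) + 1) ^ r = (real n + 1) ^ r * (real m + 1) ^ r"
      by (auto simp: min_def max_def)
    also have "C * 4 ^ J * \<dots> \<le> C * 4 ^ J * (weight s (Ray \<alpha> n) * weight s (Ray \<alpha> m))"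
      by (intro mult_left_mono mult_mono weight_ray_ge r) (auto simp: C simp del: weight.simps)
    finally show ?thesis by (simp add: mult.assoc)
  qed
  have core: "cmod b \<le> C * 4 ^ J"
  proof -
    have "C * 1 \<le> C * 4 ^ J" using C by (intro mult_left_mono) auto
    then show ?thesis using b by simp
  qed
  have "cmod (free_kernel b \<phi> p q) \<le> C * 4 ^ J * weight s p * weight s q" for p q :: "('a, 'b) vertex"
  proof (cases p; cases q)
    fix \<alpha> n \<alpha>' m assume "p = Ray \<alpha> n" "q = Ray \<alpha>' m"
    then show ?thesis using ray[of n m \<alpha>] C by (cases "\<alpha> = \<alpha>'") (simp_all del: weight.simps)
  qed (use core C in auto)
  then show ?thesis by (simp add: kernel_bound_def)
qed

lemma ray_kernel_power:
  assumes "\<And>l. \<phi> (2 * l) = \<zeta> ^ l"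
  shows "ray_kernel \<phi> n m = \<zeta> ^ (max n m - min n m + 1) * (\<Sum>k\<le>min n m. \<zeta> ^ (2 * k))"
  by (simp only: ray_kernel_def assms power_add sum_distrib_left)

text \<open>The geometric sums \<open>S\<close> obey two recurrences: adding the last term, or
  multiplying by \<zeta> squared and adding the first. Off the diagonal the first one gives 0; on
  the diagonal the second one leaves the 1. The identity is polynomial in \<zeta> and so includes
  the double root 1 at \<open>z = 0\<close>.\<close>

lemma ray_kernel_green:
  assumes \<zeta>: "\<zeta>\<^sup>2 + 1 = (2 + z) * \<zeta>" and \<phi>: "\<And>l. \<phi> (2 * l) = \<zeta> ^ l"
  shows "h_ray (\<lambda>l. ray_kernel \<phi> l m) n + z * ray_kernel \<phi> n m = (if n = m then 1 else 0)"
proof -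
  define S where "S n = (\<Sum>k\<le>n. \<zeta> ^ (2 * k))" for n
  define g where "g = (\<lambda>n m. \<zeta> ^ (max n m - min n m + 1) * S (min n m))"
  have g: "ray_kernel \<phi> = g" using ray_kernel_power[of \<phi> \<zeta>, OF \<phi>] by (auto simp: g_def S_def fun_eq_iff)
  have s: "(2 + z) * (\<zeta> * x) = (\<zeta>\<^sup>2 + 1) * x" for x using \<zeta> by (simp add: algebra_simps)
  have S: "S 0 = 1" "S (Suc n) = S n + \<zeta>\<^sup>2 * \<zeta> ^ (2 * n)" for n
    by (simp_all add: S_def power2_eq_square)
  have S3: "S (Suc n) = 1 + \<zeta>\<^sup>2 * S n" for n
  proof (induction n)
    case (Suc n)
    have "S (Suc (Suc n)) = 1 + \<zeta>\<^sup>2 * S n + \<zeta>\<^sup>2 * \<zeta> ^ (2 * Suc n)"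
      using S(2)[of "Suc n"] Suc by simp
    also have "\<dots> = 1 + \<zeta>\<^sup>2 * S (Suc n)"
      unfolding S(2)[of n] by (simp add: power2_eq_square algebra_simps)
    finally show ?case .
  qed (simp add: S_def)
  show ?thesis
  proof (cases n)
    case 0
    show ?thesis
    proof (cases m)
      case (Suc m')
      have "h_ray (\<lambda>l. g l m) n + z * g n m = (2 + z) * (\<zeta> * \<zeta> ^ Suc m') - \<zeta> ^ Suc m' * (1 + \<zeta>\<^sup>2)"
        using 0 Suc S(1) S(2)[of 0] by (simp add: g_def algebra_simps power2_eq_square)
      then show ?thesis using 0 Suc unfolding g s by (simp add: algebra_simps)
    qed (use 0 \<zeta> S(1) in \<open>simp add: g g_def algebra_simps power2_eq_square\<close>)
  next
    case n: (Suc n')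
    consider (lt) d where "m = n + Suc d" | (eq) "m = n" | (gt) d where "n' = m + d"
      using n by (metis Suc_le_eq add_Suc_right le_Suc_ex less_Suc_eq_le nat_neq_iff less_iff_Suc_add)
    then show ?thesis
    proof cases
      case lt
      have "h_ray (\<lambda>l. g l m) n + z * g n m =
          (2 + z) * (\<zeta> * (\<zeta> ^ Suc d * S (Suc n'))) - \<zeta> ^ Suc d * S (Suc (Suc n')) - \<zeta> ^ Suc d * \<zeta>\<^sup>2 * S n'"
        using n lt by (simp add: g_def algebra_simps power2_eq_square)
      also have "\<dots> = \<zeta> ^ Suc d * (\<zeta>\<^sup>2 * (S (Suc n') - S n') + S (Suc n') - S (Suc (Suc n')))"
        unfolding s by (simp add: algebra_simps)
      also have "\<dots> = 0" unfolding S(2) by (simp add: algebra_simps power2_eq_square)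
      finally show ?thesis using lt by (simp add: g)
    next
      case eq
      have "h_ray (\<lambda>l. g l m) n + z * g n m = (2 + z) * (\<zeta> * S (Suc n')) - \<zeta>\<^sup>2 * S (Suc n') - \<zeta>\<^sup>2 * S n'"
        using n eq by (simp add: g_def algebra_simps power2_eq_square)
      also have "\<dots> = 1" unfolding s S3 by (simp add: algebra_simps)
      finally show ?thesis using eq by (simp add: g)
    next
      case gt
      have "h_ray (\<lambda>l. g l m) n + z * g n m =
          (2 + z) * (\<zeta> * (\<zeta> ^ Suc d * S m)) - \<zeta> ^ Suc d * \<zeta>\<^sup>2 * S m - \<zeta> ^ Suc d * S m"
        using n gt by (simp add: g_def algebra_simps power2_eq_square)
      also have "\<dots> = 0" unfolding s by (simp add: algebra_simps)
      finally show ?thesis using gt n by (simp add: g)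
    qed
  qed
qed

text \<open>Each value of the operator involves at most three rows, so summability of rows suffices.
  This generality matters because the identity is applied both in \<open>ell2\<close> away from the
  threshold and in a weighted space at the threshold, where the kernel is unbounded.\<close>

lemma decoupled_op_green:
  assumes \<zeta>: "\<zeta>\<^sup>2 + 1 = (2 + z) * \<zeta>" and \<phi>: "\<And>l. \<phi> (2 * l) = \<zeta> ^ l" and b: "(1 + z) * b = 1"
    and sum: "\<And>p. (\<lambda>q. free_kernel b \<phi> p q * u q) summable_on UNIV"
  shows "decoupled_op (kernel_op (free_kernel b \<phi>) u) + smul z (kernel_op (free_kernel b \<phi>) u) = u"
proof
  fix p
  let ?K = "free_kernel b \<phi>"
  define T where "T = kernel_op ?K u"
  have hs: "((\<lambda>q. ?K p q * u q) has_sum T p) UNIV" for p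
    unfolding T_def kernel_op_def using sum by (rule has_sum_infsum)
  have delta: "((\<lambda>q. (if q = p then 1 else 0) * u q) has_sum u p) UNIV" for p
  proof -
    have "((\<lambda>q. (if q = p then 1 else 0) * u q) has_sum (\<Sum>q\<in>{p}. (if q = p then 1 else 0) * u q)) UNIV"
      by (rule has_sum_finite_neutralI[where B = "{p}"]) auto
    then show ?thesis by simp
  qed
  have "decoupled_op T p + z * T p = u p"
  proof (cases p)
    case (Core x)
    have "((\<lambda>q. (1 + z) * (?K p q * u q)) has_sum (1 + z) * T p) UNIV" by (intro has_sum_cmult_right hs)
    moreover have "(1 + z) * (?K p q * u q) = (if q = p then 1 else 0) * u q" for q
      using b Core by (cases q) (auto simp: mult.assoc[symmetric])
    ultimately have "(1 + z) * T p = u p" using delta[of p] has_sum_unique by simp blast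
    then show ?thesis using Core by (simp add: decoupled_op_def algebra_simps)
  next
    case (Ray \<alpha> n)
    have "((\<lambda>q. h_ray (\<lambda>l. ?K (Ray \<alpha> l) q * u q) n + z * (?K p q * u q)) has_sum
        h_ray (\<lambda>l. T (Ray \<alpha> l)) n + z * T p) UNIV"
    proof (cases n)
      case 0
      then show ?thesis by (simp add: hs has_sum_add has_sum_minus has_sum_cmult_right)
    next
      case (Suc n')
      then show ?thesis by (simp add: hs has_sum_add has_sum_minus has_sum_cmult_right)
    qed
    moreover have "h_ray (\<lambda>l. ?K (Ray \<alpha> l) q * u q) n + z * (?K p q * u q) = (if q = p then 1 else 0) * u q" for q
    proof -
      have "h_ray (\<lambda>l. f l * c) n = h_ray f n * c" for f c by (cases n) (auto simp: algebra_simps)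
      then have "h_ray (\<lambda>l. ?K (Ray \<alpha> l) q * u q) n + z * (?K p q * u q) =
          (h_ray (\<lambda>l. ?K (Ray \<alpha> l) q) n + z * ?K p q) * u q" by (simp add: algebra_simps)
      also have "h_ray (\<lambda>l. ?K (Ray \<alpha> l) q) n + z * ?K p q = (if q = p then 1 else 0)"
      proof (cases q)
        case (Core y)
        then show ?thesis using Ray by (cases n) auto
      next
        case q: (Ray \<alpha>' m)
        show ?thesis
        proof (cases "\<alpha> = \<alpha>'")
          case True
          then show ?thesis using q Ray ray_kernel_green[OF \<zeta>, of \<phi> m n, OF \<phi>] by auto
        next
          case False
          then show ?thesis using q Ray by (cases n) auto
        qed
      qed
      finally show ?thesis .
    qed
    ultimately have "h_ray (\<lambda>l. T (Ray \<alpha> l)) n + z * T p = u p" using delta[of p] has_sum_unique by simp blast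
    then show ?thesis using Ray by (simp add: decoupled_op_def)
  qed
  then show "(decoupled_op (kernel_op ?K u) + smul z (kernel_op ?K u)) p = u p" by (simp add: T_def)
qed

text \<open>On a ray, \<open>\<zeta> ^ Suc n * (a (Suc n) - \<zeta> * a n)\<close> is a first
  integral of the recursion, equal to \<open>a 0\<close> by the boundary equation. It tends to 0 for
  square-summable \<open>a\<close>; hence \<open>a 0 = 0\<close>, and then the vanishing of the
  first integral propagates zero along the ray.\<close>

lemma decoupled_op_injective:
  assumes u: "u \<in> ell2" and eq: "decoupled_op u + smul z u = 0" and z: "1 + z \<noteq> 0"
    and \<zeta>: "\<zeta>\<^sup>2 + 1 = (2 + z) * \<zeta>" and \<zeta>1: "cmod \<zeta> < 1"
  shows "u = 0"
proof -
  have pt: "decoupled_op u p + z * u p = 0" for p using eq by (metis plus_fun_apply smul_apply zero_fun_apply)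
  have core: "u (Core x) = 0" for x
  proof -
    have "(1 + z) * u (Core x) = 0" using pt[of "Core x"] by (simp add: decoupled_op_def algebra_simps)
    then show ?thesis using z by simp
  qed
  have \<zeta>0: "\<zeta> \<noteq> 0" using \<zeta> by auto
  have ray: "u (Ray \<alpha> n) = 0" for \<alpha> n
  proof -
    define a where "a n = u (Ray \<alpha> n)" for n
    have rec: "h_ray a n + z * a n = 0" for n
      using pt[of "Ray \<alpha> n"] by (simp add: decoupled_op_def a_def [abs_def])
    have step: "\<zeta> * (a (Suc (Suc n)) - \<zeta> * a (Suc n)) = a (Suc n) - \<zeta> * a n" for n
    proof -
      have r: "a (Suc (Suc n)) = (2 + z) * a (Suc n) - a n" using rec[of "Suc n"] by (simp add: algebra_simps)
      have "\<zeta> * (a (Suc (Suc n)) - \<zeta> * a (Suc n)) = ((2 + z) * \<zeta>) * a (Suc n) - \<zeta> * a n - \<zeta>\<^sup>2 * a (Suc n)"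
        unfolding r by (simp add: algebra_simps power2_eq_square)
      also have "\<dots> = a (Suc n) - \<zeta> * a n" unfolding \<zeta>[symmetric] by (simp add: algebra_simps)
      finally show ?thesis .
    qed
    have zero: "\<zeta> * (a 1 - \<zeta> * a 0) = a 0"
    proof -
      have r: "a 1 = (2 + z) * a 0" using rec[of 0] by (simp add: algebra_simps)
      have "\<zeta> * (a 1 - \<zeta> * a 0) = ((2 + z) * \<zeta>) * a 0 - \<zeta>\<^sup>2 * a 0"
        unfolding r by (simp add: algebra_simps power2_eq_square)
      also have "\<dots> = a 0" unfolding \<zeta>[symmetric] by (simp add: algebra_simps)
      finally show ?thesis .
    qed
    have pow: "\<zeta> ^ Suc n * (a (Suc n) - \<zeta> * a n) = a 0" for n
    proof (induction n)
      case (Suc n)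
      have "\<zeta> ^ Suc (Suc n) * (a (Suc (Suc n)) - \<zeta> * a (Suc n)) =
          \<zeta> ^ Suc n * (\<zeta> * (a (Suc (Suc n)) - \<zeta> * a (Suc n)))" by simp
      also have "\<dots> = a 0" unfolding step by (rule Suc)
      finally show ?case .
    qed (use zero in simp)
    have "(\<lambda>n. (cmod (a n))\<^sup>2) summable_on UNIV"
    proof -
      have "(\<lambda>p. (cmod (u p))\<^sup>2) summable_on (range (Ray \<alpha>))"
        using u by (auto simp: ell2_def intro: summable_on_subset_banach)
      then have "((\<lambda>p. (cmod (u p))\<^sup>2) \<circ> Ray \<alpha>) summable_on UNIV"
        by (subst (asm) summable_on_reindex) (auto simp: inj_def)
      then show ?thesis by (simp add: a_def o_def)
    qed
    then have "(\<lambda>n. (cmod (a n))\<^sup>2) \<longlonglongrightarrow> 0"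
      using summable_on_imp_summable summable_LIMSEQ_zero by blast
    then have "(\<lambda>n. sqrt ((cmod (a n))\<^sup>2)) \<longlonglongrightarrow> sqrt 0" by (rule tendsto_real_sqrt)
    then have a0: "a \<longlonglongrightarrow> 0" by (simp add: tendsto_norm_zero_iff)
    have "(\<lambda>n. \<zeta> ^ n) \<longlonglongrightarrow> 0" using \<zeta>1 by (simp add: LIMSEQ_power_zero)
    then have "(\<lambda>n. \<zeta> ^ Suc n * (a (Suc n) - \<zeta> * a n)) \<longlonglongrightarrow> 0 * (0 - \<zeta> * 0)"
      by (intro tendsto_mult tendsto_diff tendsto_const a0 LIMSEQ_Suc[OF a0]) (rule LIMSEQ_Suc)
    then have a00: "a 0 = 0" unfolding pow by (simp add: LIMSEQ_const_iff)
    have "a n = 0"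
    proof (induction n)
      case (Suc n)
      then show ?case using pow[of n] a00 \<zeta>0 by simp
    qed (rule a00)
    then show ?thesis by (simp add: a_def)
  qed
  show "u = 0"
  proof
    show "u p = 0 p" for p using core ray by (cases p) auto
  qed
qed

lemma geometric_sum_le:
  assumes "finite A" "inj_on f A" "0 \<le> \<rho>" "\<rho> < (1::real)"
  shows "(\<Sum>a\<in>A. \<rho> ^ f a) \<le> 1 / (1 - \<rho>)"
proof -
  have "(\<Sum>a\<in>A. \<rho> ^ f a) = (\<Sum>n\<in>f ` A. \<rho> ^ n)" using assms(2) by (simp add: sum.reindex)
  also have "\<dots> \<le> (\<Sum>n. \<rho> ^ n)" using assms by (intro sum_le_suminf summable_geometric) auto
  finally show ?thesis using assms by (simp add: suminf_geometric)
qed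

lemma free_kernel_commute: "free_kernel b \<phi> p q = free_kernel b \<phi> q p"
  by (cases p; cases q) (auto simp: ray_kernel_def max.commute min.commute)

text \<open>A ray entry is at most \<open>D\<close> times the power of |\<zeta>| given by the
  distance of its arguments. A row is split at its own index because the distance is injective on
  either side; this produces the factor 2, and the two geometric series the square in the
  denominator.\<close>

lemma free_kernel_row_sum:
  fixes p :: "('k, 'n) vertex"
  assumes \<phi>: "\<And>l. \<phi> (2 * l) = \<zeta> ^ l" and \<zeta>1: "cmod \<zeta> < 1" and F: "finite F"
  shows "(\<Sum>q\<in>F. cmod (free_kernel b \<phi> p q)) \<le> cmod b + 2 / (1 - cmod \<zeta>)\<^sup>2"
proof -
  define \<rho> where "\<rho> = cmod \<zeta>"
  have \<rho>: "0 \<le> \<rho>" "\<rho> < 1" using \<zeta>1 by (auto simp: \<rho>_def)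
  define D where "D = 1 / (1 - \<rho>)"
  have D: "D \<ge> 0" using \<rho> by (simp add: D_def)
  have ray: "cmod (ray_kernel \<phi> n m) \<le> D * \<rho> ^ (max n m - min n m)" for n m
  proof -
    have "cmod (ray_kernel \<phi> n m) \<le> \<rho> ^ (max n m - min n m + 1) * (\<Sum>k\<le>min n m. \<rho> ^ (2 * k))"
      unfolding ray_kernel_power[of \<phi> \<zeta>, OF \<phi>] norm_mult norm_power \<rho>_def
      by (intro mult_left_mono sum_norm_le) (auto simp: norm_power)
    also have "\<dots> \<le> \<rho> ^ (max n m - min n m) * D"
      using \<rho> unfolding D_def
      by (intro mult_mono power_decreasing geometric_sum_le sum_nonneg) (auto simp: inj_on_def)
    finally show ?thesis by (simp add: mult.commute)
  qed
  show ?thesis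
  proof (cases p)
    case (Core x)
    have "(\<Sum>q\<in>F. cmod (free_kernel b \<phi> p q)) = (\<Sum>q\<in>F \<inter> {p}. cmod (free_kernel b \<phi> p q))"
    proof (rule sum.mono_neutral_right)
      show "\<forall>q\<in>F - F \<inter> {p}. cmod (free_kernel b \<phi> p q) = 0"
      proof
        fix q assume "q \<in> F - F \<inter> {p}"
        then show "cmod (free_kernel b \<phi> p q) = 0" using Core by (cases q) auto
      qed
    qed (use F in auto)
    also have "\<dots> \<le> cmod b" using Core by (cases "p \<in> F") auto
    finally show ?thesis by (simp add: add_increasing2)
  next
    case (Ray \<alpha> n)
    define A where "A = {q \<in> F. \<exists>m\<le>n. q = Ray \<alpha> m}"
    define B where "B = {q \<in> F. \<exists>m>n. q = Ray \<alpha> m}"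
    have fin: "finite A" "finite B" "A \<inter> B = {}" using F by (auto simp: A_def B_def)
    define f where "f q = (case q of Core _ \<Rightarrow> 0 | Ray _ m \<Rightarrow> max n m - min n m)" for q :: "('k, 'n) vertex"
    have "(\<Sum>q\<in>F. cmod (free_kernel b \<phi> p q)) = (\<Sum>q\<in>A \<union> B. cmod (free_kernel b \<phi> p q))"
    proof (rule sum.mono_neutral_right)
      show "\<forall>q\<in>F - (A \<union> B). cmod (free_kernel b \<phi> p q) = 0"
      proof
        fix q assume q: "q \<in> F - (A \<union> B)"
        show "cmod (free_kernel b \<phi> p q) = 0"
        proof (cases q)
          case r: (Ray \<alpha>' m)
          have "\<alpha>' \<noteq> \<alpha>" using q r by (cases "m \<le> n") (auto simp: A_def B_def)
          then show ?thesis using r Ray by simp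
        qed (use Ray in auto)
      qed
    qed (use F in \<open>auto simp: A_def B_def\<close>)
    also have "\<dots> \<le> (\<Sum>q\<in>A \<union> B. D * \<rho> ^ f q)"
    proof (rule sum_mono)
      fix q assume "q \<in> A \<union> B"
      then obtain m where q: "q = Ray \<alpha> m" by (auto simp: A_def B_def)
      show "cmod (free_kernel b \<phi> p q) \<le> D * \<rho> ^ f q"
        using ray[of n m] by (simp add: q Ray f_def)
    qed
    also have "\<dots> = D * ((\<Sum>q\<in>A. \<rho> ^ f q) + (\<Sum>q\<in>B. \<rho> ^ f q))"
      using fin by (simp add: sum.union_disjoint sum_distrib_left distrib_left)
    also have "\<dots> \<le> D * (1 / (1 - \<rho>) + 1 / (1 - \<rho>))"
      using \<rho> D fin by (intro mult_left_mono add_mono geometric_sum_le) (auto simp: inj_on_def A_def B_def f_def)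
    also have "\<dots> = 2 / (1 - cmod \<zeta>)\<^sup>2" by (simp add: D_def \<rho>_def power2_eq_square)
    finally show ?thesis by (simp add: add_increasing)
  qed
qed

text \<open>Coefficients of \<open>\<eta>\<^sup>m\<close> in powers of \<open>\<kappa>\<close> when \<open>\<eta>\<^sup>2 = 1 - \<kappa> \<eta>\<close>, read off from
  \<open>\<eta>\<^bsup>m+2\<^esup> = \<eta>\<^sup>m - \<kappa> \<eta>\<^bsup>m+1\<^esup>\<close>; \<open>e\<close> are the coefficients of \<open>\<eta>\<close> itself.\<close>

fun power_coeff :: "(nat \<Rightarrow> complex) \<Rightarrow> nat \<Rightarrow> nat \<Rightarrow> complex" where
  "power_coeff e 0 m = 1"
| "power_coeff e (Suc j) 0 = 0"
| "power_coeff e (Suc j) (Suc 0) = e (Suc j)"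
| "power_coeff e (Suc j) (Suc (Suc m)) = power_coeff e (Suc j) m - power_coeff e j (Suc m)"

text \<open>Summation raises polynomial growth by one degree. The step has length two, hence the two
  initial values. Both the coefficients of the powers of \<open>eta\<close> and their remainders
  satisfy such a recursion.\<close>

lemma recursion_bound:
  fixes f g :: "nat \<Rightarrow> complex"
  assumes rec: "\<And>m. f (Suc (Suc m)) = f m - g (Suc m)"
    and f: "cmod (f 0) \<le> C" "cmod (f 1) \<le> C" and g: "\<And>m. cmod (g m) \<le> C * (real m + 1) ^ j"
  shows "cmod (f m) \<le> C * (real m + 1) ^ Suc j"
proof (induction m rule: induct_nat_012)
  case 1
  have "C * 1 \<le> C * (real 1 + 1) ^ Suc j"
    using order_trans[OF norm_ge_zero f(1)] by (intro mult_left_mono) (auto simp: one_le_power simp del: power_Suc)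
  then show ?case using f(2) by simp
next
  case (ge2 m)
  have C: "C \<ge> 0" using f norm_ge_zero order_trans by blast
  have "cmod (f (Suc (Suc m))) \<le> cmod (f m) + cmod (g (Suc m))" unfolding rec by (rule norm_triangle_ineq4)
  also have "\<dots> \<le> C * ((real m + 1) ^ Suc j + (real m + 2) ^ j)"
    using ge2(1) g[of "Suc m"] by (simp add: distrib_left add.commute)
  also have "\<dots> \<le> C * (real (Suc (Suc m)) + 1) ^ Suc j"
  proof (intro mult_left_mono C)
    have "(real m + 1) ^ Suc j + (real m + 2) ^ j \<le> (real m + 1) * (real m + 2) ^ j + (real m + 2) ^ j"
      by (auto intro!: mult_left_mono power_mono)
    also have "\<dots> = (real m + 2) ^ Suc j" by (simp add: algebra_simps)
    also have "\<dots> \<le> (real (Suc (Suc m)) + 1) ^ Suc j" by (intro power_mono) auto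
    finally show "(real m + 1) ^ Suc j + (real m + 2) ^ j \<le> (real (Suc (Suc m)) + 1) ^ Suc j" .
  qed
  finally show ?case .
qed (use f in simp)

lemma power_coeff_bound: "\<exists>C. \<forall>m. cmod (power_coeff e j m) \<le> C * (real m + 1) ^ j"
proof (induction j)
  case 0
  show ?case by (intro exI[of _ 1]) auto
next
  case (Suc j)
  then obtain C where C: "\<And>m. cmod (power_coeff e j m) \<le> C * (real m + 1) ^ j" by blast
  define C' where "C' = max C (cmod (e (Suc j)))"
  have "cmod (power_coeff e (Suc j) m) \<le> C' * (real m + 1) ^ Suc j" for m
  proof (rule recursion_bound)
    show "cmod (power_coeff e j m) \<le> C' * (real m + 1) ^ j" for m
      by (rule order_trans[OF C]) (auto simp: C'_def intro!: mult_right_mono)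
  qed (auto simp: C'_def le_max_iff_disj)
  then show ?case by blast
qed

text \<open>By the quadratic relation, the remainder of order \<open>J + 1\<close> at
  \<open>m + 2\<close> is the one at \<open>m\<close> minus \<kappa> times the remainder of order
  \<open>J\<close> at \<open>m + 1\<close>. Thus \<open>recursion_bound\<close> trades a power of
  \<kappa> for a power of \<open>m\<close>. The induction starts from
  \<open>|h \<kappa>| \<le> 1\<close>, and the expansion of \<open>h\<close> itself supplies the
  initial value at \<open>m = 1\<close>.\<close>

lemma power_expansion:
  assumes e0: "e 0 = 1"
    and exp: "\<And>J. \<exists>C. \<forall>\<kappa>\<in>D. cmod (h \<kappa> - (\<Sum>j<J. e j * \<kappa> ^ j)) \<le> C * cmod \<kappa> ^ J"
    and quad: "\<And>\<kappa>. \<kappa> \<in> D \<Longrightarrow> (h \<kappa>)\<^sup>2 = 1 - \<kappa> * h \<kappa>"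
    and le1: "\<And>\<kappa>. \<kappa> \<in> D \<Longrightarrow> cmod (h \<kappa>) \<le> 1"
  shows "\<exists>C. \<forall>\<kappa>\<in>D. \<forall>m. cmod (h \<kappa> ^ m - (\<Sum>j<J. power_coeff e j m * \<kappa> ^ j)) \<le> C * cmod \<kappa> ^ J * (real m + 1) ^ J"
proof (induction J)
  case 0
  show ?case using le1 by (intro exI[of _ 1]) (auto simp: norm_power power_le_one)
next
  case (Suc J)
  then obtain C where C: "\<And>\<kappa> m. \<kappa> \<in> D \<Longrightarrow>
      cmod (h \<kappa> ^ m - (\<Sum>j<J. power_coeff e j m * \<kappa> ^ j)) \<le> C * cmod \<kappa> ^ J * (real m + 1) ^ J" by blast
  obtain C1 where C1: "\<And>\<kappa>. \<kappa> \<in> D \<Longrightarrow> cmod (h \<kappa> - (\<Sum>j<Suc J. e j * \<kappa> ^ j)) \<le> C1 * cmod \<kappa> ^ Suc J"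
    using exp[of "Suc J"] by blast
  define C' where "C' = max 0 (max C C1)"
  have "cmod (h \<kappa> ^ m - (\<Sum>j<Suc J. power_coeff e j m * \<kappa> ^ j)) \<le> (C' * cmod \<kappa> ^ Suc J) * (real m + 1) ^ Suc J"
    if \<kappa>: "\<kappa> \<in> D" for \<kappa> m
  proof (rule recursion_bound)
    let ?f = "\<lambda>J m. h \<kappa> ^ m - (\<Sum>j<J. power_coeff e j m * \<kappa> ^ j)"
    show "?f (Suc J) (Suc (Suc m)) = ?f (Suc J) m - \<kappa> * ?f J (Suc m)" for m
    proof -
      have "h \<kappa> ^ Suc (Suc m) = h \<kappa> ^ m * (h \<kappa>)\<^sup>2" by (simp add: power2_eq_square)
      also have "\<dots> = h \<kappa> ^ m - \<kappa> * h \<kappa> ^ Suc m" unfolding quad[OF \<kappa>] by (simp add: algebra_simps)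
      finally have h: "h \<kappa> ^ Suc (Suc m) = h \<kappa> ^ m - \<kappa> * h \<kappa> ^ Suc m" .
      show ?thesis unfolding h
        by (simp add: sum.lessThan_Suc_shift sum_subtractf sum_distrib_left algebra_simps del: sum.lessThan_Suc)
    qed
    show "cmod (?f (Suc J) 0) \<le> C' * cmod \<kappa> ^ Suc J"
      by (simp add: sum.lessThan_Suc_shift C'_def del: sum.lessThan_Suc power_Suc)
    have "(\<Sum>j<Suc J. power_coeff e j 1 * \<kappa> ^ j) = (\<Sum>j<Suc J. e j * \<kappa> ^ j)"
    proof (rule sum.cong)
      show "power_coeff e j 1 * \<kappa> ^ j = e j * \<kappa> ^ j" for j using e0 by (cases j) auto
    qed simp
    then have "cmod (?f (Suc J) 1) \<le> C1 * cmod \<kappa> ^ Suc J" using C1[OF \<kappa>] by simp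
    also have "\<dots> \<le> C' * cmod \<kappa> ^ Suc J" by (intro mult_right_mono) (auto simp: C'_def)
    finally show "cmod (?f (Suc J) 1) \<le> C' * cmod \<kappa> ^ Suc J" .
    show "cmod (\<kappa> * ?f J m) \<le> C' * cmod \<kappa> ^ Suc J * (real m + 1) ^ J" for m
    proof -
      have "cmod (?f J m) \<le> C' * cmod \<kappa> ^ J * (real m + 1) ^ J"
        by (rule order_trans[OF C[OF \<kappa>]]) (auto simp: C'_def intro!: mult_right_mono)
      from mult_left_mono[OF this norm_ge_zero[of \<kappa>]] show ?thesis
        unfolding norm_mult by (simp add: mult.left_commute mult.assoc)
    qed
  qed
  then show ?case by blast
qed

section \<open>Analyticity of the root and expansion of the free kernel\<close>

lemma holomorphic_expansion:
  assumes f: "f holomorphic_on ball 0 1"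
  shows "\<exists>e. e 0 = f 0 \<and> (\<forall>J. \<exists>C. \<forall>z. cmod z < 1/2 \<longrightarrow> cmod (f z - (\<Sum>j<J. e j * z ^ j)) \<le> C * cmod z ^ J)"
proof -
  define e where "e n = (deriv ^^ n) f 0 / fact n" for n
  have sums: "(\<lambda>n. e n * z ^ n) sums f z" if "cmod z < 1" for z
    using holomorphic_power_series[OF f, of z] that by (simp add: e_def)
  \<comment> \<open>Any radius strictly between 1/2 and 1 would do. With 3/4 the coefficients are at
    most \<open>B (4/3)^n\<close>, and for \<open>|z| < 1/2\<close> the tail is dominated by a
    geometric series of ratio 2/3 with sum 3.\<close>
  have "(\<lambda>n. e n * (3/4) ^ n) \<longlonglongrightarrow> 0"
    using sums[of "3/4", THEN sums_summable, THEN summable_LIMSEQ_zero] by simp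
  then have "Bseq (\<lambda>n. e n * (3/4) ^ n)" by (intro convergent_imp_Bseq convergentI)
  then obtain B where B: "B > 0" "\<And>n. cmod (e n * (3/4) ^ n) \<le> B" by (auto simp: Bseq_def)
  have coeff: "cmod (e n) \<le> B * (4/3) ^ n" for n
    using B(2)[of n] by (simp add: norm_mult norm_power norm_divide power_divide field_simps)
  have "cmod (f z - (\<Sum>j<J. e j * z ^ j)) \<le> (3 * B * (4/3) ^ J) * cmod z ^ J" if z: "cmod z < 1/2" for z J
  proof -
    have sm: "summable (\<lambda>n. e n * z ^ n)" and fz: "f z = (\<Sum>n. e n * z ^ n)"
      using sums[of z] z by (auto simp: sums_iff)
    have "f z - (\<Sum>j<J. e j * z ^ j) = (\<Sum>n. e (n + J) * z ^ (n + J))"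
      unfolding fz by (subst suminf_minus_initial_segment[OF sm]) simp
    also have "cmod \<dots> \<le> (\<Sum>n. (B * (4/3) ^ J * cmod z ^ J) * (2/3) ^ n)"
    proof (rule norm_suminf_le)
      show "norm (e (n + J) * z ^ (n + J)) \<le> (B * (4/3) ^ J * cmod z ^ J) * (2/3) ^ n" for n
      proof -
        have "norm (e (n + J) * z ^ (n + J)) \<le> (B * (4/3) ^ (n + J)) * (cmod z ^ J * (1/2) ^ n)"
          unfolding norm_mult norm_power power_add
          using z B(1) coeff[of "n + J"]
          by (subst mult.commute[of "cmod z ^ n"]) (intro mult_mono mult_left_mono power_mono; simp add: power_add)
        also have "\<dots> = (B * (4/3) ^ J * cmod z ^ J) * ((4/3) ^ n * (1/2) ^ n)" by (simp add: power_add)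
        also have "(4/3) ^ n * (1/2) ^ n = (2/3 :: real) ^ n" by (simp flip: power_mult_distrib)
        finally show ?thesis .
      qed
    qed (intro summable_mult summable_geometric, simp)
    also have "\<dots> = (B * (4/3) ^ J * cmod z ^ J) * 3"
      by (subst suminf_mult) (auto simp: summable_geometric suminf_geometric)
    finally show ?thesis by (simp add: mult.assoc mult.commute mult.left_commute)
  qed
  moreover have "e 0 = f 0" by (simp add: e_def)
  ultimately show ?thesis by blast
qed

text \<open>\<open>(eta \<kappa>)\<^sup>2\<close> is the root \<open>\<zeta>\<close> of \<open>\<zeta> + \<zeta>\<^sup>-\<^sup>1 = 2 + \<kappa>\<^sup>2\<close> with \<open>\<bar>\<zeta>\<bar> < 1\<close> for \<open>Re \<kappa> > 0\<close>.\<close>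

definition eta :: "complex \<Rightarrow> complex" where
  "eta \<kappa> = csqrt (1 + \<kappa>\<^sup>2 / 4) - \<kappa> / 2"

lemma eta_zero [simp]: "eta 0 = 1" by (simp add: eta_def)

lemma eta_quadratic: "(eta \<kappa>)\<^sup>2 = 1 - \<kappa> * eta \<kappa>"
proof -
  have "(csqrt (1 + \<kappa>\<^sup>2 / 4))\<^sup>2 = 1 + \<kappa>\<^sup>2 / 4" by simp
  then show ?thesis unfolding eta_def by (simp add: power2_eq_square field_simps)
qed

lemma Re_one_plus_square_pos: "cmod \<kappa> < 1 \<Longrightarrow> Re (1 + \<kappa>\<^sup>2) > 0"
proof -
  assume "cmod \<kappa> < 1"
  then have "cmod (\<kappa>\<^sup>2) < 1" by (simp add: norm_power power_less_one_iff)
  then show ?thesis using abs_Re_le_cmod[of "\<kappa>\<^sup>2"] by simp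
qed

lemma eta_holomorphic: "eta holomorphic_on ball 0 1"
proof -
  have "1 + \<kappa>\<^sup>2 / 4 \<notin> \<real>\<^sub>\<le>\<^sub>0" if "\<kappa> \<in> ball 0 1" for \<kappa> :: complex
  proof -
    have "Re (1 + (\<kappa> / 2)\<^sup>2) > 0" using that by (intro Re_one_plus_square_pos) (simp add: norm_divide)
    then show ?thesis by (auto simp: complex_nonpos_Reals_iff power_divide)
  qed
  then show ?thesis unfolding eta_def by (intro holomorphic_intros) auto
qed

text \<open>With \<open>k\<close> half of \<kappa> and \<open>s\<close> the root of
  \<open>1 + k^2\<close>, one has \<open>(s - k) (s + k) = 1\<close>, so it suffices that
  \<open>s - k\<close> is the smaller factor, that is, that the real inner product of
  \<open>s\<close> and \<open>k\<close> is positive. This follows from \<open>Re s > 0\<close> and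
  from comparing the imaginary parts of \<open>s^2\<close> and \<open>1 + k^2\<close>.\<close>

lemma cmod_eta_less_1:
  assumes "Re \<kappa> > 0" "cmod \<kappa> < 1"
  shows "cmod (eta \<kappa>) < 1"
proof -
  define k where "k = \<kappa> / 2"
  define s where "s = csqrt (1 + k\<^sup>2)"
  have eta: "eta \<kappa> = s - k" by (simp add: eta_def s_def k_def power_divide)
  have sq: "s\<^sup>2 = 1 + k\<^sup>2" by (simp add: s_def)
  have k: "Re k > 0" "cmod k < 1" using assms by (auto simp: k_def norm_divide)
  have "Re (1 + k\<^sup>2) > 0" using k(2) by (rule Re_one_plus_square_pos)
  then have s: "Re s > 0" unfolding s_def csqrt.simps by (intro real_sqrt_gt_zero) (simp add: add_nonneg_pos)
  have re: "(Re s)\<^sup>2 - (Im s)\<^sup>2 = 1 + (Re k)\<^sup>2 - (Im k)\<^sup>2" and im: "Re s * Im s = Re k * Im k"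
    using arg_cong[OF sq, of Re] arg_cong[OF sq, of Im] by (simp_all add: Re_power2 Im_power2)
  have "Re s * (Re s * Re k + Im s * Im k) = (Re s)\<^sup>2 * Re k + Re k * (Im k)\<^sup>2"
    using im by (simp add: algebra_simps power2_eq_square)
  also have "\<dots> > 0" using s k by (simp add: add_pos_nonneg)
  finally have pos: "Re s * Re k + Im s * Im k > 0" using s by (simp add: zero_less_mult_iff)
  have "(cmod (s - k))\<^sup>2 < (cmod (s + k))\<^sup>2"
    using pos unfolding cmod_power2 by (simp add: power2_eq_square algebra_simps)
  then have lt: "cmod (s - k) < cmod (s + k)" by (rule power2_less_imp_less) simp
  have "(s - k) * (s + k) = 1" using sq by (simp add: algebra_simps power2_eq_square)
  then have "cmod (s - k) * cmod (s + k) = 1" by (metis norm_mult norm_one)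
  moreover have "cmod (s - k) * cmod (s + k) > 1" if "cmod (s - k) \<ge> 1"
    using that lt mult_right_mono[OF that norm_ge_zero[of "s + k"]] by linarith
  ultimately have "cmod (s - k) < 1" by fastforce
  then show ?thesis by (simp add: eta)
qed

text \<open>The radius is the one on which \<open>holomorphic_expansion\<close> controls remainders
  uniformly.\<close>

definition half_disc :: "complex set" where
  "half_disc = {\<kappa>. Re \<kappa> > 0 \<and> cmod \<kappa> < 1/2}"

definition resolvent_kernel :: "complex \<Rightarrow> ('k, 'n) vertex \<Rightarrow> ('k, 'n) vertex \<Rightarrow> complex" where
  "resolvent_kernel \<kappa> = free_kernel (1 / (1 + \<kappa>\<^sup>2)) (\<lambda>m. eta \<kappa> ^ m)"

text \<open>The expansion happens in the scalars \<open>1 / (1 + \<kappa>\<^sup>2)\<close> and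
  \<open>eta \<kappa> ^ m\<close>, and linearity carries it to the kernel. The family
  \<open>c\<close> is chosen before the weight, so that the same coefficients can later be read in
  different spaces.\<close>

lemma resolvent_kernel_expansion:
  "\<exists>c :: nat \<Rightarrow> ('k, 'n) vertex \<Rightarrow> ('k, 'n) vertex \<Rightarrow> complex.
     c 0 = free_kernel 1 (\<lambda>_. 1) \<and>
     (\<forall>j s. 1 \<le> s \<longrightarrow> real j \<le> s \<longrightarrow> (\<exists>C. kernel_bound s C (c j))) \<and>
     (\<forall>J s. 1 \<le> s \<longrightarrow> real J \<le> s \<longrightarrow> (\<exists>C. \<forall>\<kappa>\<in>half_disc.
        kernel_bound s (C * cmod \<kappa> ^ J) (\<lambda>p q. resolvent_kernel \<kappa> p q - (\<Sum>j<J. \<kappa> ^ j * c j p q))))"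
proof -
  have ne: "1 + \<kappa>\<^sup>2 \<noteq> 0" if "cmod \<kappa> < 1" for \<kappa> using Re_one_plus_square_pos[OF that] by (metis less_irrefl zero_complex.sel(1))
  obtain e where e: "e 0 = 1" "\<And>J. \<exists>C. \<forall>z. cmod z < 1/2 \<longrightarrow> cmod (eta z - (\<Sum>j<J. e j * z ^ j)) \<le> C * cmod z ^ J"
    using holomorphic_expansion[OF eta_holomorphic] by auto
  have "(\<lambda>\<kappa>. 1 / (1 + \<kappa>\<^sup>2)) holomorphic_on ball 0 1" by (intro holomorphic_intros) (use ne in auto)
  from holomorphic_expansion[OF this] obtain d where d: "d 0 = 1"
    "\<And>J. \<exists>C. \<forall>z. cmod z < 1/2 \<longrightarrow> cmod (1 / (1 + z\<^sup>2) - (\<Sum>j<J. d j * z ^ j)) \<le> C * cmod z ^ J" by auto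
  define c :: "nat \<Rightarrow> ('k, 'n) vertex \<Rightarrow> ('k, 'n) vertex \<Rightarrow> complex"
    where "c j = free_kernel (d j) (power_coeff e j)" for j
  have c0: "c 0 = free_kernel 1 (\<lambda>_. 1)" 
  proof -
    have "power_coeff e 0 = (\<lambda>_. 1)" by (simp add: fun_eq_iff)
    then show ?thesis by (simp add: c_def d(1))
  qed
  have cb: "\<exists>C. kernel_bound s C (c j)" if s: "1 \<le> s" "real j \<le> s" for j s
  proof -
    obtain C where C: "\<And>m. cmod (power_coeff e j m) \<le> C * (real m + 1) ^ j" using power_coeff_bound by blast
    have "cmod (power_coeff e j m) \<le> max C (cmod (d j)) * (real m + 1) ^ j" for m
      by (rule order_trans[OF C]) (auto intro!: mult_right_mono)
    from free_kernel_bound[OF max.cobounded2 this s] show ?thesis unfolding c_def by blast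
  qed
  have diff: "resolvent_kernel \<kappa> p q - (\<Sum>j<J. \<kappa> ^ j * c j p q) =
      free_kernel (1 / (1 + \<kappa>\<^sup>2) - (\<Sum>j<J. d j * \<kappa> ^ j)) (\<lambda>m. eta \<kappa> ^ m - (\<Sum>j<J. power_coeff e j m * \<kappa> ^ j)) p q"
    for \<kappa> J p q
  proof (induction J)
    case (Suc J)
    have "resolvent_kernel \<kappa> p q - (\<Sum>j<Suc J. \<kappa> ^ j * c j p q) =
      (resolvent_kernel \<kappa> p q - (\<Sum>j<J. \<kappa> ^ j * c j p q)) - \<kappa> ^ J * c J p q" by simp
    also have "\<dots> = free_kernel (1 / (1 + \<kappa>\<^sup>2) - (\<Sum>j<Suc J. d j * \<kappa> ^ j))
        (\<lambda>m. eta \<kappa> ^ m - (\<Sum>j<Suc J. power_coeff e j m * \<kappa> ^ j)) p q"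
      unfolding Suc unfolding c_def free_kernel_diff by (simp add: algebra_simps)
    finally show ?case .
  qed (simp add: resolvent_kernel_def)
  have "\<exists>C. \<forall>\<kappa>\<in>half_disc.
        kernel_bound s (C * cmod \<kappa> ^ J) (\<lambda>p q. resolvent_kernel \<kappa> p q - (\<Sum>j<J. \<kappa> ^ j * c j p q) )"
    if s: "1 \<le> s" "real J \<le> s" for J s
  proof -
    have "\<exists>C. \<forall>\<kappa>\<in>half_disc. \<forall>m. cmod (eta \<kappa> ^ m - (\<Sum>j<J. power_coeff e j m * \<kappa> ^ j)) \<le> C * cmod \<kappa> ^ J * (real m + 1) ^ J"
    proof (rule power_expansion[of e, OF e(1)])
      show "\<exists>C. \<forall>\<kappa>\<in>half_disc. cmod (eta \<kappa> - (\<Sum>j<J. e j * \<kappa> ^ j)) \<le> C * cmod \<kappa> ^ J" for J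
        using e(2)[of J] by (auto simp: half_disc_def)
      show "cmod (eta \<kappa>) \<le> 1" if "\<kappa> \<in> half_disc" for \<kappa>
        using that cmod_eta_less_1[of \<kappa>] by (auto simp: half_disc_def)
    qed (rule eta_quadratic)
    then obtain C where C: "\<And>\<kappa> m. \<kappa> \<in> half_disc \<Longrightarrow>
        cmod (eta \<kappa> ^ m - (\<Sum>j<J. power_coeff e j m * \<kappa> ^ j)) \<le> C * cmod \<kappa> ^ J * (real m + 1) ^ J" by blast
    obtain C' where C': "\<And>z. cmod z < 1/2 \<Longrightarrow> cmod (1 / (1 + z\<^sup>2) - (\<Sum>j<J. d j * z ^ j)) \<le> C' * cmod z ^ J"
      using d(2) by blast
    have "kernel_bound s (max C C' * cmod \<kappa> ^ J * 4 ^ J) (free_kernel (1 / (1 + \<kappa>\<^sup>2) - (\<Sum>j<J. d j * \<kappa> ^ j))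
        (\<lambda>m. eta \<kappa> ^ m - (\<Sum>j<J. power_coeff e j m * \<kappa> ^ j)))" if \<kappa>: "\<kappa> \<in> half_disc" for \<kappa>
    proof (rule free_kernel_bound[OF _ _ s])
      show "cmod (1 / (1 + \<kappa>\<^sup>2) - (\<Sum>j<J. d j * \<kappa> ^ j)) \<le> max C C' * cmod \<kappa> ^ J"
        using \<kappa> by (intro order_trans[OF C']) (auto simp: half_disc_def intro!: mult_right_mono)
      show "cmod (eta \<kappa> ^ m - (\<Sum>j<J. power_coeff e j m * \<kappa> ^ j)) \<le> max C C' * cmod \<kappa> ^ J * (real m + 1) ^ J" for m
        by (rule order_trans[OF C[OF \<kappa>]]) (auto intro!: mult_right_mono)
    qed
    then have "\<forall>\<kappa>\<in>half_disc. kernel_bound s (max C C' * 4 ^ J * cmod \<kappa> ^ J)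
        (\<lambda>p q. resolvent_kernel \<kappa> p q - (\<Sum>j<J. \<kappa> ^ j * c j p q))"
      unfolding diff by (auto simp: mult.commute mult.left_commute)
    then show ?thesis by blast
  qed
  then show ?thesis using c0 cb by blast
qed

subsection \<open>Fredholm alternative\<close>

declare plus_fun_apply [simp del] minus_apply [simp del] uminus_apply [simp del] zero_fun_apply [simp del] smul_apply [simp del]

lemmas pointwise = plus_fun_apply minus_apply uminus_apply zero_fun_apply smul_apply

text \<open>A dimension count: the columns, extended by 0 outside \<open>F\<close>, are independent,
  and a right-hand side outside their span would give \<open>card F + 1\<close> independent
  functions in a space spanned by \<open>card F\<close> point masses.\<close>

lemma finite_linear_system_solvable:
  fixes M :: "'a \<Rightarrow> 'a \<Rightarrow> 'f::field"
  assumes F: "finite F"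
    and inj: "\<And>c. \<forall>p\<in>F. (\<Sum>q\<in>F. M p q * c q) = 0 \<Longrightarrow> \<forall>q\<in>F. c q = 0"
  shows "\<exists>c. \<forall>p\<in>F. (\<Sum>q\<in>F. M p q * c q) = y p"
proof -
  define scale where "scale = (\<lambda>(c::'f) (f::'a \<Rightarrow> 'f) x. c * f x)"
  interpret vector_space scale
    by unfold_locales (auto simp: scale_def fun_eq_iff plus_fun_apply distrib_left distrib_right mult.assoc)
  have sum_apply: "(\<Sum>v\<in>S. f v) x = (\<Sum>v\<in>S. f v x)" for S :: "'b set" and f :: "'b \<Rightarrow> 'a \<Rightarrow> 'f" and x
    by (induction S rule: infinite_finite_induct) (auto simp: pointwise)
  define col where "col q = (\<lambda>p. if p \<in> F then M p q else 0)" for q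
  define e where "e p = (\<lambda>x. if x = p then 1 else (0::'f))" for p :: 'a
  \<comment> \<open>Independence is stated for the set of columns, so repeated columns have to be
    excluded first; two equal ones would be annihilated by a vector with entries 1 and -1.\<close>
  have col_inj: "inj_on col F"
  proof (rule inj_onI, rule ccontr)
    fix q q' assume q: "q \<in> F" "q' \<in> F" "col q = col q'" "q \<noteq> q'"
    define c where "c x = (if x = q then 1 else if x = q' then -1 else (0::'f))" for x
    have "(\<Sum>x\<in>F. M p x * c x) = 0" if p: "p \<in> F" for p
    proof -
      have "(\<Sum>x\<in>F. M p x * c x) = (\<Sum>x\<in>{q, q'}. M p x * c x)"
        using F q by (intro sum.mono_neutral_right) (auto simp: c_def)
      also have "\<dots> = M p q - M p q'" using q by (simp add: c_def)
      also have "\<dots> = 0" using fun_cong[OF q(3), of p] p by (simp add: col_def)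
      finally show ?thesis .
    qed
    then have "c q = 0" using inj q by blast
    then show False by (simp add: c_def)
  qed
  have ind: "independent (col ` F)"
  proof
    assume "dependent (col ` F)"
    then obtain u where u: "\<exists>v\<in>col ` F. u v \<noteq> 0" "(\<Sum>v\<in>col ` F. scale (u v) v) = 0"
      using F by (auto simp: dependent_finite)
    have "(\<Sum>q\<in>F. M p q * u (col q)) = 0" if p: "p \<in> F" for p
    proof -
      have "(\<Sum>v\<in>col ` F. scale (u v) v) p = (\<Sum>q\<in>F. M p q * u (col q))"
        unfolding sum_apply sum.reindex[OF col_inj] o_def
        using p by (intro sum.cong) (simp_all add: scale_def col_def)
      then show ?thesis using u(2) by (simp add: pointwise)
    qed
    then have "\<forall>q\<in>F. u (col q) = 0" using inj[of "\<lambda>q. u (col q)"] by blast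
    then show False using u(1) by blast
  qed
  have in_span: "f \<in> span (e ` F)" if "\<And>x. x \<notin> F \<Longrightarrow> f x = 0" for f
  proof -
    have "f = (\<Sum>p\<in>F. scale (f p) (e p))"
    proof
      fix x
      show "f x = (\<Sum>p\<in>F. scale (f p) (e p)) x"
        unfolding sum_apply using F that[of x] by (cases "x \<in> F") (simp_all add: scale_def e_def if_distrib cong: if_cong)
    qed
    moreover have "(\<Sum>p\<in>F. scale (f p) (e p)) \<in> span (e ` F)"
      by (intro span_sum span_scale span_base) auto
    ultimately show ?thesis by simp
  qed
  define y' where "y' = (\<lambda>p. if p \<in> F then y p else 0)"
  have "y' \<in> span (col ` F)"
  proof (rule ccontr)
    assume no: "y' \<notin> span (col ` F)"
    then have "independent (insert y' (col ` F))" using ind by (simp add: independent_insert)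
    moreover have "insert y' (col ` F) \<subseteq> span (e ` F)" by (auto intro!: in_span simp: y'_def col_def)
    ultimately have "card (insert y' (col ` F)) \<le> card (e ` F)"
      using independent_span_bound[of "e ` F"] F by blast
    moreover have "card (insert y' (col ` F)) = Suc (card F)"
      using no F span_base by (subst card_insert_disjoint) (auto simp: card_image[OF col_inj])
    moreover have "card (e ` F) \<le> card F" by (rule card_image_le[OF F])
    ultimately show False by simp
  qed
  then obtain u where u: "y' = (\<Sum>v\<in>col ` F. scale (u v) v)"
    using span_finite[of "col ` F"] F by auto
  have "(\<Sum>q\<in>F. M p q * u (col q)) = y p" if p: "p \<in> F" for p
  proof -
    have "y' p = (\<Sum>q\<in>F. M p q * u (col q))"
      unfolding u sum_apply sum.reindex[OF col_inj] o_def
      using p by (intro sum.cong) (simp_all add: scale_def col_def)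
    then show ?thesis using p by (simp add: y'_def)
  qed
  then show ?thesis by (intro exI[of _ "\<lambda>q. u (col q)"]) blast
qed

text \<open>Banach's argument in the weighted sup norm. The limit is formed pointwise as a
  telescoping series; its tail bound is uniform relative to the weight and yields both membership in
  the space and convergence in norm.\<close>

lemma contraction_fixed_point:
  fixes A :: "('k, 'n) oper"
  assumes A: "\<And>u. u \<in> Ldual s \<Longrightarrow> A u \<in> Ldual s"
    and contr: "\<And>u w. u \<in> Ldual s \<Longrightarrow> w \<in> Ldual s \<Longrightarrow> normLdual s (A u - A w) \<le> normLdual s (u - w) / 2"
  shows "\<exists>u\<in>Ldual s. A u = u"
proof -
  define X where "X n = (A ^^ n) 0" for n
  have X: "X n \<in> Ldual s" for n by (induction n) (simp_all add: X_def A )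
  define D where "D = normLdual s (X 1 - X 0)"
  have D: "D \<ge> 0" unfolding D_def by (intro normLdual_nonneg Ldual_diff X)
  have step: "normLdual s (X (Suc n) - X n) \<le> D * (1/2) ^ n" for n
  proof (induction n)
    case (Suc n)
    have "normLdual s (X (Suc (Suc n)) - X (Suc n)) \<le> normLdual s (X (Suc n) - X n) / 2"
      using contr[OF X X, of "Suc n" n] by (simp add: X_def)
    then show ?case using Suc by simp
  qed (simp add: D_def)
  have step_pt: "cmod (X (Suc n) p - X n p) \<le> (D * weight s p) * (1/2) ^ n" for n p
  proof -
    have "cmod (X (Suc n) p - X n p) \<le> normLdual s (X (Suc n) - X n) * weight s p"
      using Ldual_bound[OF Ldual_diff(1)[OF X X], of "Suc n" n p] by (simp add: pointwise)
    also have "\<dots> \<le> (D * (1/2) ^ n) * weight s p" by (intro mult_right_mono step) auto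
    finally show ?thesis by (simp add: mult.commute mult.left_commute)
  qed
  have sm: "summable (\<lambda>n. (D * weight s p) * (1/2) ^ n)" for p
    by (intro summable_mult summable_geometric) simp
  define u where "u p = (\<Sum>n. X (Suc n) p - X n p)" for p
  have sm': "summable (\<lambda>n. X (Suc n) p - X n p)" for p
    by (rule summable_comparison_test'[OF sm[of p]]) (use step_pt in auto)
  have tail: "cmod ((u - X n) p) \<le> (2 * D * (1/2) ^ n) * weight s p" for n p
  proof -
    have "(\<Sum>i<n. X (Suc i) p - X i p) = X n p" by (subst sum_lessThan_telescope) (simp add: X_def pointwise)
    then have "(u - X n) p = (\<Sum>i. X (Suc (i + n)) p - X (i + n) p)"
      unfolding u_def pointwise using suminf_minus_initial_segment[OF sm'[of p], of n] by simp
    also have "cmod \<dots> \<le> (\<Sum>i. (D * weight s p * (1/2) ^ n) * (1/2) ^ i)"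
    proof (rule norm_suminf_le)
      show "norm (X (Suc (i + n)) p - X (i + n) p) \<le> (D * weight s p * (1/2) ^ n) * (1/2) ^ i" for i
        using step_pt[of "i + n" p] by (simp add: power_add mult.commute mult.left_commute)
    qed (intro summable_mult summable_geometric, simp)
    also have "\<dots> = (D * weight s p * (1/2) ^ n) * 2"
      by (subst suminf_mult) (auto simp: summable_geometric suminf_geometric)
    finally show ?thesis by (simp add: mult.assoc mult.commute mult.left_commute)
  qed
  have diffL: "u - X n \<in> Ldual s" "normLdual s (u - X n) \<le> 2 * D * (1/2) ^ n" for n
    by (rule LdualI, rule tail)+
  have uL: "u \<in> Ldual s" using diffL(1)[of 0] by (simp add: X_def)
  have le: "normLdual s (A u - u) \<le> 2 * D * (1/2) ^ n" for n
  proof -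
    have "A u - u = (A u - A (X n)) - (u - X (Suc n))" by (simp add: X_def)
    then have "normLdual s (A u - u) \<le> normLdual s (A u - A (X n)) + normLdual s (u - X (Suc n))"
      using Ldual_diff(2)[OF Ldual_diff(1)[OF A[OF uL] A[OF X]] diffL(1)] by metis
    also have "\<dots> \<le> (2 * D * (1/2) ^ n) / 2 + 2 * D * (1/2) ^ Suc n"
      using contr[OF uL X, of n] diffL(2)[of n] diffL(2)[of "Suc n"] by linarith
    finally show ?thesis by simp
  qed
  have "(\<lambda>n. 2 * D * (1/2) ^ n) \<longlonglongrightarrow> 2 * D * 0"
    by (intro tendsto_mult tendsto_const LIMSEQ_power_zero) simp
  then have "normLdual s (A u - u) \<le> 0" using le by (intro LIMSEQ_le_const[of _ 0]) auto
  have "A u = u"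
  proof
    fix p
    have "cmod ((A u - u) p) \<le> normLdual s (A u - u) * weight s p"
      by (rule Ldual_bound[OF Ldual_diff(1)[OF A[OF uL] uL]])
    also have "\<dots> \<le> 0" using \<open>normLdual s (A u - u) \<le> 0\<close> by (simp add: mult_nonpos_nonneg)
    finally show "A u p = u p" by (simp add: pointwise)
  qed
  then show ?thesis using uL by blast
qed

definition linear_Ldual :: "real \<Rightarrow> ('k, 'n) oper \<Rightarrow> bool" where
  "linear_Ldual s A \<longleftrightarrow> (\<forall>u\<in>Ldual s. A u \<in> Ldual s) \<and>
     (\<forall>u\<in>Ldual s. \<forall>w\<in>Ldual s. A (u + w) = A u + A w) \<and> (\<forall>c. \<forall>u\<in>Ldual s. A (smul c u) = smul c (A u))"

lemma linear_LdualD: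
  assumes "linear_Ldual s A"
  shows "u \<in> Ldual s \<Longrightarrow> A u \<in> Ldual s"
    and "u \<in> Ldual s \<Longrightarrow> w \<in> Ldual s \<Longrightarrow> A (u + w) = A u + A w"
    and "u \<in> Ldual s \<Longrightarrow> A (smul c u) = smul c (A u)"
    and "u \<in> Ldual s \<Longrightarrow> w \<in> Ldual s \<Longrightarrow> A (u - w) = A u - A w"
    and "A 0 = 0"
proof -
  show A: "u \<in> Ldual s \<Longrightarrow> A u \<in> Ldual s" "u \<in> Ldual s \<Longrightarrow> w \<in> Ldual s \<Longrightarrow> A (u + w) = A u + A w"
    "u \<in> Ldual s \<Longrightarrow> A (smul c u) = smul c (A u)" for u w c
    using assms by (auto simp: linear_Ldual_def)
  show "u \<in> Ldual s \<Longrightarrow> w \<in> Ldual s \<Longrightarrow> A (u - w) = A u - A w"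
    using A(2)[of u "- w"] A(3)[of w "-1"] Ldual_uminus(1)[of w] by (simp add: smul_minus_one)
  have "A (smul 0 0) = smul 0 (A 0)" by (rule A) simp
  moreover have "smul 0 u = 0" for u :: "('a, 'b) state" by (auto simp: fun_eq_iff pointwise)
  ultimately show "A 0 = 0" by simp
qed

lemma linear_Ldual_sum:
  assumes A: "linear_Ldual s A" and "finite F" "\<And>i. i \<in> F \<Longrightarrow> b i \<in> Ldual s"
  shows "A (\<Sum>i\<in>F. smul (c i) (b i)) = (\<Sum>i\<in>F. smul (c i) (A (b i)))"
  using assms(2,3)
proof (induction F rule: finite_induct)
  case (insert i F)
  then have "A (smul (c i) (b i) + (\<Sum>i\<in>F. smul (c i) (b i))) =
      A (smul (c i) (b i)) + A (\<Sum>i\<in>F. smul (c i) (b i))"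
    by (intro linear_LdualD(2)[OF A] Ldual_smul Ldual_sum) auto
  moreover have "A (smul (c i) (b i)) = smul (c i) (A (b i))" using insert by (intro linear_LdualD(3)[OF A]) auto
  ultimately show ?case using insert by simp
qed (use linear_LdualD(5)[OF A] in simp)

text \<open>Bounded invertibility of \<open>1 + A\<close>, expressed by a lower bound and
  surjectivity. The constant is a parameter because one value must later serve all small
  \<kappa>.\<close>

definition one_plus_iso :: "real \<Rightarrow> real \<Rightarrow> ('k, 'n) oper \<Rightarrow> bool" where
  "one_plus_iso s C A \<longleftrightarrow> (\<forall>u\<in>Ldual s. normLdual s u \<le> C * normLdual s (u + A u)) \<and>
     (\<forall>w\<in>Ldual s. \<exists>u\<in>Ldual s. u + A u = w)"

text \<open>With \<open>R\<close> the inverse of \<open>1 + A\<close>, the equation becomes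
  \<open>u = R (w - P u)\<close>. Smallness of \<open>P\<close> makes the right-hand side a
  contraction of factor 1/2 and, absorbed into the lower bound, doubles the constant.\<close>

lemma one_plus_iso_perturb:
  fixes A P :: "('k, 'n) oper"
  assumes A: "linear_Ldual s A" and P: "linear_Ldual s P" and iso: "one_plus_iso s C A" and C: "C \<ge> 0"
    and small: "\<And>u. u \<in> Ldual s \<Longrightarrow> C * normLdual s (P u) \<le> normLdual s u / 2"
  shows "one_plus_iso s (2 * C) (\<lambda>u. A u + P u)"
proof -
  note AL = linear_LdualD[OF A] and PL = linear_LdualD[OF P]
  define R where "R w = (SOME u. u \<in> Ldual s \<and> u + A u = w)" for w
  have R: "R w \<in> Ldual s" "R w + A (R w) = w" if "w \<in> Ldual s" for w
    using iso that someI_ex[of "\<lambda>u. u \<in> Ldual s \<and> u + A u = w"] by (auto simp: one_plus_iso_def R_def)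
  have Rdiff: "normLdual s (R w - R w') \<le> C * normLdual s (w - w')" if w: "w \<in> Ldual s" "w' \<in> Ldual s" for w w'
  proof -
    have "(R w - R w') + A (R w - R w') = (R w + A (R w)) - (R w' + A (R w'))"
      using AL(4)[OF R(1)[OF w(1)] R(1)[OF w(2)]] by simp
    then show ?thesis using iso Ldual_diff(1)[OF R(1)[OF w(1)] R(1)[OF w(2)]] R(2)[OF w(1)] R(2)[OF w(2)]
      by (auto simp: one_plus_iso_def)
  qed
  have surj: "\<exists>u\<in>Ldual s. u + (A u + P u) = w" if w: "w \<in> Ldual s" for w :: "('k, 'n) state"
  proof -
    have "\<exists>u\<in>Ldual s. R (w - P u) = u"
    proof (rule contraction_fixed_point)
      show "R (w - P u) \<in> Ldual s" if "u \<in> Ldual s" for u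
        using that w by (intro R Ldual_diff PL)
      fix u u' :: "('k, 'n) state" assume u: "u \<in> Ldual s" "u' \<in> Ldual s"
      have "normLdual s (R (w - P u) - R (w - P u')) \<le> C * normLdual s ((w - P u) - (w - P u'))"
        by (intro Rdiff Ldual_diff w PL u)
      also have "(w - P u) - (w - P u') = P (u' - u)" using PL(4)[OF u(2,1)] by simp
      also have "C * normLdual s (P (u' - u)) \<le> normLdual s (u' - u) / 2"
        by (intro small Ldual_diff u)
      also have "normLdual s (u' - u) \<le> normLdual s (u - u')"
        using Ldual_uminus(2)[OF Ldual_diff(1)[OF u]] by simp
      finally show "normLdual s (R (w - P u) - R (w - P u')) \<le> normLdual s (u - u') / 2" by simp
    qed
    then obtain u where u: "u \<in> Ldual s" "R (w - P u) = u" by blast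
    have "u + A u = w - P u" using R(2)[of "w - P u"] u Ldual_diff(1)[OF w PL(1)[OF u(1)]] by simp
    then have "u + (A u + P u) = w" by (simp add: algebra_simps)
    then show ?thesis using u by blast
  qed
  have "normLdual s u \<le> 2 * C * normLdual s (u + (A u + P u))" if u: "u \<in> Ldual s" for u
  proof -
    have in1: "u + (A u + P u) \<in> Ldual s" by (intro Ldual_add u AL PL)
    have "normLdual s u \<le> C * normLdual s (u + A u)" using iso u by (auto simp: one_plus_iso_def)
    also have "u + A u = (u + (A u + P u)) - P u" by simp
    also have "C * normLdual s \<dots> \<le> C * (normLdual s (u + (A u + P u)) + normLdual s (P u))"
      by (intro mult_left_mono Ldual_diff in1 PL u C)
    also have "\<dots> \<le> C * normLdual s (u + (A u + P u)) + normLdual s u / 2"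
      using small[OF u] by (simp add: distrib_left)
    finally show ?thesis by simp
  qed
  then show ?thesis using surj by (auto simp: one_plus_iso_def)
qed

text \<open>Let \<open>y\<close> and \<open>b p\<close> solve the equation for \<open>B\<close> with
  right-hand sides \<open>w\<close> and \<open>a p\<close>. The ansatz \<open>u = y - comb c\<close>
  solves the equation for \<open>A\<close> as soon as \<open>c\<close> lists the values of
  \<open>u\<close> on \<open>F\<close>, which is a square linear system. Injectivity of
  \<open>1 + A\<close> makes that system injective, hence solvable.\<close>

lemma one_plus_iso_finite_rank:
  assumes B: "linear_Ldual s B" and iso: "one_plus_iso s C B" and C: "C \<ge> 0"
    and F: "finite F" and a: "\<And>p. p \<in> F \<Longrightarrow> a p \<in> Ldual s"
    and A: "linear_Ldual s A" and AB: "\<And>u. u \<in> Ldual s \<Longrightarrow> A u = B u + (\<Sum>p\<in>F. smul (u p) (a p))"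
    and inj: "\<And>u. u \<in> Ldual s \<Longrightarrow> u + A u = 0 \<Longrightarrow> u = 0"
  shows "\<exists>C'\<ge>0. one_plus_iso s C' A"
proof -
  note AL = linear_LdualD[OF A] and BL = linear_LdualD[OF B]
  have sum_apply: "(\<Sum>v\<in>S. f v) x = (\<Sum>v\<in>S. f v x)" for S :: "'c set" and f :: "'c \<Rightarrow> ('a, 'b) state" and x
    by (induction S rule: infinite_finite_induct) (auto simp: pointwise)
  have "\<forall>p\<in>F. \<exists>b\<in>Ldual s. b + B b = a p" using iso a by (auto simp: one_plus_iso_def)
  then obtain b where b: "\<And>p. p \<in> F \<Longrightarrow> b p \<in> Ldual s" "\<And>p. p \<in> F \<Longrightarrow> b p + B (b p) = a p" by metis
  define comb where "comb c = (\<Sum>q\<in>F. smul (c q) (b q))" for c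
  have combL: "comb c \<in> Ldual s" for c unfolding comb_def by (intro Ldual_sum Ldual_smul F b)
  have combB: "comb c + B (comb c) = (\<Sum>q\<in>F. smul (c q) (a q))" for c
  proof -
    have "B (comb c) = (\<Sum>q\<in>F. smul (c q) (B (b q)))"
      unfolding comb_def by (rule linear_Ldual_sum[OF B F b(1)])
    then have "comb c + B (comb c) = (\<Sum>q\<in>F. smul (c q) (b q) + smul (c q) (B (b q)))"
      by (simp add: comb_def sum.distrib)
    also have "\<dots> = (\<Sum>q\<in>F. smul (c q) (a q))"
      using b(2) by (intro sum.cong) (auto simp: fun_eq_iff pointwise distrib_left[symmetric])
    finally show ?thesis .
  qed
  have key: "(y - comb c) + A (y - comb c) = y + B y"
    if y: "y \<in> Ldual s" and c: "\<And>p. p \<in> F \<Longrightarrow> c p + comb c p = y p" for y c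
  proof -
    have "(\<Sum>p\<in>F. smul ((y - comb c) p) (a p)) = (\<Sum>p\<in>F. smul (c p) (a p))"
    proof (rule sum.cong)
      fix p assume "p \<in> F"
      then have "(y - comb c) p = c p" using c[of p] by (simp add: pointwise algebra_simps)
      then show "smul ((y - comb c) p) (a p) = smul (c p) (a p)" by simp
    qed simp
    moreover have "A (y - comb c) = (B y - B (comb c)) + (\<Sum>p\<in>F. smul ((y - comb c) p) (a p))"
      using AB[OF Ldual_diff(1)[OF y combL]] BL(4)[OF y combL] by simp
    ultimately have "(y - comb c) + A (y - comb c) = y + B y + (- (comb c + B (comb c)) + (\<Sum>p\<in>F. smul (c p) (a p)))"
      by (simp add: algebra_simps)
    then show ?thesis unfolding combB by simp
  qed
  define M where "M p q = (if p = q then 1 else 0) + b q p" for p q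
  have M: "(\<Sum>q\<in>F. M p q * c q) = c p + comb c p" if "p \<in> F" for p c
  proof -
    have "(\<Sum>q\<in>F. M p q * c q) = (\<Sum>q\<in>F. (if p = q then 1 else 0) * c q) + (\<Sum>q\<in>F. b q p * c q)"
      by (simp add: M_def distrib_right sum.distrib)
    also have "(\<Sum>q\<in>F. (if p = q then 1 else 0) * c q) = c p"
      using that F by (simp add: if_distrib[of "\<lambda>x. x * _"] cong: if_cong)
    finally show ?thesis unfolding comb_def sum_apply by (simp add: pointwise mult.commute)
  qed
  have Minj: "\<forall>q\<in>F. c q = 0" if c: "\<forall>p\<in>F. (\<Sum>q\<in>F. M p q * c q) = 0" for c
  proof -
    \<comment> \<open>A solution of the homogeneous system is the case \<open>y = 0\<close>: it puts
      \<open>- comb c\<close> into the kernel of \<open>1 + A\<close>. Once \<open>comb c\<close>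
      vanishes, the system itself reads \<open>c = 0\<close>.\<close>
    have "(0 - comb c) + A (0 - comb c) = 0 + B 0"
      by (rule key) (use c M in \<open>auto simp: pointwise\<close>)
    then have "0 - comb c = 0"
      using inj[OF Ldual_diff(1)[OF _ combL], of 0 c] BL(5) by simp
    then have "comb c p = 0" for p by (metis diff_0 neg_equal_0_iff_equal zero_fun_apply)
    then show ?thesis using c M by (auto simp: pointwise)
  qed
  \<comment> \<open>Solving for unit data gives the inverse matrix \<open>g\<close>; through it the
    coefficients depend on \<open>y\<close> with a bound independent of the right-hand side, as the
    constant \<open>C'\<close> requires.\<close>
  have "\<forall>r. \<exists>c. \<forall>p\<in>F. (\<Sum>q\<in>F. M p q * c q) = (if p = r then 1 else 0)"
    by (intro allI finite_linear_system_solvable[OF F]) (rule Minj)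
  then obtain g where g: "\<And>r p. p \<in> F \<Longrightarrow> (\<Sum>q\<in>F. M p q * g r q) = (if p = r then 1 else 0)" by metis
  define K where "K q = (\<Sum>r\<in>F. weight s r * cmod (g r q))" for q
  define C' where "C' = C * (1 + (\<Sum>q\<in>F. K q * normLdual s (b q)))"
  have K0: "K q \<ge> 0" for q unfolding K_def by (intro sum_nonneg) auto
  have C': "C' \<ge> 0" unfolding C'_def
    by (intro mult_nonneg_nonneg add_nonneg_nonneg sum_nonneg C K0 normLdual_nonneg b) auto
  have solve: "\<exists>u\<in>Ldual s. u + A u = w \<and> normLdual s u \<le> C' * normLdual s w" if w: "w \<in> Ldual s" for w
  proof -
    obtain y where y: "y \<in> Ldual s" "y + B y = w" using iso w by (auto simp: one_plus_iso_def)
    have ny: "normLdual s y \<le> C * normLdual s w" using iso y by (auto simp: one_plus_iso_def)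
    define c where "c q = (\<Sum>r\<in>F. y r * g r q)" for q
    have c: "c p + comb c p = y p" if p: "p \<in> F" for p
    proof -
      have "c p + comb c p = (\<Sum>q\<in>F. \<Sum>r\<in>F. M p q * (y r * g r q))"
        unfolding M[OF p, of c, symmetric] by (simp add: c_def sum_distrib_left)
      also have "\<dots> = (\<Sum>r\<in>F. y r * (\<Sum>q\<in>F. M p q * g r q))"
        by (subst sum.swap) (simp add: sum_distrib_left mult.left_commute)
      also have "\<dots> = y p" using p F by (simp add: g if_distrib[of "\<lambda>x. _ * x"] cong: if_cong)
      finally show ?thesis .
    qed
    have cq: "cmod (c q) \<le> normLdual s y * K q" for q
    proof -
      have "cmod (c q) \<le> (\<Sum>r\<in>F. (normLdual s y * weight s r) * cmod (g r q))"
        unfolding c_def using Ldual_bound[OF y(1)]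
        by (intro sum_norm_le) (auto simp: norm_mult intro!: mult_right_mono)
      then show ?thesis by (simp add: K_def sum_distrib_left mult.assoc)
    qed
    have "normLdual s (comb c) \<le> (\<Sum>q\<in>F. normLdual s (smul (c q) (b q)))"
      unfolding comb_def by (intro Ldual_sum Ldual_smul F b)
    also have "\<dots> \<le> (\<Sum>q\<in>F. (normLdual s y * K q) * normLdual s (b q))"
      by (intro sum_mono order_trans[OF Ldual_smul(2)] mult_right_mono cq b normLdual_nonneg)
    finally have "normLdual s (y - comb c) \<le> normLdual s y * (1 + (\<Sum>q\<in>F. K q * normLdual s (b q)))"
      using Ldual_diff(2)[OF y(1) combL, of c] by (simp add: distrib_left sum_distrib_left mult.assoc)
    also have "\<dots> \<le> (C * normLdual s w) * (1 + (\<Sum>q\<in>F. K q * normLdual s (b q)))"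
      by (intro mult_right_mono ny add_nonneg_nonneg sum_nonneg mult_nonneg_nonneg K0 normLdual_nonneg b) auto
    finally have "normLdual s (y - comb c) \<le> C' * normLdual s w" by (simp add: C'_def mult.commute mult.left_commute)
    moreover have "(y - comb c) + A (y - comb c) = w" using key[OF y(1) c] y(2) by simp
    ultimately show ?thesis using Ldual_diff(1)[OF y(1) combL] by blast
  qed
  have "normLdual s u \<le> C' * normLdual s (u + A u)" if u: "u \<in> Ldual s" for u
  proof -
    obtain u' where u': "u' \<in> Ldual s" "u' + A u' = u + A u" "normLdual s u' \<le> C' * normLdual s (u + A u)"
      using solve[OF Ldual_add(1)[OF u AL(1)[OF u]]] by blast
    have "(u' - u) + A (u' - u) = (u' + A u') - (u + A u)" using AL(4)[OF u'(1) u] by simp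
    then have "u' - u = 0" using inj[OF Ldual_diff(1)[OF u'(1) u]] u'(2) by simp
    then show ?thesis using u'(3) by simp
  qed
  then show ?thesis using solve C' by (intro exI[of _ C']) (auto simp: one_plus_iso_def)
qed

subsection \<open>The threshold equation\<close>

definition core_coupling :: "'k::finite set set \<Rightarrow> ('n::finite \<Rightarrow> 'k) \<Rightarrow> ('k, 'n) oper" where
  "core_coupling E xs u = (\<lambda>p. case p of
     Core x \<Rightarrow> h_core E xs (\<lambda>y. u (Core y)) x - u (Core x) | Ray _ _ \<Rightarrow> 0)"

definition coupling :: "'k::finite set set \<Rightarrow> ('n::finite \<Rightarrow> 'k) \<Rightarrow> ('k, 'n) oper \<Rightarrow> ('k, 'n) oper" where
  "coupling E xs V u = V u + core_coupling E xs u"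

lemma Hop_eq_decoupled_op: "Hop E xs V u = decoupled_op u + coupling E xs V u"
proof
  fix p
  show "Hop E xs V u p = (decoupled_op u + coupling E xs V u) p"
    by (cases p) (simp_all add: Hop_def H0_def decoupled_op_def coupling_def core_coupling_def pointwise)
qed

lemma core_coupling_add: "core_coupling E xs (u + w) = core_coupling E xs u + core_coupling E xs w"
proof
  fix p
  show "core_coupling E xs (u + w) p = (core_coupling E xs u + core_coupling E xs w) p"
    by (cases p) (simp_all add: core_coupling_def h_core_def pointwise sum.distrib sum_subtractf algebra_simps)
qed

lemma core_coupling_smul: "core_coupling E xs (smul c u) = smul c (core_coupling E xs u)"
proof
  fix p
  show "core_coupling E xs (smul c u) p = smul c (core_coupling E xs u) p"
    by (cases p) (simp_all add: core_coupling_def h_core_def pointwise sum_distrib_left right_diff_distrib distrib_left mult.left_commute)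
qed

lemma core_coupling_bounded:
  fixes E :: "'k::finite set set" and xs :: "'n::finite \<Rightarrow> 'k"
  shows "\<exists>C\<ge>0. \<forall>u\<in>Ldual s. core_coupling E xs u \<in> Lsp s \<and> normL s (core_coupling E xs u) \<le> C * normLdual s u"
proof -
  define K where "K = (\<Sum>y\<in>(UNIV::'k set). 2::real) + (\<Sum>\<alpha>\<in>(UNIV::'n set). 1) + 1"
  define C where "C = (\<Sum>x\<in>(UNIV::'k set). K)"
  have K: "K \<ge> 0" unfolding K_def by (intro add_nonneg_nonneg sum_nonneg) auto
  have C: "C \<ge> 0" unfolding C_def by (intro sum_nonneg K)
  have "core_coupling E xs u \<in> Lsp s \<and> normL s (core_coupling E xs u) \<le> C * normLdual s u" if u: "u \<in> Ldual s" for u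
  proof -
    define N where "N = normLdual s u"
    have N: "N \<ge> 0" unfolding N_def by (rule normLdual_nonneg[OF u])
    have core: "cmod (u (Core x)) \<le> N" for x using Ldual_bound[OF u, of "Core x"] by (simp add: N_def)
    have pt: "cmod (core_coupling E xs u (Core x)) \<le> K * N" for x
    proof -
      have "cmod (\<Sum>y\<in>{y. {x, y} \<in> E}. u (Core x) - u (Core y)) \<le> (\<Sum>y\<in>{y. {x, y} \<in> E}. 2 * N)"
        using core[of x] core norm_triangle_ineq4[of "u (Core x)"] by (intro sum_norm_le) (smt (verit))
      also have "\<dots> \<le> (\<Sum>y\<in>(UNIV::'k set). 2 * N)" using N by (intro sum_mono2) auto
      finally have 1: "cmod (\<Sum>y\<in>{y. {x, y} \<in> E}. u (Core x) - u (Core y)) \<le> (\<Sum>y\<in>(UNIV::'k set). 2 * N)" .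
      have 2: "cmod (\<Sum>\<alpha>\<in>UNIV. (if x = xs \<alpha> then 1 else 0) * u (Core x)) \<le> (\<Sum>\<alpha>\<in>(UNIV::'n set). N)"
        using core[of x] N by (intro sum_norm_le) auto
      have "cmod (core_coupling E xs u (Core x)) \<le> (\<Sum>y\<in>(UNIV::'k set). 2 * N) + (\<Sum>\<alpha>\<in>(UNIV::'n set). N) + N"
        unfolding core_coupling_def h_core_def vertex.case
        by (rule order_trans[OF norm_triangle_ineq4 add_mono[OF order_trans[OF norm_triangle_ineq add_mono[OF 1 2]] core]])
      then show ?thesis by (simp add: K_def algebra_simps)
    qed
    have "(\<Sum>p\<in>F. weight s p * cmod (core_coupling E xs u p)) \<le> C * N" if F: "finite F" for F
    proof -
      have "(\<Sum>p\<in>F. weight s p * cmod (core_coupling E xs u p)) = (\<Sum>p\<in>F \<inter> range Core. weight s p * cmod (core_coupling E xs u p))"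
      proof (rule sum.mono_neutral_right)
        show "\<forall>p\<in>F - F \<inter> range Core. weight s p * cmod (core_coupling E xs u p) = 0"
        proof
          fix p assume "p \<in> F - F \<inter> range Core"
          then show "weight s p * cmod (core_coupling E xs u p) = 0" by (cases p) (auto simp: core_coupling_def)
        qed
      qed (use F in auto)
      also have "\<dots> \<le> (\<Sum>p\<in>range Core. weight s p * cmod (core_coupling E xs u p))"
        by (intro sum_mono2) auto
      also have "\<dots> = (\<Sum>x\<in>UNIV. cmod (core_coupling E xs u (Core x)))"
        by (subst sum.reindex) (auto simp: inj_def)
      also have "\<dots> \<le> (\<Sum>x\<in>(UNIV::'k set). K * N)" by (intro sum_mono pt)
      finally show ?thesis by (simp add: C_def)
    qed
    then show ?thesis using LspI[of s "core_coupling E xs u" "C * N"] unfolding N_def by blast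
  qed
  then show ?thesis using C by blast
qed

text \<open>At \<kappa> = 0 all powers of \<open>eta\<close> are 1, and a ray entry counts summands:
  \<open>min n m + 1\<close>, the Green function of the Dirichlet half-line.\<close>

definition threshold_kernel :: "('k, 'n) vertex \<Rightarrow> ('k, 'n) vertex \<Rightarrow> complex" where
  "threshold_kernel = free_kernel 1 (\<lambda>_. 1)"

lemma threshold_kernel_bound: "1 \<le> s \<Longrightarrow> kernel_bound s 1 threshold_kernel"
  using free_kernel_bound[of 1 1 "\<lambda>_. 1" 0 s] by (simp add: threshold_kernel_def)

text \<open>On a ray, \<open>min n m + 1\<close> equals \<open>m + 1\<close> minus the truncated
  difference \<open>m - n\<close>. The first term does not depend on \<open>n\<close> and produces
  the constant, a first moment of \<open>f\<close>. The second lives on \<open>n < m\<close>, so the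
  column at \<open>m\<close> has \<open>m\<close> entries of size at most \<open>m\<close>; the
  resulting \<open>m^2\<close> is what the drop from \<open>s\<close> to \<open>s - 2\<close> pays
  for.\<close>

lemma threshold_asymptotics:
  fixes f :: "('k::finite, 'n::finite) state"
  assumes f: "f \<in> Lsp s" and s: "s \<ge> 2"
  shows "\<exists>c w. w \<in> Lsp (s - 2) \<and> kernel_op threshold_kernel f = (\<Sum>\<alpha>\<in>UNIV. smul (c \<alpha>) (one_ray \<alpha>)) + w"
proof -
  define g :: "'n \<Rightarrow> ('k, 'n) vertex \<Rightarrow> complex"
    where "g \<alpha> q = (case q of Core _ \<Rightarrow> 0 | Ray \<alpha>' m \<Rightarrow> if \<alpha>' = \<alpha> then of_nat (m + 1) else 0)" for \<alpha> q
  define lead :: "('k, 'n) vertex \<Rightarrow> ('k, 'n) vertex \<Rightarrow> complex"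
    where "lead p q = (case p of Core _ \<Rightarrow> 0 | Ray \<alpha> n \<Rightarrow> g \<alpha> q)" for p q
  define k where "k p q = threshold_kernel p q - lead p q" for p q
  define c where "c \<alpha> = (\<Sum>\<^sub>\<infinity>q. g \<alpha> q * f q)" for \<alpha>
  have w1: "real (Suc m) \<le> weight s (Ray \<alpha> m)" for \<alpha> :: 'n and m
    using weight_ray_ge[of 1 s m \<alpha>] s by (simp add: add.commute del: weight.simps)
  have g: "cmod (g \<alpha> q) \<le> 1 * weight s q" for \<alpha> q
  proof (cases q)
    case (Ray \<alpha>' m)
    then show ?thesis using Ray w1[of m \<alpha>'] by (auto simp: g_def simp del: weight.simps of_nat_add of_nat_Suc)
  qed (simp add: g_def)
  have gs: "(\<lambda>q. g \<alpha> q * f q) summable_on UNIV" for \<alpha> by (rule Lsp_comparison(1)[OF f g])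
  have lead_sum: "(\<lambda>q. lead p q * f q) summable_on UNIV" for p by (cases p) (simp_all add: lead_def gs)
  have kb: "kernel_bound s 1 (threshold_kernel :: ('k, 'n) vertex \<Rightarrow> _)" using s by (intro threshold_kernel_bound) simp
  have ray: "ray_kernel (\<lambda>_. 1) n m = of_nat (min n m + 1)" for n m by (simp add: ray_kernel_def)
  have k_core: "k (Core x) q = (if q = Core x then 1 else 0)" for x q
    by (cases q) (auto simp: k_def threshold_kernel_def lead_def)
  have k_ray: "k (Ray \<alpha> n) q = (case q of Core _ \<Rightarrow> 0 | Ray \<alpha>' m \<Rightarrow> if \<alpha>' = \<alpha> then - of_nat (m - n) else 0)" for \<alpha> n q
    by (cases q) (auto simp: k_def threshold_kernel_def lead_def g_def ray min_def of_nat_diff)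
  have "kernel_op k f \<in> Lsp (s - 2)"
  proof (rule kernel_op_Lsp[OF _ _ f])
    show "\<exists>C. \<forall>q. cmod (k p q) \<le> C * weight s q" for p
    proof (intro exI[of _ 1] allI)
      fix q
      show "cmod (k p q) \<le> 1 * weight s q"
      proof (cases p)
        case (Core x)
        then show ?thesis using weight_ge_1[of s q] s by (simp add: k_core)
      next
        case (Ray \<alpha> n)
        show ?thesis
        proof (cases q)
          case q: (Ray \<alpha>' m)
          have "real (m - n) \<le> weight s (Ray \<alpha>' m)" by (rule order_trans[OF _ w1]) simp
          then show ?thesis using Ray q weight_nonneg[of s "Ray \<alpha>' m"]
            by (auto simp: k_ray simp del: weight.simps weight_nonneg)
        qed (use Ray in \<open>simp add: k_ray\<close>)
      qed
    qed
    fix F :: "('k, 'n) vertex set" and q assume F: "finite F"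
    show "(\<Sum>p\<in>F. weight (s - 2) p * cmod (k p q)) \<le> 1 * weight s q"
    proof (cases q)
      case (Core y)
      have "(\<Sum>p\<in>F. weight (s - 2) p * cmod (k p q)) \<le> (\<Sum>p\<in>{q}. 1)"
      proof (rule order_trans[OF eq_refl sum_mono])
        show "(\<Sum>p\<in>F. weight (s - 2) p * cmod (k p q)) = (\<Sum>p\<in>{q}. if q \<in> F then weight (s - 2) p * cmod (k p q) else 0)"
        proof -
          have "(\<Sum>p\<in>F. weight (s - 2) p * cmod (k p q)) = (\<Sum>p\<in>F \<inter> {q}. weight (s - 2) p * cmod (k p q))"
          proof (rule sum.mono_neutral_right)
            show "\<forall>p\<in>F - F \<inter> {q}. weight (s - 2) p * cmod (k p q) = 0"
            proof
              fix p assume "p \<in> F - F \<inter> {q}"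
              then show "weight (s - 2) p * cmod (k p q) = 0" using Core by (cases p) (auto simp: k_core k_ray)
            qed
          qed (use F in auto)
          then show ?thesis by (cases "q \<in> F") auto
        qed
      qed (auto simp: Core k_core)
      then show ?thesis using Core by simp
    next
      case (Ray \<alpha> m)
      have "(\<Sum>p\<in>F. weight (s - 2) p * cmod (k p q)) = (\<Sum>p\<in>F \<inter> Ray \<alpha> ` {..<m}. weight (s - 2) p * cmod (k p q))"
      proof (rule sum.mono_neutral_right)
        show "\<forall>p\<in>F - F \<inter> Ray \<alpha> ` {..<m}. weight (s - 2) p * cmod (k p q) = 0"
        proof
          fix p assume "p \<in> F - F \<inter> Ray \<alpha> ` {..<m}"
          then show "weight (s - 2) p * cmod (k p q) = 0"
            using Ray by (cases p) (auto simp: k_core k_ray)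
        qed
      qed (use F in auto)
      also have "\<dots> \<le> (\<Sum>p\<in>F \<inter> Ray \<alpha> ` {..<m}. weight (s - 2) q * real m)"
      proof (rule sum_mono)
        fix p assume "p \<in> F \<inter> Ray \<alpha> ` {..<m}"
        then obtain n where p: "p = Ray \<alpha> n" "n < m" by auto
        have "weight (s - 2) p \<le> weight (s - 2) q"
          using p s Ray by (auto intro!: powr_mono2 add_mono power_mono simp: add_nonneg_nonneg)
        moreover have "cmod (k p q) \<le> real m" using Ray unfolding p(1) k_ray by (simp del: of_nat_diff)
        ultimately show "weight (s - 2) p * cmod (k p q) \<le> weight (s - 2) q * real m"
          by (intro mult_mono) (auto simp del: weight.simps)
      qed
      also have "\<dots> = real (card (F \<inter> Ray \<alpha> ` {..<m})) * (weight (s - 2) q * real m)" by simp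
      also have "\<dots> \<le> real m * (weight (s - 2) q * real m)"
      proof (intro mult_right_mono mult_nonneg_nonneg)
        have "card (F \<inter> Ray \<alpha> ` {..<m}) \<le> card (Ray \<alpha> ` {..<m} :: ('k, 'n) vertex set)" by (intro card_mono) auto
        also have "\<dots> \<le> card {..<m}" by (intro card_image_le) auto
        finally show "real (card (F \<inter> Ray \<alpha> ` {..<m})) \<le> real m" by simp
      qed (auto simp del: weight.simps)
      also have "\<dots> \<le> (1 + (real (m + 1))\<^sup>2) * weight (s - 2) q"
      proof -
        have "real m * real m \<le> 1 + (real (m + 1))\<^sup>2" by (simp add: power2_eq_square algebra_simps)
        from mult_right_mono[OF this weight_nonneg[of "s - 2" q]] show ?thesis by (simp add: mult.commute mult.left_commute)
      qed
      also have "\<dots> = weight s q"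
      proof -
        have pos: "1 + (real (m + 1))\<^sup>2 > 0" by (simp add: add_pos_nonneg)
        have "s / 2 = 1 + (s - 2) / 2" by (simp add: field_simps)
        then have "(1 + (real (m + 1))\<^sup>2) powr (s / 2) = (1 + (real (m + 1))\<^sup>2) powr 1 * (1 + (real (m + 1))\<^sup>2) powr ((s - 2) / 2)"
          by (simp only: powr_add)
        then show ?thesis using pos Ray by simp
      qed
      finally show ?thesis using Ray by simp
    qed
  qed
  moreover have "kernel_op threshold_kernel f = (\<Sum>\<alpha>\<in>UNIV. smul (c \<alpha>) (one_ray \<alpha>)) + kernel_op k f"
  proof
    fix p
    have sum_apply: "(\<Sum>v\<in>S. h v) x = (\<Sum>v\<in>S. h v x)" for S :: "'n set" and h :: "'n \<Rightarrow> ('k, 'n) state" and x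
      by (induction S rule: infinite_finite_induct) (auto simp: pointwise)
    have "kernel_op threshold_kernel f p = (\<Sum>\<^sub>\<infinity>q. lead p q * f q + k p q * f q)"
      by (simp add: kernel_op_def k_def algebra_simps)
    also have "\<dots> = (\<Sum>\<^sub>\<infinity>q. lead p q * f q) + (\<Sum>\<^sub>\<infinity>q. k p q * f q)"
    proof (rule infsum_add[OF lead_sum])
      show "(\<lambda>q. k p q * f q) summable_on UNIV"
        using has_sum_minus[OF has_sum_infsum[OF kernel_summable[OF kb f, of p]] has_sum_infsum[OF lead_sum[of p]]]
        unfolding summable_on_def k_def left_diff_distrib by blast
    qed
    also have "(\<Sum>\<^sub>\<infinity>q. lead p q * f q) = (\<Sum>\<alpha>\<in>UNIV. smul (c \<alpha>) (one_ray \<alpha>)) p"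
      unfolding sum_apply
      by (cases p) (simp_all add: lead_def c_def pointwise one_ray_def if_distrib[of "\<lambda>x. _ * x"] cong: if_cong)
    finally show "kernel_op threshold_kernel f p = ((\<Sum>\<alpha>\<in>UNIV. smul (c \<alpha>) (one_ray \<alpha>)) + kernel_op k f) p"
      by (simp add: kernel_op_def pointwise)
  qed
  ultimately show ?thesis by blast
qed

section \<open>Calculus of bounded operators between the weighted spaces\<close>

lemma bounded_opI_Ldual:
  assumes "\<And>u. u \<in> S \<Longrightarrow> A u \<in> Ldual s" "\<And>u w. u \<in> S \<Longrightarrow> w \<in> S \<Longrightarrow> A (u + w) = A u + A w"
    "\<And>c u. u \<in> S \<Longrightarrow> A (smul c u) = smul c (A u)" "\<And>u. u \<in> S \<Longrightarrow> normLdual s (A u) \<le> C * nS u"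
  shows "bounded_op S nS (Ldual s) (normLdual s) A"
  using assms unfolding bounded_op_def by blast

lemma kernel_op_bounded_op:
  "kernel_bound s C k \<Longrightarrow> bounded_op (Lsp s) (normL s) (Ldual s) (normLdual s) (kernel_op k)"
  by (rule bounded_opI_Ldual) (auto intro: kernel_op_Ldual kernel_op_add kernel_op_smul)

lemma bounded_op_comp:
  assumes A: "bounded_op S nS T nT A" and B: "bounded_op T nT R nR B" and nonneg: "\<And>x. x \<in> T \<Longrightarrow> nT x \<ge> 0"
  shows "bounded_op S nS R nR (\<lambda>u. B (A u))"
proof -
  obtain CA where CA: "\<And>u. u \<in> S \<Longrightarrow> nT (A u) \<le> CA * nS u" using A unfolding bounded_op_def by blast
  obtain CB where CB: "\<And>u. u \<in> T \<Longrightarrow> nR (B u) \<le> CB * nT u" using B unfolding bounded_op_def by blast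
  have "nR (B (A u)) \<le> (max CB 0 * CA) * nS u" if u: "u \<in> S" for u
  proof -
    have T: "A u \<in> T" using A u by (auto simp: bounded_op_def)
    have "nR (B (A u)) \<le> CB * nT (A u)" by (rule CB[OF T])
    also have "\<dots> \<le> max CB 0 * nT (A u)" by (intro mult_right_mono nonneg T) auto
    also have "\<dots> \<le> max CB 0 * (CA * nS u)" by (intro mult_left_mono CA u) auto
    finally show ?thesis by (simp add: mult.assoc)
  qed
  then show ?thesis using A B unfolding bounded_op_def by (intro conjI exI[of _ "max CB 0 * CA"] ballI allI) simp_all
qed

lemma bounded_op_diff:
  assumes A: "bounded_op S nS (Ldual s) (normLdual s) A" and B: "bounded_op S nS (Ldual s) (normLdual s) B"
  shows "bounded_op S nS (Ldual s) (normLdual s) (\<lambda>u. A u - B u)"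
proof -
  obtain CA where CA: "\<And>u. u \<in> S \<Longrightarrow> normLdual s (A u) \<le> CA * nS u" using A unfolding bounded_op_def by blast
  obtain CB where CB: "\<And>u. u \<in> S \<Longrightarrow> normLdual s (B u) \<le> CB * nS u" using B unfolding bounded_op_def by blast
  have AB: "\<And>u. u \<in> S \<Longrightarrow> A u \<in> Ldual s" "\<And>u. u \<in> S \<Longrightarrow> B u \<in> Ldual s" using A B by (auto simp: bounded_op_def)
  show ?thesis
  proof (rule bounded_opI_Ldual)
    show "normLdual s (A u - B u) \<le> (CA + CB) * nS u" if u: "u \<in> S" for u
      using Ldual_diff(2)[OF AB(1)[OF u] AB(2)[OF u]] CA[OF u] CB[OF u] by (simp add: distrib_right)
    show "A (u + w) - B (u + w) = A u - B u + (A w - B w)" if "u \<in> S" "w \<in> S" for u w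
      using that A B by (simp add: bounded_op_def)
    show "A (smul c u) - B (smul c u) = smul c (A u - B u)" if "u \<in> S" for c u
      using that A B by (simp add: bounded_op_def fun_eq_iff pointwise right_diff_distrib)
  qed (intro Ldual_diff AB)
qed

lemma bounded_op_zero: "bounded_op S (normL t) (Ldual s) (normLdual s) (\<lambda>u. 0)"
  by (rule bounded_opI_Ldual[where C = 0]) (auto simp: fun_eq_iff pointwise)

lemma bounded_op_add:
  assumes A: "bounded_op S (normL t) (Ldual s) (normLdual s) A" and B: "bounded_op S (normL t) (Ldual s) (normLdual s) B"
  shows "bounded_op S (normL t) (Ldual s) (normLdual s) (\<lambda>u. A u + B u)"
  using bounded_op_diff[OF A bounded_op_diff[OF bounded_op_zero B]] by simp

lemma bounded_op_sum:
  assumes "finite I" "\<And>i. i \<in> I \<Longrightarrow> bounded_op S (normL t) (Ldual s) (normLdual s) (A i)"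
  shows "bounded_op S (normL t) (Ldual s) (normLdual s) (\<lambda>u. \<Sum>i\<in>I. A i u)"
  using assms by (induction I rule: finite_induct) (auto intro: bounded_op_zero bounded_op_add)

lemma bounded_op_Lsp_mono:
  assumes "bounded_op S nS (Lsp t) (normL t) A" "s \<le> t"
  shows "bounded_op S nS (Lsp s) (normL s) A"
  using assms Lsp_mono[OF assms(2)] unfolding bounded_op_def by (meson order_trans)

lemma bounded_op_Ldual_mono:
  assumes "bounded_op S nS (Ldual s) (normLdual s) A" "s \<le> t"
  shows "bounded_op S nS (Ldual t) (normLdual t) A"
  using assms Ldual_mono[OF assms(2)] unfolding bounded_op_def by (meson order_trans)

lemma bounded_op_cong:
  assumes "bounded_op (Lsp s) nS T nT A" "\<And>u. u \<in> Lsp s \<Longrightarrow> B u = A u"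
  shows "bounded_op (Lsp s) nS T nT B"
  using assms Lsp_add(1) Lsp_smul(1) unfolding bounded_op_def by (auto simp: Lsp_add(1) Lsp_smul(1))

section \<open>The decoupled operator on square-summable functions\<close>

lemma ell2_smul:
  assumes "u \<in> ell2"
  shows "smul c u \<in> ell2" 
proof (rule ell2I(1)[where C = "cmod c * norm2 u"])
  fix F :: "('a, 'b) vertex set" assume F: "finite F"
  have "(\<Sum>p\<in>F. (cmod (smul c u p))\<^sup>2) = (cmod c)\<^sup>2 * (\<Sum>p\<in>F. (cmod (u p))\<^sup>2)"
    by (simp add: pointwise norm_mult power_mult_distrib sum_distrib_left)
  also have "\<dots> \<le> (cmod c)\<^sup>2 * (norm2 u)\<^sup>2" by (intro mult_left_mono ell2_sum_le assms F) auto
  finally show "(\<Sum>p\<in>F. (cmod (smul c u p))\<^sup>2) \<le> (cmod c * norm2 u)\<^sup>2" by (simp add: power_mult_distrib)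
qed simp

lemma ell2_add: "u \<in> ell2 \<Longrightarrow> w \<in> ell2 \<Longrightarrow> u + w \<in> ell2"
  using ell2_diff(1)[of u "smul (-1) w"] ell2_smul[of w "-1"] by (simp add: smul_minus_one)

lemma ell2_reindex:
  assumes u: "u \<in> ell2" and inj: "inj_on f A"
  shows "(\<lambda>p. if p \<in> A then u (f p) else 0) \<in> ell2"
proof (rule ell2I(1)[where C = "norm2 u"])
  fix F :: "('c, 'd) vertex set" assume F: "finite F"
  have "(\<Sum>p\<in>F. (cmod (if p \<in> A then u (f p) else 0))\<^sup>2) = (\<Sum>p\<in>F \<inter> A. (cmod (u (f p)))\<^sup>2)"
    using F by (intro sum.mono_neutral_cong_right) auto
  also have "\<dots> = (\<Sum>q\<in>f ` (F \<inter> A). (cmod (u q))\<^sup>2)"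
    using inj by (subst sum.reindex) (auto simp: inj_on_def)
  also have "\<dots> \<le> (norm2 u)\<^sup>2" by (intro ell2_sum_le u) (use F in auto)
  finally show "(\<Sum>p\<in>F. (cmod (if p \<in> A then u (f p) else 0))\<^sup>2) \<le> (norm2 u)\<^sup>2" .
qed simp

lemma decoupled_op_ell2:
  assumes u: "u \<in> ell2"
  shows "decoupled_op u \<in> ell2"
proof -
  \<comment> \<open>\<open>S1\<close> and \<open>S2\<close> are the two shifts along the rays, and
    \<open>R\<close> is the restriction to them, which raises the coefficient of \<open>u\<close>
    from 1 on the core to 2 on the rays. Each is an injective reindexing.\<close>
  define S1 where "S1 p = (if p \<in> {Ray \<alpha> n | \<alpha> n. True} then u ((case p of Core x \<Rightarrow> Core x | Ray \<alpha> n \<Rightarrow> Ray \<alpha> (Suc n))) else 0)" for p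
  define S2 where "S2 p = (if p \<in> {Ray \<alpha> (Suc n) | \<alpha> n. True} then u ((case p of Core x \<Rightarrow> Core x | Ray \<alpha> n \<Rightarrow> Ray \<alpha> (n - 1))) else 0)" for p
  define R where "R p = (if p \<in> {Ray \<alpha> n | \<alpha> n. True} then u (id p) else 0)" for p
  have "S1 \<in> ell2" unfolding S1_def by (rule ell2_reindex[OF u]) (auto simp: inj_on_def)
  moreover have "S2 \<in> ell2" unfolding S2_def by (rule ell2_reindex[OF u]) (auto simp: inj_on_def)
  moreover have "R \<in> ell2" unfolding R_def by (rule ell2_reindex[OF u]) (auto simp: inj_on_def)
  moreover have "decoupled_op u = (u - (S1 - R)) - S2"
  proof
    fix p
    show "decoupled_op u p = ((u - (S1 - R)) - S2) p"
    proof (cases p)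
      case (Ray \<alpha> n)
      then show ?thesis by (cases n) (simp_all add: decoupled_op_def pointwise S1_def S2_def R_def)
    qed (auto simp: decoupled_op_def pointwise S1_def S2_def R_def)
  qed
  ultimately show ?thesis using u by (simp add: ell2_diff(1))
qed

lemma decoupled_op_add: "decoupled_op (u + w) = decoupled_op u + decoupled_op w"
proof
  fix p
  have "h_ray (\<lambda>l. f l + g l) n = h_ray f n + h_ray g n" for f g n by (cases n) (auto simp: algebra_simps)
  then show "decoupled_op (u + w) p = (decoupled_op u + decoupled_op w) p"
    by (cases p) (simp_all add: decoupled_op_def pointwise)
qed

lemma decoupled_op_smul: "decoupled_op (smul c u) = smul c (decoupled_op u)"
proof
  fix p
  have "h_ray (\<lambda>l. c * f l) n = c * h_ray f n" for f n by (cases n) (auto simp: algebra_simps)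
  then show "decoupled_op (smul c u) p = smul c (decoupled_op u) p"
    by (cases p) (simp_all add: decoupled_op_def pointwise)
qed

lemma decoupled_op_diff: "decoupled_op (u - w) = decoupled_op u - decoupled_op w"
  using decoupled_op_add[of u "smul (-1) w"] decoupled_op_smul[of "-1" w] by (simp add: smul_minus_one)

section \<open>Invertibility at a regular threshold\<close>

lemma one_plus_iso_unique:
  assumes A: "linear_Ldual s A" and iso: "one_plus_iso s C A"
    and u: "u \<in> Ldual s" "w \<in> Ldual s" "u + A u = w + A w"
  shows "u = w"
proof -
  have d: "u - w \<in> Ldual s" by (rule Ldual_diff(1)[OF u(1,2)])
  have "(u - w) + A (u - w) = (u + A u) - (w + A w)" using linear_LdualD(4)[OF A u(1,2)] by simp
  then have "normLdual s (u - w) \<le> C * normLdual s (0 :: ('a, 'b) state)"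
    using iso d u(3) by (auto simp: one_plus_iso_def)
  then have le: "normLdual s (u - w) \<le> 0" by simp
  show ?thesis
  proof
    fix p
    have "cmod ((u - w) p) \<le> normLdual s (u - w) * weight s p" by (rule Ldual_bound[OF d])
    also have "\<dots> \<le> 0" using le by (simp add: mult_nonpos_nonneg)
    finally show "u p = w p" by (simp add: pointwise)
  qed
qed

locale regular_threshold = factored_perturbation \<beta> V v U
  for \<beta> and V :: "('k::finite, 'n::finite) oper" and v :: "'h::complex_hilbert \<Rightarrow> ('k, 'n) state" and U +
  fixes E :: "'k set set" and xs :: "'n \<Rightarrow> 'k"
  assumes \<beta>: "\<beta> \<ge> 2" and regular: "res_space E xs V \<beta> \<subseteq> {0}"
begin

abbreviation W :: "('k, 'n) oper" where "W \<equiv> coupling E xs V"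

lemma V_bounded_op: "bounded_op (Ldual \<beta>) (normLdual \<beta>) (Lsp \<beta>) (normL \<beta>) V"
  using asm_A by (simp add: assumption_A_def)

definition W_bound :: real where
  "W_bound = (SOME C. C \<ge> 0 \<and> (\<forall>u\<in>Ldual \<beta>. W u \<in> Lsp \<beta> \<and> normL \<beta> (W u) \<le> C * normLdual \<beta> u))"

lemma W_bound: "W_bound \<ge> 0" "u \<in> Ldual \<beta> \<Longrightarrow> W u \<in> Lsp \<beta>"
    "u \<in> Ldual \<beta> \<Longrightarrow> normL \<beta> (W u) \<le> W_bound * normLdual \<beta> u"
proof -
  obtain C1 where C1: "C1 \<ge> 0" "\<And>u. u \<in> Ldual \<beta> \<Longrightarrow> core_coupling E xs u \<in> Lsp \<beta>"
      "\<And>u. u \<in> Ldual \<beta> \<Longrightarrow> normL \<beta> (core_coupling E xs u) \<le> C1 * normLdual \<beta> u"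
    using core_coupling_bounded[of \<beta> E xs] by blast
  obtain C2 where C2: "\<And>u. u \<in> Ldual \<beta> \<Longrightarrow> V u \<in> Lsp \<beta>" "\<And>u. u \<in> Ldual \<beta> \<Longrightarrow> normL \<beta> (V u) \<le> C2 * normLdual \<beta> u"
    using V_bounded_op unfolding bounded_op_def by blast
  have "\<exists>C\<ge>0. \<forall>u\<in>Ldual \<beta>. W u \<in> Lsp \<beta> \<and> normL \<beta> (W u) \<le> C * normLdual \<beta> u"
  proof (intro exI[of _ "max C2 0 + C1"] conjI ballI)
    show "W u \<in> Lsp \<beta>" if "u \<in> Ldual \<beta>" for u
      unfolding coupling_def by (intro Lsp_add C1 C2 that)
    fix u :: "('k, 'n) state" assume u: "u \<in> Ldual \<beta>"
    have "normL \<beta> (W u) \<le> normL \<beta> (V u) + normL \<beta> (core_coupling E xs u)"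
      unfolding coupling_def by (intro Lsp_add C1 C2 u)
    also have "\<dots> \<le> max C2 0 * normLdual \<beta> u + C1 * normLdual \<beta> u"
      by (intro add_mono C1 u order_trans[OF C2(2)[OF u]] mult_right_mono normLdual_nonneg) auto
    finally show "normL \<beta> (W u) \<le> (max C2 0 + C1) * normLdual \<beta> u" by (simp add: distrib_right)
  qed (use C1 in auto)
  from someI_ex[OF this] show "W_bound \<ge> 0" "u \<in> Ldual \<beta> \<Longrightarrow> W u \<in> Lsp \<beta>"
    "u \<in> Ldual \<beta> \<Longrightarrow> normL \<beta> (W u) \<le> W_bound * normLdual \<beta> u"
    unfolding W_bound_def[symmetric] by blast+
qed

lemma W_linear:
  assumes "u \<in> Ldual \<beta>"
  shows "w \<in> Ldual \<beta> \<Longrightarrow> W (u + w) = W u + W w" and "W (smul c u) = smul c (W u)"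
  using assms V_bounded_op
  by (auto simp: coupling_def bounded_op_def core_coupling_add core_coupling_smul fun_eq_iff pointwise distrib_left)

lemma W_bounded_op: "bounded_op (Ldual \<beta>) (normLdual \<beta>) (Lsp \<beta>) (normL \<beta>) W"
  unfolding bounded_op_def using W_bound W_linear by blast

lemma kernel_W:
  assumes k: "kernel_bound \<beta> C k"
  shows "linear_Ldual \<beta> (\<lambda>u. kernel_op k (W u))"
    and "C \<ge> 0 \<Longrightarrow> u \<in> Ldual \<beta> \<Longrightarrow> normLdual \<beta> (kernel_op k (W u)) \<le> C * W_bound * normLdual \<beta> u"
proof -
  have "bounded_op (Ldual \<beta>) (normLdual \<beta>) (Ldual \<beta>) (normLdual \<beta>) (\<lambda>u. kernel_op k (W u))"
    by (rule bounded_op_comp[OF W_bounded_op kernel_op_bounded_op[OF k] normL_nonneg])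
  then show "linear_Ldual \<beta> (\<lambda>u. kernel_op k (W u))" by (simp add: bounded_op_def linear_Ldual_def)
  assume C: "C \<ge> 0" and u: "u \<in> Ldual \<beta>"
  have "normLdual \<beta> (kernel_op k (W u)) \<le> C * normL \<beta> (W u)" by (intro kernel_op_Ldual k W_bound u)
  also have "\<dots> \<le> C * (W_bound * normLdual \<beta> u)" by (intro mult_left_mono C W_bound u)
  finally show "normLdual \<beta> (kernel_op k (W u)) \<le> C * W_bound * normLdual \<beta> u" by (simp add: mult.assoc)
qed

text \<open>Enlarging the finite set by the core makes the core coupling vanish, which leaves the
  smallness of \<open>V\<close>.\<close>

lemma W_small:
  assumes "e > 0"
  shows "\<exists>F. finite F \<and> (\<forall>u\<in>Ldual \<beta>. (\<forall>p\<in>F. u p = 0) \<longrightarrow> normL \<beta> (W u) \<le> e * normLdual \<beta> u)"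
proof -
  obtain F where F: "finite F" "\<And>u. u \<in> Ldual \<beta> \<Longrightarrow> \<forall>p\<in>F. u p = 0 \<Longrightarrow> normL \<beta> (V u) \<le> e * normLdual \<beta> u"
    using V_small[OF assms] by blast
  have "normL \<beta> (W u) \<le> e * normLdual \<beta> u" if u: "u \<in> Ldual \<beta>" "\<forall>p\<in>F \<union> range Core. u p = 0" for u
  proof -
    have "core_coupling E xs u p = 0" for p
      using u(2) by (cases p) (auto simp: core_coupling_def h_core_def)
    then have "core_coupling E xs u = 0" by (simp add: fun_eq_iff pointwise)
    then show ?thesis using F(2)[OF u(1)] u(2) by (simp add: coupling_def)
  qed
  then show ?thesis using F(1) by (intro exI[of _ "F \<union> range Core"]) auto
qed

lemma threshold_injective:
  assumes u: "u \<in> Ldual \<beta>" and eq: "u + kernel_op threshold_kernel (W u) = 0"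
  shows "u = 0"
proof -
  define f where "f = - W u"
  have kb: "kernel_bound \<beta> 1 (threshold_kernel :: ('k, 'n) vertex \<Rightarrow> _)" using \<beta> by (intro threshold_kernel_bound) simp
  have fL: "f \<in> Lsp \<beta>" unfolding f_def by (intro Lsp_uminus W_bound u)
  have "kernel_op threshold_kernel f = - kernel_op threshold_kernel (W u)"
    using kernel_op_smul[OF kb W_bound(2)[OF u], of "-1"] by (simp add: f_def smul_minus_one)
  then have uf: "u = kernel_op threshold_kernel f" using eq by (metis eq_neg_iff_add_eq_0)
  \<comment> \<open>At \<open>z = 0\<close> the characteristic equation has the double root 1, so
    the constant \<phi> is its power sequence.\<close>
  have "decoupled_op (kernel_op threshold_kernel f) + smul 0 (kernel_op threshold_kernel f) = f"
    unfolding threshold_kernel_def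
  proof (rule decoupled_op_green[where \<zeta> = 1])
    show "(\<lambda>q. free_kernel 1 (\<lambda>_. 1) p q * f q) summable_on UNIV" for p
      using kernel_summable[OF kb fL] by (simp add: threshold_kernel_def)
  qed auto
  then have "decoupled_op u = f" unfolding uf[symmetric] by (simp add: fun_eq_iff pointwise)
  then have "Hop E xs V u = 0" by (simp add: Hop_eq_decoupled_op f_def)
  then have "u \<in> gen_eigenspace E xs V \<beta>" using u by (simp add: gen_eigenspace_def)
  moreover obtain c w where "w \<in> Lsp (\<beta> - 2)" "u = (\<Sum>\<alpha>\<in>UNIV. smul (c \<alpha>) (one_ray \<alpha>)) + w"
    using threshold_asymptotics[OF fL \<beta>] unfolding uf[symmetric] by blast
  ultimately have "u \<in> res_space E xs V \<beta>" unfolding res_space_def by blast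
  then show ?thesis using regular by blast
qed

lemma iso_threshold: "\<exists>C\<ge>0. one_plus_iso \<beta> C (\<lambda>u. kernel_op threshold_kernel (W u))"
proof -
  let ?T = "\<lambda>u. kernel_op threshold_kernel (W u)"
  have kb: "kernel_bound \<beta> 1 (threshold_kernel :: ('k, 'n) vertex \<Rightarrow> _)" using \<beta> by (intro threshold_kernel_bound) simp
  have TL: "linear_Ldual \<beta> ?T" by (rule kernel_W[OF kb])
  note T = linear_LdualD[OF TL]
  \<comment> \<open>As the threshold kernel has bound 1, the constant 1/2 gives \<open>?T\<close>
    composed with the cut-off \<open>Q\<close> norm at most 1/2. The identity perturbed by it is
    invertible with constant 2.\<close>
  obtain F where F: "finite F" "\<And>u. u \<in> Ldual \<beta> \<Longrightarrow> \<forall>p\<in>F. u p = 0 \<Longrightarrow> normL \<beta> (W u) \<le> 1 / 2 * normLdual \<beta> u"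
    using W_small[of "1/2"] by auto
  define Q where "Q u = (\<lambda>p. if p \<in> F then 0 else u p)" for u :: "('k, 'n) state"
  have Q: "Q u \<in> Ldual \<beta>" "normLdual \<beta> (Q u) \<le> normLdual \<beta> u" if u: "u \<in> Ldual \<beta>" for u
  proof -
    have "cmod (Q u p) \<le> normLdual \<beta> u * weight \<beta> p" for p
      using Ldual_bound[OF u, of p] normLdual_nonneg[OF u] by (auto simp: Q_def)
    then show "Q u \<in> Ldual \<beta>" "normLdual \<beta> (Q u) \<le> normLdual \<beta> u" by (rule LdualI)+
  qed
  have Q_lin: "Q (u + w) = Q u + Q w" "Q (smul c u) = smul c (Q u)" for u w c
    by (auto simp: Q_def fun_eq_iff pointwise)
  have TQL: "linear_Ldual \<beta> (\<lambda>u. ?T (Q u))"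
    unfolding linear_Ldual_def using Q T by (simp add: Q_lin)
  have "one_plus_iso \<beta> (2 * 1) (\<lambda>u. 0 + ?T (Q u))"
  proof (rule one_plus_iso_perturb[OF _ TQL])
    show "linear_Ldual \<beta> (\<lambda>u. 0 :: ('k, 'n) state)" by (auto simp: linear_Ldual_def fun_eq_iff pointwise)
    show "one_plus_iso \<beta> 1 (\<lambda>u. 0 :: ('k, 'n) state)" by (simp add: one_plus_iso_def)
    fix u :: "('k, 'n) state" assume u: "u \<in> Ldual \<beta>"
    have "normLdual \<beta> (?T (Q u)) \<le> 1 * normL \<beta> (W (Q u))" by (intro kernel_op_Ldual kb W_bound Q u)
    also have "\<dots> \<le> 1 / 2 * normLdual \<beta> (Q u)" using F(2)[OF Q(1)[OF u]] by (simp add: Q_def)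
    finally show "1 * normLdual \<beta> (?T (Q u)) \<le> normLdual \<beta> u / 2" using Q(2)[OF u] by simp
  qed simp
  then have isoQ: "one_plus_iso \<beta> 2 (\<lambda>u. ?T (Q u))" by simp
  define d where "d p = (\<lambda>q. if q = p then 1 else (0::complex))" for p :: "('k, 'n) vertex"
  have d: "d p \<in> Ldual \<beta>" for p
    using weight_ge_1[of \<beta>] \<beta> by (intro LdualI[where C = 1]) (auto simp: d_def)
  have sum_apply: "(\<Sum>v\<in>S. h v) x = (\<Sum>v\<in>S. h v x)" for S :: "('k, 'n) vertex set" and h :: "_ \<Rightarrow> ('k, 'n) state" and x
    by (induction S rule: infinite_finite_induct) (auto simp: pointwise)
  show ?thesis
  proof (rule one_plus_iso_finite_rank[OF TQL isoQ _ F(1) _ TL])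
    show "?T (d p) \<in> Ldual \<beta>" for p by (intro T d)
    show "?T u = ?T (Q u) + (\<Sum>p\<in>F. smul (u p) (?T (d p)))" if u: "u \<in> Ldual \<beta>" for u
    proof -
      have "u = Q u + (\<Sum>p\<in>F. smul (u p) (d p))"
      proof
        fix x
        show "u x = (Q u + (\<Sum>p\<in>F. smul (u p) (d p))) x"
          using F(1) by (cases "x \<in> F") (simp_all add: pointwise sum_apply Q_def d_def if_distrib cong: if_cong)
      qed
      then have "?T u = ?T (Q u + (\<Sum>p\<in>F. smul (u p) (d p)))" by simp
      also have "\<dots> = ?T (Q u) + ?T (\<Sum>p\<in>F. smul (u p) (d p))"
        by (intro T Q u Ldual_sum F Ldual_smul d)
      also have "?T (\<Sum>p\<in>F. smul (u p) (d p)) = (\<Sum>p\<in>F. smul (u p) (?T (d p)))"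
        by (rule linear_Ldual_sum[OF TL F(1) d])
      finally show ?thesis .
    qed
  qed (auto intro: threshold_injective)
qed

end

subsection \<open>The resolvent near the threshold\<close>

lemma half_disc_facts:
  assumes "\<kappa> \<in> half_disc"
  shows "((eta \<kappa>)\<^sup>2)\<^sup>2 + 1 = (2 + \<kappa>\<^sup>2) * (eta \<kappa>)\<^sup>2" and "cmod ((eta \<kappa>)\<^sup>2) < 1"
    and "eta \<kappa> ^ (2 * l) = ((eta \<kappa>)\<^sup>2) ^ l" and "1 + \<kappa>\<^sup>2 \<noteq> 0"
proof -
  have \<kappa>: "Re \<kappa> > 0" "cmod \<kappa> < 1" using assms by (auto simp: half_disc_def)
  have "\<kappa> * eta \<kappa> = 1 - (eta \<kappa>)\<^sup>2" using eta_quadratic[of \<kappa>] by simp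
  then have "(\<kappa> * eta \<kappa>)\<^sup>2 = (1 - (eta \<kappa>)\<^sup>2)\<^sup>2" by simp
  then show "((eta \<kappa>)\<^sup>2)\<^sup>2 + 1 = (2 + \<kappa>\<^sup>2) * (eta \<kappa>)\<^sup>2"
    by (simp add: power_mult_distrib power2_diff algebra_simps)
  show "cmod ((eta \<kappa>)\<^sup>2) < 1"
    using cmod_eta_less_1[OF \<kappa>] by (simp add: norm_power power_less_one_iff)
  show "eta \<kappa> ^ (2 * l) = ((eta \<kappa>)\<^sup>2) ^ l" by (simp add: power_mult)
  show "1 + \<kappa>\<^sup>2 \<noteq> 0" using Re_one_plus_square_pos[OF \<kappa>(2)] by (metis less_irrefl zero_complex.sel(1))
qed

text \<open>The bound \<open>M\<close> blows up as \<kappa> tends to 0, because |\<open>eta\<close>|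
  tends to 1. It serves for fixed \<kappa> only, to identify the resolvent on
  \<open>ell2\<close>.\<close>

lemma resolvent_kernel_ell2:
  fixes \<kappa> :: complex
  assumes \<kappa>: "\<kappa> \<in> half_disc"
  shows "\<exists>M\<ge>0. \<forall>u\<in>(ell2 :: ('k, 'n) state set). kernel_op (resolvent_kernel \<kappa>) u \<in> ell2 \<and>
    norm2 (kernel_op (resolvent_kernel \<kappa>) u) \<le> M * norm2 u \<and> (\<forall>p. (\<lambda>q. resolvent_kernel \<kappa> p q * u q) summable_on UNIV)"
proof -
  define M where "M = cmod (1 / (1 + \<kappa>\<^sup>2)) + 2 / (1 - cmod ((eta \<kappa>)\<^sup>2))\<^sup>2"
  have rows: "(\<Sum>q\<in>F. cmod (resolvent_kernel \<kappa> p q)) \<le> M" if "finite F" for p :: "('k, 'n) vertex" and F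
    unfolding resolvent_kernel_def M_def
    by (rule free_kernel_row_sum[OF half_disc_facts(3)[OF \<kappa>] half_disc_facts(2)[OF \<kappa>] that])
  have cols: "(\<Sum>p\<in>F. cmod (resolvent_kernel \<kappa> p q)) \<le> M" if "finite F" for q :: "('k, 'n) vertex" and F
    using rows[OF that, of q] by (simp add: resolvent_kernel_def free_kernel_commute[of _ _ q])
  have "M \<ge> 0" using rows[of "{}"] by simp
  then show ?thesis using schur_test[of "resolvent_kernel \<kappa>" M, OF rows cols] by blast
qed

lemma resolvent_kernel_green:
  assumes \<kappa>: "\<kappa> \<in> half_disc" and u: "u \<in> ell2"
  shows "decoupled_op (kernel_op (resolvent_kernel \<kappa>) u) + smul (\<kappa>\<^sup>2) (kernel_op (resolvent_kernel \<kappa>) u) = u"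
  unfolding resolvent_kernel_def
proof (rule decoupled_op_green[OF half_disc_facts(1)[OF \<kappa>] half_disc_facts(3)[OF \<kappa>]])
  show "(\<lambda>q. free_kernel (1 / (1 + \<kappa>\<^sup>2)) (\<lambda>m. eta \<kappa> ^ m) p q * u q) summable_on UNIV" for p
    using resolvent_kernel_ell2[OF \<kappa>] u unfolding resolvent_kernel_def by blast
qed (use half_disc_facts(4)[OF \<kappa>] in simp)

lemma smul_add: "smul c (u + w) = smul c u + smul c w"
  and smul_diff: "smul c (u - w) = smul c u - smul c w"
  and smul_smul: "smul c (smul d u) = smul (c * d) u"
  by (auto simp: fun_eq_iff pointwise algebra_simps)

lemma free_resolvent_unique:
  assumes \<kappa>: "\<kappa> \<in> half_disc" and u: "u \<in> ell2" and w: "w \<in> ell2"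
    and eq: "decoupled_op u + smul (\<kappa>\<^sup>2) u = decoupled_op w + smul (\<kappa>\<^sup>2) w"
  shows "u = w"
proof -
  have "decoupled_op (u - w) + smul (\<kappa>\<^sup>2) (u - w) = 0"
    unfolding decoupled_op_diff smul_diff using eq by (simp add: algebra_simps)
  then have "u - w = 0"
    by (rule decoupled_op_injective[OF ell2_diff(1)[OF u w] _ half_disc_facts(4,1,2)[OF \<kappa>]])
  then show ?thesis by simp
qed

lemma kernel_bound_mono: "kernel_bound s C k \<Longrightarrow> C \<le> C' \<Longrightarrow> kernel_bound s C' k"
  unfolding kernel_bound_def by (meson mult_right_mono order_trans weight_nonneg)

definition coeff_kernel :: "nat \<Rightarrow> ('k, 'n) vertex \<Rightarrow> ('k, 'n) vertex \<Rightarrow> complex" where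
  "coeff_kernel = (SOME c. c 0 = threshold_kernel \<and>
     (\<forall>j s. 1 \<le> s \<longrightarrow> real j \<le> s \<longrightarrow> (\<exists>C. kernel_bound s C (c j))) \<and>
     (\<forall>J s. 1 \<le> s \<longrightarrow> real J \<le> s \<longrightarrow> (\<exists>C. \<forall>\<kappa>\<in>half_disc.
        kernel_bound s (C * cmod \<kappa> ^ J) (\<lambda>p q. resolvent_kernel \<kappa> p q - (\<Sum>j<J. \<kappa> ^ j * c j p q)))))"

definition remainder_kernel :: "nat \<Rightarrow> complex \<Rightarrow> ('k, 'n) vertex \<Rightarrow> ('k, 'n) vertex \<Rightarrow> complex" where
  "remainder_kernel J \<kappa> p q = resolvent_kernel \<kappa> p q - (\<Sum>j<J. \<kappa> ^ j * coeff_kernel j p q)"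

lemma coeff_kernel:
  shows coeff_kernel_0: "coeff_kernel 0 = threshold_kernel"
    and coeff_kernel_bound: "1 \<le> s \<Longrightarrow> real j \<le> s \<Longrightarrow> \<exists>C. kernel_bound s C (coeff_kernel j)"
    and remainder_kernel_bound: "1 \<le> s \<Longrightarrow> real J \<le> s \<Longrightarrow>
      \<exists>C\<ge>0. \<forall>\<kappa>\<in>half_disc. kernel_bound s (C * cmod \<kappa> ^ J) (remainder_kernel J \<kappa> :: ('k, 'n) vertex \<Rightarrow> _)"
proof -
  note * = someI_ex[OF resolvent_kernel_expansion, folded threshold_kernel_def, folded coeff_kernel_def]
  show "coeff_kernel 0 = threshold_kernel" using * by blast
  show "1 \<le> s \<Longrightarrow> real j \<le> s \<Longrightarrow> \<exists>C. kernel_bound s C (coeff_kernel j)" using * by blast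
  assume "1 \<le> s" "real J \<le> s"
  then obtain C where C: "\<And>\<kappa>. \<kappa> \<in> half_disc \<Longrightarrow> kernel_bound s (C * cmod \<kappa> ^ J) (remainder_kernel J \<kappa> :: ('k, 'n) vertex \<Rightarrow> _)"
    using * unfolding remainder_kernel_def by blast
  have "kernel_bound s (max C 0 * cmod \<kappa> ^ J) (remainder_kernel J \<kappa> :: ('k, 'n) vertex \<Rightarrow> _)" if "\<kappa> \<in> half_disc" for \<kappa>
    by (rule kernel_bound_mono[OF C[OF that]]) (simp add: mult_right_mono)
  then show "\<exists>C\<ge>0. \<forall>\<kappa>\<in>half_disc. kernel_bound s (C * cmod \<kappa> ^ J) (remainder_kernel J \<kappa> :: ('k, 'n) vertex \<Rightarrow> _)"
    by (intro exI[of _ "max C 0"]) auto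
qed

lemma remainder_kernel_0: "remainder_kernel 0 \<kappa> = resolvent_kernel \<kappa>"
  by (auto simp: remainder_kernel_def fun_eq_iff)

lemma resolvent_kernel_bound:
  "1 \<le> s \<Longrightarrow> \<exists>C\<ge>0. \<forall>\<kappa>\<in>half_disc. kernel_bound s C (resolvent_kernel \<kappa>)"
  using remainder_kernel_bound[of s 0] by (simp add: remainder_kernel_0)

text \<open>\<open>G\<^sub>j = A (R\<^sub>j - \<Sum>\<^bsub>i<j\<^esub> R\<^sub>j\<^sub>-\<^sub>i W G\<^sub>i)\<close>, where \<open>A = (1 + R\<^sub>0 W)\<^sup>-\<^sup>1\<close>: comparison of coefficients in
  \<open>(1 + R\<^sub>0(\<kappa>) W) R(\<kappa>) = R\<^sub>0(\<kappa>)\<close>.\<close>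

fun resolvent_coeff :: "('k, 'n) oper \<Rightarrow> ('k, 'n) oper \<Rightarrow> (nat \<Rightarrow> ('k, 'n) oper) \<Rightarrow> nat \<Rightarrow> ('k, 'n) oper" where
  "resolvent_coeff A W r j u = A (r j u - (\<Sum>i<j. r (j - i) (W (resolvent_coeff A W r i u))))"

declare resolvent_coeff.simps [simp del]

context regular_threshold
begin

lemma Hop_linear:
  assumes "u \<in> ell2"
  shows "w \<in> ell2 \<Longrightarrow> Hop E xs V (u + w) = Hop E xs V u + Hop E xs V w"
    and "Hop E xs V (smul c u) = smul c (Hop E xs V u)"
proof -
  have L: "u \<in> Ldual \<beta>" if "u \<in> ell2" for u :: "('k, 'n) state" using ell2_Ldual(1)[OF that, of \<beta>] \<beta> by simp
  show "w \<in> ell2 \<Longrightarrow> Hop E xs V (u + w) = Hop E xs V u + Hop E xs V w"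
    using W_linear(1)[OF L[OF assms] L] by (simp add: Hop_eq_decoupled_op decoupled_op_add)
  show "Hop E xs V (smul c u) = smul c (Hop E xs V u)"
    using W_linear(2)[OF L[OF assms]] by (simp add: Hop_eq_decoupled_op decoupled_op_smul smul_add)
qed

lemma W_ell2:
  assumes "u \<in> Ldual \<beta>"
  shows "W u \<in> ell2" and "norm2 (W u) \<le> W_bound * normLdual \<beta> u"
  using Lsp_ell2[OF W_bound(2)[OF assms]] W_bound(3)[OF assms] \<beta> by auto

text \<open>The first-order remainder of the free kernel is of order \<kappa> in the weighted norm,
  so the inverse at the threshold perturbs to all small \<kappa> with a common constant.\<close>

lemma iso_near_threshold:
  "\<exists>\<delta>>0. \<exists>C\<ge>0. \<forall>\<kappa>\<in>half_disc. cmod \<kappa> < \<delta> \<longrightarrow> one_plus_iso \<beta> C (\<lambda>u. kernel_op (resolvent_kernel \<kappa>) (W u))"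
proof -
  obtain C where C: "C \<ge> 0" "one_plus_iso \<beta> C (\<lambda>u. kernel_op threshold_kernel (W u))"
    using iso_threshold by blast
  obtain C1 where C1: "C1 \<ge> 0" "\<And>\<kappa>. \<kappa> \<in> half_disc \<Longrightarrow>
      kernel_bound \<beta> (C1 * cmod \<kappa> ^ 1) (remainder_kernel 1 \<kappa> :: ('k, 'n) vertex \<Rightarrow> _)"
    using remainder_kernel_bound[of \<beta> 1] \<beta> by auto
  have tb: "kernel_bound \<beta> 1 (threshold_kernel :: ('k, 'n) vertex \<Rightarrow> _)" using \<beta> by (intro threshold_kernel_bound) simp
  obtain C2 where C2: "\<And>\<kappa>. \<kappa> \<in> half_disc \<Longrightarrow> kernel_bound \<beta> C2 (resolvent_kernel \<kappa> :: ('k, 'n) vertex \<Rightarrow> _)"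
    using resolvent_kernel_bound[of \<beta>] \<beta> by auto
  define B where "B = C * C1 * W_bound"
  have B: "B \<ge> 0" unfolding B_def using C(1) C1(1) W_bound(1) by simp
  \<comment> \<open>Chosen so that \<open>B * \<delta> \<le> 1 / 2\<close>; the summand 1 covers
    \<open>B = 0\<close>.\<close>
  define \<delta> where "\<delta> = 1 / (2 * B + 1)"
  have \<delta>: "\<delta> > 0" using B by (simp add: \<delta>_def)
  have "one_plus_iso \<beta> (2 * C) (\<lambda>u. kernel_op (resolvent_kernel \<kappa>) (W u))" if \<kappa>: "\<kappa> \<in> half_disc" "cmod \<kappa> < \<delta>" for \<kappa>
  proof -
    note rb = C1(2)[OF \<kappa>(1)]
    have "one_plus_iso \<beta> (2 * C) (\<lambda>u. kernel_op threshold_kernel (W u) + kernel_op (remainder_kernel 1 \<kappa>) (W u))"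
    proof (rule one_plus_iso_perturb[OF kernel_W(1)[OF tb] kernel_W(1)[OF rb] C(2) C(1)])
      fix u :: "('k, 'n) state" assume u: "u \<in> Ldual \<beta>"
      have "C * normLdual \<beta> (kernel_op (remainder_kernel 1 \<kappa>) (W u)) \<le> C * (C1 * cmod \<kappa> ^ 1 * W_bound * normLdual \<beta> u)"
        using C(1) C1(1) by (intro mult_left_mono kernel_W(2)[OF rb _ u]) auto
      also have "\<dots> = (B * cmod \<kappa>) * normLdual \<beta> u" by (simp add: B_def mult_ac)
      also have "\<dots> \<le> (1 / 2) * normLdual \<beta> u"
      proof (intro mult_right_mono normLdual_nonneg u)
        have "B * cmod \<kappa> \<le> B * \<delta>" using B \<kappa>(2) by (intro mult_left_mono) auto
        also have "\<dots> \<le> 1 / 2" using B by (simp add: \<delta>_def field_simps)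
        finally show "B * cmod \<kappa> \<le> 1 / 2" .
      qed
      finally show "C * normLdual \<beta> (kernel_op (remainder_kernel 1 \<kappa>) (W u)) \<le> normLdual \<beta> u / 2" by simp
    qed
    moreover have "kernel_op threshold_kernel (W u) + kernel_op (remainder_kernel 1 \<kappa>) (W u) =
        kernel_op (resolvent_kernel \<kappa>) (W u)" if u: "u \<in> Ldual \<beta>" for u
    proof -
      have rem: "remainder_kernel 1 \<kappa> = (\<lambda>p q :: ('k, 'n) vertex. resolvent_kernel \<kappa> p q - 1 * threshold_kernel p q)"
        by (simp add: remainder_kernel_def coeff_kernel_0 fun_eq_iff)
      show ?thesis
        unfolding rem kernel_op_kernel_diff[OF C2[OF \<kappa>(1)] tb W_bound(2)[OF u]] by (simp add: fun_eq_iff pointwise)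
    qed
    ultimately show ?thesis by (simp add: one_plus_iso_def)
  qed
  then show ?thesis using \<delta> C(1) by (intro exI[of _ \<delta>] conjI exI[of _ "2 * C"]) auto
qed

text \<open>The bridge between \<open>ell2\<close> and the weighted space. A solution in the larger
  space returns to \<open>ell2\<close> because \<open>W u\<close> lies in
  \<open>Lsp \<beta>\<close>, hence in \<open>ell2\<close>, and \<open>u\<close> is the free
  resolvent applied to \<open>g - W u\<close>.\<close>

lemma resolvent_equation:
  assumes \<kappa>: "\<kappa> \<in> half_disc" and g: "g \<in> ell2"
  shows "u \<in> ell2 \<and> Hop E xs V u + smul (\<kappa>\<^sup>2) u = g \<longleftrightarrow>
    u \<in> Ldual \<beta> \<and> u + kernel_op (resolvent_kernel \<kappa>) (W u) = kernel_op (resolvent_kernel \<kappa>) g"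
proof -
  let ?K = "kernel_op (resolvent_kernel \<kappa>) :: ('k, 'n) oper"
  have K: "?K u \<in> ell2" "(\<lambda>q. resolvent_kernel \<kappa> p q * u q) summable_on UNIV" if "u \<in> ell2" for u :: "('k, 'n) state" and p
    using resolvent_kernel_ell2[OF \<kappa>] that by blast+
  have Kdiff: "?K (g - W u) = ?K g - ?K (W u)" if u: "u \<in> Ldual \<beta>" for u
  proof
    fix p
    show "?K (g - W u) p = (?K g - ?K (W u)) p"
      unfolding kernel_op_def pointwise right_diff_distrib
      using has_sum_minus[OF has_sum_infsum[OF K(2)[OF g]] has_sum_infsum[OF K(2)[OF W_ell2(1)[OF u]]]]
      by (rule infsumI)
  qed
  show ?thesis
  proof
    assume u: "u \<in> ell2 \<and> Hop E xs V u + smul (\<kappa>\<^sup>2) u = g"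
    have uL: "u \<in> Ldual \<beta>" using u ell2_Ldual(1)[of u \<beta>] \<beta> by simp
    have f: "g - W u \<in> ell2" by (intro ell2_diff g W_ell2 uL)
    have "decoupled_op u + smul (\<kappa>\<^sup>2) u = g - W u"
      using u by (auto simp: Hop_eq_decoupled_op algebra_simps)
    then have "u = ?K (g - W u)"
      using u by (intro free_resolvent_unique[OF \<kappa> _ K(1)[OF f]]) (auto simp: resolvent_kernel_green[OF \<kappa> f])
    then have "u + ?K (W u) = ?K g" unfolding Kdiff[OF uL] by (simp add: eq_diff_eq)
    then show "u \<in> Ldual \<beta> \<and> u + ?K (W u) = ?K g" using uL by blast
  next
    assume u: "u \<in> Ldual \<beta> \<and> u + ?K (W u) = ?K g"
    then have f: "g - W u \<in> ell2" by (intro ell2_diff g W_ell2) auto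
    have "u = ?K g - ?K (W u)" using u by (simp add: eq_diff_eq)
    then have eq: "u = ?K (g - W u)" using Kdiff u by simp
    then have "decoupled_op u + smul (\<kappa>\<^sup>2) u = g - W u"
      using resolvent_kernel_green[OF \<kappa> f] by simp
    then have "Hop E xs V u + smul (\<kappa>\<^sup>2) u = g" by (simp add: Hop_eq_decoupled_op algebra_simps)
    moreover have "u \<in> ell2" using eq K(1)[OF f] by simp
    ultimately show "u \<in> ell2 \<and> Hop E xs V u + smul (\<kappa>\<^sup>2) u = g" by blast
  qed
qed

text \<open>Bijectivity is transported from the weighted space by \<open>resolvent_equation\<close>.
  For the norm, \<open>iso\<close> first bounds the solution in \<open>Ldual \<beta>\<close>; then
  \<open>W\<close> takes it into \<open>ell2\<close>, and solving the equation for the solution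
  gives its \<open>ell2\<close> norm.\<close>

lemma resolvent_exists:
  assumes \<kappa>: "\<kappa> \<in> half_disc" and iso: "one_plus_iso \<beta> C (\<lambda>u. kernel_op (resolvent_kernel \<kappa>) (W u))" and C: "C \<ge> 0"
  shows "bij_betw (\<lambda>u. Hop E xs V u + smul (\<kappa>\<^sup>2) u) ell2 ell2"
    and "g \<in> ell2 \<Longrightarrow> resolvent (Hop E xs V) \<kappa> g \<in> Ldual \<beta>"
    and "g \<in> ell2 \<Longrightarrow> resolvent (Hop E xs V) \<kappa> g + kernel_op (resolvent_kernel \<kappa>) (W (resolvent (Hop E xs V) \<kappa> g))
      = kernel_op (resolvent_kernel \<kappa>) g"
    and "bounded_op ell2 norm2 ell2 norm2 (resolvent (Hop E xs V) \<kappa>)"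
proof -
  let ?K = "kernel_op (resolvent_kernel \<kappa>) :: ('k, 'n) oper" and ?T = "\<lambda>u. Hop E xs V u + smul (\<kappa>\<^sup>2) u"
  let ?R = "resolvent (Hop E xs V) \<kappa>"
  obtain C2 where C2: "kernel_bound \<beta> C2 (resolvent_kernel \<kappa> :: ('k, 'n) vertex \<Rightarrow> _)"
    using resolvent_kernel_bound[of \<beta>] \<beta> \<kappa> by auto
  have lin: "linear_Ldual \<beta> (\<lambda>u. ?K (W u))" by (rule kernel_W(1)[OF C2])
  obtain M where M: "M \<ge> 0" "\<And>u. u \<in> ell2 \<Longrightarrow> ?K u \<in> ell2" "\<And>u. u \<in> ell2 \<Longrightarrow> norm2 (?K u) \<le> M * norm2 u"
    using resolvent_kernel_ell2[OF \<kappa>] by blast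
  have L: "u \<in> Ldual \<beta>" "normLdual \<beta> u \<le> norm2 u" if "u \<in> ell2" for u :: "('k, 'n) state"
    using ell2_Ldual[OF that, of \<beta>] \<beta> by auto
  have T: "?T u \<in> ell2" if u: "u \<in> ell2" for u
    unfolding Hop_eq_decoupled_op by (intro ell2_add decoupled_op_ell2 ell2_smul W_ell2 u L)
  have inj: "inj_on ?T ell2"
  proof (rule inj_onI)
    fix u w :: "('k, 'n) state" assume u: "u \<in> ell2" "w \<in> ell2" "?T u = ?T w"
    have "u + ?K (W u) = w + ?K (W w)"
      using resolvent_equation[OF \<kappa> T[OF u(1)], of u] resolvent_equation[OF \<kappa> T[OF u(1)], of w] u by auto
    then show "u = w" by (rule one_plus_iso_unique[OF lin iso L(1)[OF u(1)] L(1)[OF u(2)]])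
  qed
  have surj: "\<exists>u\<in>ell2. ?T u = g" if g: "g \<in> ell2" for g
  proof -
    obtain u where "u \<in> Ldual \<beta>" "u + ?K (W u) = ?K g"
      using iso L(1)[OF M(2)[OF g]] by (auto simp: one_plus_iso_def)
    then show ?thesis using resolvent_equation[OF \<kappa> g, of u] by blast
  qed
  show bij: "bij_betw ?T ell2 ell2"
    unfolding bij_betw_def using inj T surj by (auto simp: image_iff)
  have R: "?R g \<in> ell2" "?T (?R g) = g" if "g \<in> ell2" for g
    using bij that unfolding resolvent_def bij_betw_def
    by (auto intro!: the_inv_into_into[of ?T ell2 g ell2, OF inj] f_the_inv_into_f[of ?T ell2 g, OF inj])
  have R_unique: "?R g = u" if "u \<in> ell2" "?T u = g" for u g
    unfolding resolvent_def using the_inv_into_f_f[OF inj that(1)] that(2) by simp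
  have RE: "?R g \<in> Ldual \<beta>" "?R g + ?K (W (?R g)) = ?K g" if g: "g \<in> ell2" for g
    using resolvent_equation[OF \<kappa> g, of "?R g"] R[OF g] by auto
  show "g \<in> ell2 \<Longrightarrow> ?R g \<in> Ldual \<beta>" "g \<in> ell2 \<Longrightarrow> ?R g + ?K (W (?R g)) = ?K g"
    using RE by blast+
  define D where "D = 2 * (M + M * (W_bound * (C * M)))"
  have bd: "norm2 (?R g) \<le> D * norm2 g" if g: "g \<in> ell2" for g
  proof -
    have "normLdual \<beta> (?R g) \<le> C * normLdual \<beta> (?K g)"
      using iso RE[OF g] by (auto simp: one_plus_iso_def)
    also have "\<dots> \<le> C * (M * norm2 g)"
      by (intro mult_left_mono C order_trans[OF L(2)[OF M(2)[OF g]] M(3)[OF g]])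
    finally have RL: "normLdual \<beta> (?R g) \<le> C * M * norm2 g" by (simp add: mult.assoc)
    note We = W_ell2[OF RE(1)[OF g]]
    have "?R g = ?K g - ?K (W (?R g))" using RE(2)[OF g] by (simp add: eq_diff_eq)
    then have "norm2 (?R g) \<le> 2 * (norm2 (?K g) + norm2 (?K (W (?R g))))"
      using ell2_diff(2)[OF M(2)[OF g] M(2)[OF We(1)]] by simp
    also have "\<dots> \<le> 2 * (M * norm2 g + M * (W_bound * (C * M * norm2 g)))"
      by (intro mult_left_mono add_mono M(3) g order_trans[OF M(3)[OF We(1)]] order_trans[OF We(2)] RL W_bound M(1)) auto
    finally show ?thesis by (simp add: D_def algebra_simps)
  qed
  show "bounded_op ell2 norm2 ell2 norm2 ?R"
    unfolding bounded_op_def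
  proof (intro conjI ballI allI exI[of _ D])
    show "?R g \<in> ell2" "norm2 (?R g) \<le> D * norm2 g" if "g \<in> ell2" for g using R bd that by auto
    show "?R (g + h) = ?R g + ?R h" if gh: "g \<in> ell2" "h \<in> ell2" for g h
    proof (rule R_unique)
      have "?T (?R g + ?R h) = ?T (?R g) + ?T (?R h)"
        using Hop_linear(1)[OF R(1)[OF gh(1)] R(1)[OF gh(2)]] by (simp add: smul_add)
      then show "?T (?R g + ?R h) = g + h" using R(2) gh by simp
    qed (intro ell2_add R gh)
    show "?R (smul c g) = smul c (?R g)" if g: "g \<in> ell2" for c g
    proof (rule R_unique)
      have "?T (smul c (?R g)) = smul c (?T (?R g))"
        using Hop_linear(2)[OF R(1)[OF g]] by (simp add: smul_add smul_smul mult.commute)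
      then show "?T (smul c (?R g)) = smul c g" using R(2)[OF g] by simp
    qed (intro ell2_smul R g)
  qed
qed



section \<open>Coefficients and remainder of the resolvent expansion\<close>

definition threshold_inverse :: "('k, 'n) oper" where
  "threshold_inverse w = (SOME u. u \<in> Ldual \<beta> \<and> u + kernel_op threshold_kernel (W u) = w)"

lemma threshold_inverse:
  assumes "w \<in> Ldual \<beta>"
  shows "threshold_inverse w \<in> Ldual \<beta>"
    and "threshold_inverse w + kernel_op threshold_kernel (W (threshold_inverse w)) = w"
proof -
  have "\<exists>u. u \<in> Ldual \<beta> \<and> u + kernel_op threshold_kernel (W u) = w"
    using iso_threshold assms by (auto simp: one_plus_iso_def)
  from someI_ex[OF this] show "threshold_inverse w \<in> Ldual \<beta>"
    "threshold_inverse w + kernel_op threshold_kernel (W (threshold_inverse w)) = w"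
    by (auto simp: threshold_inverse_def)
qed

lemma threshold_inverse_bounded_op:
  "bounded_op (Ldual \<beta>) (normLdual \<beta>) (Ldual \<beta>) (normLdual \<beta>) threshold_inverse"
proof -
  let ?T = "\<lambda>u. kernel_op threshold_kernel (W u)" and ?A = threshold_inverse
  have kb: "kernel_bound \<beta> 1 (threshold_kernel :: ('k, 'n) vertex \<Rightarrow> _)" using \<beta> by (intro threshold_kernel_bound) simp
  have lin: "linear_Ldual \<beta> ?T" by (rule kernel_W[OF kb])
  note T = linear_LdualD[OF lin]
  obtain C where C: "one_plus_iso \<beta> C ?T" using iso_threshold by blast
  note A = threshold_inverse
  have unique: "?A w = u" if "u \<in> Ldual \<beta>" "u + ?T u = w" for u w
  proof -
    have w: "w \<in> Ldual \<beta>" unfolding that(2)[symmetric] by (intro Ldual_add that T)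
    show ?thesis by (rule one_plus_iso_unique[OF lin C A(1)[OF w] that(1)]) (simp add: A(2)[OF w] that(2))
  qed
  show ?thesis
  proof (rule bounded_opI_Ldual)
    show "?A u \<in> Ldual \<beta>" if "u \<in> Ldual \<beta>" for u using A that by blast
    show "normLdual \<beta> (?A u) \<le> C * normLdual \<beta> u" if u: "u \<in> Ldual \<beta>" for u
      using C A(1)[OF u] A(2)[OF u] by (auto simp: one_plus_iso_def)
    show "?A (u + w) = ?A u + ?A w" if u: "u \<in> Ldual \<beta>" "w \<in> Ldual \<beta>" for u w
    proof (rule unique)
      have "(?A u + ?A w) + ?T (?A u + ?A w) = (?A u + ?T (?A u)) + (?A w + ?T (?A w))"
        unfolding T(2)[OF A(1)[OF u(1)] A(1)[OF u(2)]] by (simp add: algebra_simps)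
      then show "(?A u + ?A w) + ?T (?A u + ?A w) = u + w" using A(2) u by simp
    qed (intro Ldual_add A u)
    show "?A (smul c u) = smul c (?A u)" if u: "u \<in> Ldual \<beta>" for c u
    proof (rule unique)
      have "smul c (?A u) + ?T (smul c (?A u)) = smul c (?A u + ?T (?A u))"
        unfolding T(3)[OF A(1)[OF u]] by (simp add: smul_add)
      then show "smul c (?A u) + ?T (smul c (?A u)) = smul c u" using A(2)[OF u] by simp
    qed (intro Ldual_smul A u)
  qed
qed

definition G :: "nat \<Rightarrow> ('k, 'n) oper" where
  "G = resolvent_coeff threshold_inverse W (\<lambda>j. kernel_op (coeff_kernel j))"

text \<open>Whatever the growth of \<open>A u\<close>, the operator \<open>W\<close> restores decay
  of full weight \<beta>. Only the outer kernel then limits the target exponent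
  \<open>t\<close>.\<close>

lemma coeff_W_bounded_op:
  assumes A: "bounded_op (Lsp s) (normL s) (Ldual \<beta>) (normLdual \<beta>) A" and i: "1 \<le> t" "real i \<le> t" "t \<le> \<beta>"
  shows "bounded_op (Lsp s) (normL s) (Ldual t) (normLdual t) (\<lambda>u. kernel_op (coeff_kernel i) (W (A u)))"
proof -
  obtain C where C: "kernel_bound t C (coeff_kernel i :: ('k, 'n) vertex \<Rightarrow> _)" using coeff_kernel_bound[OF i(1,2)] by blast
  have "bounded_op (Lsp s) (normL s) (Lsp \<beta>) (normL \<beta>) (\<lambda>u. W (A u))"
    by (rule bounded_op_comp[OF A W_bounded_op normLdual_nonneg])
  from bounded_op_comp[OF bounded_op_Lsp_mono[OF this i(3)] kernel_op_bounded_op[OF C] normL_nonneg] show ?thesis .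
qed

text \<open>The source weight is already the final one, but the target is
  \<open>Ldual \<beta>\<close>, since \<open>threshold_inverse\<close> is controlled only
  there.\<close>

lemma G_bounded_op_weak:
  assumes s: "1 \<le> s" "s \<le> \<beta>" "real j \<le> s"
  shows "bounded_op (Lsp s) (normL s) (Ldual \<beta>) (normLdual \<beta>) (G j)"
  using s(3)
proof (induction j rule: less_induct)
  case (less j)
  obtain C where C: "kernel_bound s C (coeff_kernel j :: ('k, 'n) vertex \<Rightarrow> _)" using coeff_kernel_bound[OF s(1) less.prems] by blast
  have bd: "bounded_op (Lsp s) (normL s) (Ldual \<beta>) (normLdual \<beta>)
      (\<lambda>u. kernel_op (coeff_kernel j) u - (\<Sum>i<j. kernel_op (coeff_kernel (j - i)) (W (G i u))))"
  proof (intro bounded_op_diff bounded_op_sum)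
    show "bounded_op (Lsp s) (normL s) (Ldual \<beta>) (normLdual \<beta>) (kernel_op (coeff_kernel j) :: ('k, 'n) oper)"
      by (rule bounded_op_Ldual_mono[OF kernel_op_bounded_op[OF C] s(2)])
    fix i assume "i \<in> {..<j}"
    then have i: "i < j" by simp
    have "bounded_op (Lsp s) (normL s) (Ldual \<beta>) (normLdual \<beta>) (G i)"
      using i less.prems by (intro less.IH) auto
    then show "bounded_op (Lsp s) (normL s) (Ldual \<beta>) (normLdual \<beta>) (\<lambda>u. kernel_op (coeff_kernel (j - i)) (W (G i u)))"
      using s less.prems by (intro coeff_W_bounded_op) auto
  qed simp
  have Gj: "G j = (\<lambda>u. threshold_inverse (kernel_op (coeff_kernel j) u -
      (\<Sum>i<j. kernel_op (coeff_kernel (j - i)) (W (G i u)))))"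
    unfolding G_def by (rule ext) (rule resolvent_coeff.simps)
  show ?case unfolding Gj by (rule bounded_op_comp[OF bd threshold_inverse_bounded_op normLdual_nonneg])
qed

text \<open>The summand \<open>i = j\<close> has the threshold kernel in front; together with
  \<open>G j u\<close> it undoes \<open>threshold_inverse\<close>. The form without the inverse
  permits the improved bound on \<open>G j\<close>.\<close>

lemma G_equation:
  assumes s: "1 \<le> s" "s \<le> \<beta>" "real j \<le> s" and u: "u \<in> Lsp s"
  shows "G j u + (\<Sum>i\<le>j. kernel_op (coeff_kernel (j - i)) (W (G i u))) = kernel_op (coeff_kernel j) u"
proof -
  define w where "w = kernel_op (coeff_kernel j) u - (\<Sum>i<j. kernel_op (coeff_kernel (j - i)) (W (G i u)))"
  have G: "G j u = threshold_inverse w" unfolding G_def w_def by (rule resolvent_coeff.simps)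
  obtain C where C: "kernel_bound s C (coeff_kernel j :: ('k, 'n) vertex \<Rightarrow> _)" using coeff_kernel_bound[OF s(1,3)] by blast
  have "kernel_op (coeff_kernel (j - i)) (W (G i u)) \<in> Ldual \<beta>" if "i < j" for i
  proof -
    have "bounded_op (Lsp s) (normL s) (Ldual \<beta>) (normLdual \<beta>) (\<lambda>u. kernel_op (coeff_kernel (j - i)) (W (G i u)))"
      using that s by (intro coeff_W_bounded_op G_bounded_op_weak) auto
    then show ?thesis using u by (simp add: bounded_op_def)
  qed
  then have w: "w \<in> Ldual \<beta>"
    unfolding w_def using Ldual_mono(1)[OF s(2) kernel_op_Ldual(1)[OF C u]] by (intro Ldual_diff Ldual_sum) auto
  have "G j u + kernel_op threshold_kernel (W (G j u)) = w" unfolding G by (rule threshold_inverse(2)[OF w])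
  moreover have "(\<Sum>i\<le>j. kernel_op (coeff_kernel (j - i)) (W (G i u))) =
      (\<Sum>i<j. kernel_op (coeff_kernel (j - i)) (W (G i u))) + kernel_op threshold_kernel (W (G j u))"
    by (simp add: lessThan_Suc_atMost[symmetric] coeff_kernel_0)
  ultimately show ?thesis unfolding w_def by (simp add: algebra_simps)
qed

text \<open>A bootstrap: \<open>G_equation\<close> expresses \<open>G j\<close> by kernels of order
  at most \<open>j\<close> applied to functions in \<open>Lsp s\<close>, and each such term lies in
  \<open>Ldual s\<close> itself.\<close>

lemma G_bounded_op:
  assumes s: "1 \<le> s" "s \<le> \<beta>" "real j \<le> s"
  shows "G j \<in> Bsp s"
proof -
  obtain C where C: "kernel_bound s C (coeff_kernel j :: ('k, 'n) vertex \<Rightarrow> _)" using coeff_kernel_bound[OF s(1,3)] by blast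
  have "bounded_op (Lsp s) (normL s) (Ldual s) (normLdual s)
      (\<lambda>u. kernel_op (coeff_kernel j) u - (\<Sum>i\<le>j. kernel_op (coeff_kernel (j - i)) (W (G i u))))"
    using s by (intro bounded_op_diff bounded_op_sum kernel_op_bounded_op[OF C] coeff_W_bounded_op G_bounded_op_weak) auto
  then show ?thesis unfolding Bsp_def mem_Collect_eq
    by (rule bounded_op_cong) (use G_equation[OF s] in \<open>simp add: eq_diff_eq\<close>)
qed

lemma remainder_kernel_Suc:
  fixes f :: "('k, 'n) state"
  assumes \<kappa>: "\<kappa> \<in> half_disc" and J: "real J \<le> \<beta>" and f: "f \<in> Lsp \<beta>"
  shows "kernel_op (remainder_kernel (Suc J) \<kappa>) f =
    kernel_op (remainder_kernel J \<kappa>) f - smul (\<kappa> ^ J) (kernel_op (coeff_kernel J) f)"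
proof -
  have \<beta>1: "1 \<le> \<beta>" using \<beta> by simp
  obtain C where C: "kernel_bound \<beta> C (coeff_kernel J :: ('k, 'n) vertex \<Rightarrow> _)" using coeff_kernel_bound[OF \<beta>1 J] by blast
  obtain C' where C': "kernel_bound \<beta> C' (remainder_kernel J \<kappa> :: ('k, 'n) vertex \<Rightarrow> _)"
    using remainder_kernel_bound[OF \<beta>1 J] \<kappa> by blast
  have "remainder_kernel (Suc J) \<kappa> = (\<lambda>p q :: ('k, 'n) vertex. remainder_kernel J \<kappa> p q - \<kappa> ^ J * coeff_kernel J p q)"
    by (simp add: remainder_kernel_def fun_eq_iff)
  then show ?thesis using kernel_op_kernel_diff[OF C' C f, of "\<kappa> ^ J"] by simp
qed

text \<open>The point is the shape of the right-hand side: in each term the power of \<kappa> and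
  the order of the remainder kernel add up to \<open>m\<close>. In the step of the induction,
  raising every remainder by one order releases terms with factor \<open>\<kappa> ^ m\<close>, which
  \<open>G_equation\<close> collects into the contribution of \<open>G m u\<close>.\<close>

lemma remainder_equation:
  assumes \<kappa>: "\<kappa> \<in> half_disc" and u: "u \<in> Lsp \<beta>" and R: "R \<in> Ldual \<beta>"
    and RE: "R + kernel_op (resolvent_kernel \<kappa>) (W R) = kernel_op (resolvent_kernel \<kappa>) u"
    and m: "real m \<le> \<beta>"
  defines "D \<equiv> \<lambda>m. R - (\<Sum>j<m. smul (\<kappa> ^ j) (G j u))"
  shows "D m \<in> Ldual \<beta>" and "D m + kernel_op (resolvent_kernel \<kappa>) (W (D m)) =
    kernel_op (remainder_kernel m \<kappa>) u - (\<Sum>j<m. smul (\<kappa> ^ j) (kernel_op (remainder_kernel (m - j) \<kappa>) (W (G j u))))"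
proof -
  let ?K = "kernel_op (resolvent_kernel \<kappa>) :: ('k, 'n) oper"
  have \<beta>1: "1 \<le> \<beta>" using \<beta> by simp
  obtain C2 where C2: "kernel_bound \<beta> C2 (resolvent_kernel \<kappa> :: ('k, 'n) vertex \<Rightarrow> _)"
    using resolvent_kernel_bound[OF \<beta>1] \<kappa> by blast
  note lin = linear_LdualD[OF kernel_W(1)[OF C2]]
  have GL: "G j u \<in> Ldual \<beta>" if "real j \<le> \<beta>" for j
    using G_bounded_op_weak[OF \<beta>1 order_refl that] u by (simp add: bounded_op_def)
  have "D m \<in> Ldual \<beta> \<and> D m + ?K (W (D m)) =
    kernel_op (remainder_kernel m \<kappa>) u - (\<Sum>j<m. smul (\<kappa> ^ j) (kernel_op (remainder_kernel (m - j) \<kappa>) (W (G j u))))"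
    using m
  proof (induction m)
    case 0
    then show ?case using R RE by (simp add: D_def remainder_kernel_0)
  next
    case (Suc m)
    then have m: "real m \<le> \<beta>" and IH1: "D m \<in> Ldual \<beta>" and IH2: "D m + ?K (W (D m)) =
      kernel_op (remainder_kernel m \<kappa>) u - (\<Sum>j<m. smul (\<kappa> ^ j) (kernel_op (remainder_kernel (m - j) \<kappa>) (W (G j u))))"
      by auto
    let ?x = "smul (\<kappa> ^ m) (G m u)"
    have xL: "?x \<in> Ldual \<beta>" by (intro Ldual_smul GL m)
    have DS: "D (Suc m) = D m - ?x" by (simp add: D_def algebra_simps)
    have rec: "smul (\<kappa> ^ j) (kernel_op (remainder_kernel (Suc m - j) \<kappa>) (W (G j u))) =
        smul (\<kappa> ^ j) (kernel_op (remainder_kernel (m - j) \<kappa>) (W (G j u))) -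
        smul (\<kappa> ^ m) (kernel_op (coeff_kernel (m - j)) (W (G j u)))" if j: "j \<le> m" for j
    proof -
      have "Suc m - j = Suc (m - j)" using j by simp
      moreover have "kernel_op (remainder_kernel (Suc (m - j)) \<kappa>) (W (G j u)) =
         kernel_op (remainder_kernel (m - j) \<kappa>) (W (G j u)) - smul (\<kappa> ^ (m - j)) (kernel_op (coeff_kernel (m - j)) (W (G j u)))"
        using j m by (intro remainder_kernel_Suc[OF \<kappa>] W_bound GL) auto
      ultimately show ?thesis using j by (simp add: smul_diff smul_smul power_add[symmetric])
    qed
    have sum_smul: "(\<Sum>j\<le>m. smul c (f j)) = smul c (\<Sum>j\<le>m. f j)" for c and f :: "nat \<Rightarrow> ('k, 'n) state"
      by (induction m) (simp_all add: smul_add)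
    have "kernel_op (remainder_kernel (Suc m) \<kappa>) u - (\<Sum>j<Suc m. smul (\<kappa> ^ j) (kernel_op (remainder_kernel (Suc m - j) \<kappa>) (W (G j u))))
      = kernel_op (remainder_kernel m \<kappa>) u - smul (\<kappa> ^ m) (kernel_op (coeff_kernel m) u)
        - ((\<Sum>j\<le>m. smul (\<kappa> ^ j) (kernel_op (remainder_kernel (m - j) \<kappa>) (W (G j u))))
        - smul (\<kappa> ^ m) (\<Sum>j\<le>m. kernel_op (coeff_kernel (m - j)) (W (G j u))))"
      unfolding remainder_kernel_Suc[OF \<kappa> m u] lessThan_Suc_atMost sum_smul[symmetric] sum_subtractf[symmetric]
      using rec by simp
    also have "smul (\<kappa> ^ m) (\<Sum>j\<le>m. kernel_op (coeff_kernel (m - j)) (W (G j u)))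
      = smul (\<kappa> ^ m) (kernel_op (coeff_kernel m) u) - ?x"
      unfolding G_equation[OF \<beta>1 order_refl m u, symmetric] by (simp add: smul_add)
    also have "(\<Sum>j\<le>m. smul (\<kappa> ^ j) (kernel_op (remainder_kernel (m - j) \<kappa>) (W (G j u)))) =
        (\<Sum>j<m. smul (\<kappa> ^ j) (kernel_op (remainder_kernel (m - j) \<kappa>) (W (G j u)))) + smul (\<kappa> ^ m) (?K (W (G m u)))"
      by (simp add: lessThan_Suc_atMost[symmetric] remainder_kernel_0)
    also have "smul (\<kappa> ^ m) (?K (W (G m u))) = ?K (W ?x)" using lin(3)[OF GL[OF m]] by simp
    finally have "kernel_op (remainder_kernel (Suc m) \<kappa>) u - (\<Sum>j<Suc m. smul (\<kappa> ^ j) (kernel_op (remainder_kernel (Suc m - j) \<kappa>) (W (G j u))))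
      = (D m + ?K (W (D m))) - (?x + ?K (W ?x))" unfolding IH2 by (simp add: algebra_simps)
    moreover have "D (Suc m) + ?K (W (D (Suc m))) = (D m + ?K (W (D m))) - (?x + ?K (W ?x))"
      unfolding DS lin(4)[OF IH1 xL] by (simp add: algebra_simps)
    ultimately show ?case using Ldual_diff(1)[OF IH1 xL] unfolding DS by metis
  qed
  then show "D m \<in> Ldual \<beta>" and "D m + ?K (W (D m)) =
    kernel_op (remainder_kernel m \<kappa>) u - (\<Sum>j<m. smul (\<kappa> ^ j) (kernel_op (remainder_kernel (m - j) \<kappa>) (W (G j u))))"
    by auto
qed

text \<open>Every term on the right of \<open>remainder_equation\<close> is of order
  \<open>\<kappa> ^ m\<close>, and the lower bound for \<open>1 + R_0(\<kappa>) W\<close> passes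
  this to the remainder. \<open>B\<close> is built from \<open>C\<close> and constants independent
  of \<kappa>, so it serves all \<kappa> at once.\<close>

lemma resolvent_expansion:
  assumes m: "real m \<le> \<beta>" and C: "C \<ge> 0"
  shows "\<exists>B\<ge>0. \<forall>\<kappa>\<in>half_disc. one_plus_iso \<beta> C (\<lambda>u. kernel_op (resolvent_kernel \<kappa>) (W u)) \<longrightarrow>
    (\<forall>u\<in>Lsp \<beta>. normLdual \<beta> (resolvent (Hop E xs V) \<kappa> u - (\<Sum>j<m. smul (\<kappa> ^ j) (G j u))) \<le> B * cmod \<kappa> ^ m * normL \<beta> u)"
proof -
  have \<beta>1: "1 \<le> \<beta>" using \<beta> by simp
  have "\<exists>c\<ge>0. \<forall>\<kappa>\<in>half_disc. kernel_bound \<beta> (c * cmod \<kappa> ^ J) (remainder_kernel J \<kappa> :: ('k, 'n) vertex \<Rightarrow> _)" if "J \<le> m" for J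
    using remainder_kernel_bound[OF \<beta>1, of J] that m by simp
  then obtain c where c: "\<And>J. J \<le> m \<Longrightarrow> c J \<ge> 0"
    "\<And>J \<kappa>. J \<le> m \<Longrightarrow> \<kappa> \<in> half_disc \<Longrightarrow> kernel_bound \<beta> (c J * cmod \<kappa> ^ J) (remainder_kernel J \<kappa> :: ('k, 'n) vertex \<Rightarrow> _)"
    by metis
  have "\<exists>g\<ge>0. \<forall>u\<in>Lsp \<beta>. normLdual \<beta> (G j u) \<le> g * normL \<beta> u" if "j < m" for j
  proof -
    have "bounded_op (Lsp \<beta>) (normL \<beta>) (Ldual \<beta>) (normLdual \<beta>) (G j)"
      using that m by (intro G_bounded_op_weak \<beta>1) auto
    then obtain g where g: "\<And>u. u \<in> Lsp \<beta> \<Longrightarrow> normLdual \<beta> (G j u) \<le> g * normL \<beta> u" unfolding bounded_op_def by blast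
    then have "\<forall>u\<in>Lsp \<beta>. normLdual \<beta> (G j u) \<le> max g 0 * normL \<beta> u"
      by (auto intro!: order_trans[OF g] mult_right_mono normL_nonneg)
    then show ?thesis by (intro exI[of _ "max g 0"]) auto
  qed
  then obtain g where g: "\<And>j. j < m \<Longrightarrow> g j \<ge> 0" "\<And>j u. j < m \<Longrightarrow> u \<in> Lsp \<beta> \<Longrightarrow> normLdual \<beta> (G j u) \<le> g j * normL \<beta> u"
    by metis
  define B where "B = C * (c m + (\<Sum>j<m. c (m - j) * W_bound * g j))"
  have B: "B \<ge> 0" unfolding B_def
    by (intro mult_nonneg_nonneg add_nonneg_nonneg sum_nonneg C W_bound) (auto intro: c g)
  have "normLdual \<beta> (resolvent (Hop E xs V) \<kappa> u - (\<Sum>j<m. smul (\<kappa> ^ j) (G j u))) \<le> B * cmod \<kappa> ^ m * normL \<beta> u"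
    if \<kappa>: "\<kappa> \<in> half_disc" and iso: "one_plus_iso \<beta> C (\<lambda>u. kernel_op (resolvent_kernel \<kappa>) (W u))" and u: "u \<in> Lsp \<beta>" for \<kappa> u
  proof -
    define D where "D = resolvent (Hop E xs V) \<kappa> u - (\<Sum>j<m. smul (\<kappa> ^ j) (G j u))"
    have u2: "u \<in> ell2" using Lsp_ell2(1)[OF u] \<beta> by simp
    note Req = remainder_equation[OF \<kappa> u resolvent_exists(2,3)[OF \<kappa> iso C u2] m, folded D_def]
    have GL: "G j u \<in> Ldual \<beta>" if "j < m" for j
      using G_bounded_op_weak[OF \<beta>1 order_refl, of j] that m u by (simp add: bounded_op_def)
    have summand: "smul (\<kappa> ^ j) (kernel_op (remainder_kernel (m - j) \<kappa>) (W (G j u))) \<in> Ldual \<beta>"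
      "normLdual \<beta> (smul (\<kappa> ^ j) (kernel_op (remainder_kernel (m - j) \<kappa>) (W (G j u)))) \<le>
        c (m - j) * W_bound * g j * (cmod \<kappa> ^ m * normL \<beta> u)" if j: "j < m" for j
    proof -
      have kb: "kernel_bound \<beta> (c (m - j) * cmod \<kappa> ^ (m - j)) (remainder_kernel (m - j) \<kappa> :: ('k, 'n) vertex \<Rightarrow> _)"
        by (intro c \<kappa>) simp
      have L: "kernel_op (remainder_kernel (m - j) \<kappa>) (W (G j u)) \<in> Ldual \<beta>"
        by (intro kernel_op_Ldual[OF kb] W_bound GL j)
      show "smul (\<kappa> ^ j) (kernel_op (remainder_kernel (m - j) \<kappa>) (W (G j u))) \<in> Ldual \<beta>"
        by (rule Ldual_smul(1)[OF L])
      have "normLdual \<beta> (smul (\<kappa> ^ j) (kernel_op (remainder_kernel (m - j) \<kappa>) (W (G j u)))) \<le>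
          cmod \<kappa> ^ j * (c (m - j) * cmod \<kappa> ^ (m - j) * W_bound * (g j * normL \<beta> u))"
        using c(1)[of "m - j"] W_bound(1) g(2)[OF j u]
        by (intro order_trans[OF Ldual_smul(2)[OF L]] order_trans[OF mult_left_mono[OF kernel_W(2)[OF kb _ GL[OF j]]]])
          (auto simp: norm_power intro!: mult_left_mono)
      also have "\<dots> = c (m - j) * W_bound * g j * ((cmod \<kappa> ^ j * cmod \<kappa> ^ (m - j)) * normL \<beta> u)" by (simp add: mult_ac)
      also have "cmod \<kappa> ^ j * cmod \<kappa> ^ (m - j) = cmod \<kappa> ^ m" using j by (simp add: power_add[symmetric])
      finally show "normLdual \<beta> (smul (\<kappa> ^ j) (kernel_op (remainder_kernel (m - j) \<kappa>) (W (G j u)))) \<le>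
        c (m - j) * W_bound * g j * (cmod \<kappa> ^ m * normL \<beta> u)" .
    qed
    have kb: "kernel_bound \<beta> (c m * cmod \<kappa> ^ m) (remainder_kernel m \<kappa> :: ('k, 'n) vertex \<Rightarrow> _)" by (intro c \<kappa>) simp
    let ?S = "\<Sum>j<m. smul (\<kappa> ^ j) (kernel_op (remainder_kernel (m - j) \<kappa>) (W (G j u)))"
    have S: "?S \<in> Ldual \<beta>" by (intro Ldual_sum) (auto intro: summand)
    have "normLdual \<beta> ?S \<le> (\<Sum>j<m. c (m - j) * W_bound * g j * (cmod \<kappa> ^ m * normL \<beta> u))"
      by (rule order_trans[OF Ldual_sum(2)]) (auto intro!: sum_mono summand)
    then have "normLdual \<beta> (kernel_op (remainder_kernel m \<kappa>) u - ?S) \<le>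
        c m * cmod \<kappa> ^ m * normL \<beta> u + (\<Sum>j<m. c (m - j) * W_bound * g j * (cmod \<kappa> ^ m * normL \<beta> u))"
      using Ldual_diff(2)[OF kernel_op_Ldual(1)[OF kb u] S] kernel_op_Ldual(2)[OF kb u] by linarith
    also have "\<dots> = (c m + (\<Sum>j<m. c (m - j) * W_bound * g j)) * (cmod \<kappa> ^ m * normL \<beta> u)"
      by (simp add: distrib_right sum_distrib_right mult.assoc)
    finally have rhs: "normLdual \<beta> (D + kernel_op (resolvent_kernel \<kappa>) (W D)) \<le> \<dots>" unfolding Req(2) .
    have "normLdual \<beta> D \<le> C * normLdual \<beta> (D + kernel_op (resolvent_kernel \<kappa>) (W D))"
      using iso Req(1) by (auto simp: one_plus_iso_def)
    also have "\<dots> \<le> C * ((c m + (\<Sum>j<m. c (m - j) * W_bound * g j)) * (cmod \<kappa> ^ m * normL \<beta> u))"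
      by (intro mult_left_mono rhs C)
    finally show ?thesis by (simp add: B_def D_def mult.assoc)
  qed
  then show ?thesis using B by blast
qed

end

section \<open>Vanishing projections, operator norm and the expansion theorem\<close>

interpretation state_module: module "smul :: complex \<Rightarrow> ('k, 'n) state \<Rightarrow> ('k, 'n) state"
  by unfold_locales (auto simp: fun_eq_iff pointwise algebra_simps)

text \<open>The empty set is the only basis of the zero space, so the choice in the projection is
  forced and the sum is empty.\<close>

lemma bound_projection_zero:
  assumes "bound_space E xs V \<beta> = {0}"
  shows "bound_projection E xs V \<beta> = 0"
proof -
  have "bound_basis E xs V \<beta> B \<longleftrightarrow> B = {}" for B
  proof
    assume "bound_basis E xs V \<beta> B"
    then have "\<not> state_module.dependent B" "state_module.span B = {0}" using assms by (auto simp: bound_basis_def)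
    then have "B \<subseteq> {0}" "0 \<notin> B" using state_module.span_superset state_module.dependent_zero by blast+
    then show "B = {}" by blast
  next
    assume "B = {}"
    then show "bound_basis E xs V \<beta> B" using assms
      by (simp add: bound_basis_def state_module.span_empty state_module.independent_empty)
  qed
  then have "(SOME B. bound_basis E xs V \<beta> B) = {}" by simp
  then show ?thesis by (simp add: bound_projection_def)
qed

text \<open>A resonance basis could only be empty or \<open>{0}\<close>, and the coefficient 1
  contradicts independence in the latter case. Again the choice is forced.\<close>

lemma resonance_projection_zero:
  assumes res: "res_space E xs V \<beta> = {0}" and bnd: "bound_space E xs V \<beta> = {0}"
  shows "resonance_projection E xs V \<beta> = 0"
proof -
  have "resonance_basis E xs V \<beta> B \<longleftrightarrow> B = {}" for B
  proof
    assume B: "resonance_basis E xs V \<beta> B"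
    then have sub: "B \<subseteq> {0}" using res by (simp add: resonance_basis_def)
    have ind: "\<forall>\<Psi>\<in>F. a \<Psi> = 0" if "finite F" "F \<subseteq> B" "(\<Sum>\<Psi>\<in>F. smul (a \<Psi>) \<Psi>) = 0" for F a
      using B that bnd unfolding resonance_basis_def by blast
    show "B = {}"
    proof (rule ccontr)
      assume "B \<noteq> {}"
      then have "B = {0}" using sub by blast
      moreover have "(\<Sum>\<Psi>\<in>{0}. smul 1 \<Psi>) = (0 :: ('a, 'b) state)" by (simp add: fun_eq_iff pointwise)
      ultimately show False using ind[of "{0}" "\<lambda>_. 1"] by simp
    qed
  next
    assume "B = {}"
    then show "resonance_basis E xs V \<beta> B" using res bnd by (auto simp: resonance_basis_def)
  qed
  then have "(SOME B. resonance_basis E xs V \<beta> B) = {}" by simp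
  then show ?thesis by (simp add: resonance_projection_def)
qed

lemma normB_bound:
  fixes A :: "('k, 'n) oper"
  assumes "\<And>u. u \<in> Lsp s \<Longrightarrow> normLdual s (A u) \<le> C * normL s u" and C: "C \<ge> 0"
  shows "\<bar>normB s A\<bar> \<le> C"
proof -
  have le: "normLdual s (A u) / normL s u \<le> C" if u: "u \<in> Lsp s" for u
    using assms(1)[OF u] C normL_nonneg[of s u] by (cases "normL s u = 0") (auto simp: field_simps)
  have "(Lsp s :: ('k, 'n) state set) \<noteq> {}" using Lsp_zero(1) by blast
  then have "normB s A \<le> C" unfolding normB_def by (rule cSUP_least) (rule le)
  \<comment> \<open>The quotient at \<open>u = 0\<close> has denominator 0 and hence the value 0, so
    the supremum is nonnegative and its absolute value is bounded as well.\<close>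
  moreover have "normLdual s (A 0) / normL s (0 :: ('k, 'n) state) \<le> normB s A"
    unfolding normB_def
  proof (rule cSUP_upper[where f = "\<lambda>u. normLdual s (A u) / normL s u"])
    show "bdd_above ((\<lambda>u. normLdual s (A u) / normL s u) ` Lsp s)"
      by (rule bdd_aboveI[of _ C]) (use le in blast)
  qed simp
  ultimately show ?thesis by simp
qed

lemma (in regular_threshold) resolvent_Bsp:
  assumes \<kappa>: "\<kappa> \<in> half_disc" and iso: "one_plus_iso \<beta> C (\<lambda>u. kernel_op (resolvent_kernel \<kappa>) (W u))" and C: "C \<ge> 0"
  shows "resolvent (Hop E xs V) \<kappa> \<in> Bsp \<beta>"
proof -
  let ?R = "resolvent (Hop E xs V) \<kappa>"
  note R = resolvent_exists[OF \<kappa> iso C]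
  obtain C2 where C2: "kernel_bound \<beta> C2 (resolvent_kernel \<kappa> :: ('k, 'n) vertex \<Rightarrow> _)"
    using resolvent_kernel_bound[of \<beta>] \<beta> \<kappa> by auto
  have l2: "u \<in> ell2" if "u \<in> Lsp \<beta>" for u :: "('k, 'n) state" using Lsp_ell2(1)[OF that] \<beta> by simp
  have "bounded_op (Lsp \<beta>) (normL \<beta>) (Ldual \<beta>) (normLdual \<beta>) ?R"
  proof (rule bounded_opI_Ldual)
    show "normLdual \<beta> (?R u) \<le> (C * C2) * normL \<beta> u" if u: "u \<in> Lsp \<beta>" for u
    proof -
      have "normLdual \<beta> (?R u) \<le> C * normLdual \<beta> (kernel_op (resolvent_kernel \<kappa>) u)"
        using iso R(2,3)[OF l2[OF u]] by (auto simp: one_plus_iso_def)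
      also have "\<dots> \<le> C * (C2 * normL \<beta> u)" by (intro mult_left_mono kernel_op_Ldual[OF C2 u] C)
      finally show ?thesis by (simp add: mult.assoc)
    qed
  qed (use R(4) l2 R(2) in \<open>auto simp: bounded_op_def\<close>)
  then show ?thesis by (simp add: Bsp_def)
qed

lemma (in regular_threshold) not_in_l2_spectrum:
  assumes \<kappa>: "\<kappa> \<in> half_disc" and iso: "one_plus_iso \<beta> C (\<lambda>u. kernel_op (resolvent_kernel \<kappa>) (W u))" and C: "C \<ge> 0"
  shows "- (\<kappa>\<^sup>2) \<notin> l2_spectrum (Hop E xs V)"
proof -
  have "(\<lambda>u. Hop E xs V u - smul (- (\<kappa>\<^sup>2)) u) = (\<lambda>u. Hop E xs V u + smul (\<kappa>\<^sup>2) u)"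
    by (simp add: fun_eq_iff pointwise)
  then show ?thesis
    using resolvent_exists(1,4)[OF \<kappa> iso C] by (simp add: l2_spectrum_def resolvent_def[abs_def])
qed

theorem theorem3p5:
  fixes E0 :: "'k::finite set set"
    and xs :: "'n::finite \<Rightarrow> 'k"
    and V :: "('k, 'n) oper"
    and v :: "'h::complex_hilbert \<Rightarrow> ('k, 'n) state"
    and U :: "'h \<Rightarrow> 'h"
    and \<beta> :: nat
  assumes "simple_graph E0" and "connected_graph E0"
    and "\<beta> \<ge> 2"
    and "assumption_A (real \<beta>) V v U"
    and "res_space E0 xs V (real \<beta>) = {0}"
    and "bound_space E0 xs V (real \<beta>) = {0}"
  shows "\<exists>G :: int \<Rightarrow> ('k, 'n) oper.
     (\<forall>j. j \<notin> {0..int \<beta> - 2} \<longrightarrow> G j = 0) \<and>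
     (\<forall>\<^sub>F \<kappa> in at 0 within {\<kappa>. Re \<kappa> > 0}.
        - (\<kappa>\<^sup>2) \<notin> l2_spectrum (Hop E0 xs V) \<and>
        resolvent (Hop E0 xs V) \<kappa> \<in> Bsp (real \<beta>)) \<and>
     (\<lambda>\<kappa>. normB (real \<beta>)
           (\<lambda>u. resolvent (Hop E0 xs V) \<kappa> u - (\<Sum>j=0..\<beta> - 2. smul (\<kappa> ^ j) (G (int j) u))))
       \<in> O[at 0 within {\<kappa>. Re \<kappa> > 0}](\<lambda>\<kappa>. norm \<kappa> ^ (\<beta> - 1)) \<and>
     (\<forall>j\<in>{0..\<beta> - 2}. (even j \<longrightarrow> G (int j) \<in> Bsp (real (j + 1))) \<and>
                     (odd j \<longrightarrow> G (int j) \<in> Bsp (real j))) \<and>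
     G (-2) = bound_projection E0 xs V (real \<beta>) \<and> bound_projection E0 xs V (real \<beta>) = 0 \<and>
     G (-1) = resonance_projection E0 xs V (real \<beta>) \<and> resonance_projection E0 xs V (real \<beta>) = 0"
proof -
  interpret regular_threshold "real \<beta>" V v U E0 xs
    using assms by unfold_locales auto
  obtain \<delta> C where \<delta>: "\<delta> > 0" and C: "C \<ge> 0"
    and iso: "\<And>\<kappa>. \<kappa> \<in> half_disc \<Longrightarrow> cmod \<kappa> < \<delta> \<Longrightarrow> one_plus_iso \<beta> C (\<lambda>u. kernel_op (resolvent_kernel \<kappa>) (W u))"
    using iso_near_threshold by blast
  \<comment> \<open>The order is \<open>\<beta> - 1\<close>: summation over
    \<open>j < \<beta> - 1\<close> is summation from 0 to \<open>\<beta> - 2\<close>, and the error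
    is of the order claimed.\<close>
  obtain B where B: "B \<ge> 0" "\<And>\<kappa> u. \<kappa> \<in> half_disc \<Longrightarrow> cmod \<kappa> < \<delta> \<Longrightarrow> u \<in> Lsp \<beta> \<Longrightarrow>
      normLdual \<beta> (resolvent (Hop E0 xs V) \<kappa> u - (\<Sum>j<\<beta> - 1. smul (\<kappa> ^ j) (G j u))) \<le> B * cmod \<kappa> ^ (\<beta> - 1) * normL \<beta> u"
    using resolvent_expansion[of "\<beta> - 1" C] C iso by auto
  have near: "\<forall>\<^sub>F \<kappa> in at 0 within {\<kappa>. Re \<kappa> > 0}. \<kappa> \<in> half_disc \<and> cmod \<kappa> < \<delta>"
    unfolding eventually_at using \<delta> by (intro exI[of _ "min \<delta> (1/2)"]) (auto simp: half_disc_def)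
  \<comment> \<open>Indices outside the range get the zero operator, the convention for powers that
    do not occur; this covers -2 and -1.\<close>
  define G' :: "int \<Rightarrow> ('k, 'n) oper" where "G' j = (if j \<in> {0..int \<beta> - 2} then G (nat j) else 0)" for j
  have G': "G' (int j) = G j" if "j \<le> \<beta> - 2" for j using that assms(3) by (auto simp: G'_def)
  have range: "{0..\<beta> - 2} = {..<\<beta> - 1}" using assms(3) by auto
  have "\<forall>\<^sub>F \<kappa> in at 0 within {\<kappa>. Re \<kappa> > 0}. norm (normB \<beta>
      (\<lambda>u. resolvent (Hop E0 xs V) \<kappa> u - (\<Sum>j=0..\<beta> - 2. smul (\<kappa> ^ j) (G' (int j) u)))) \<le> B * norm (norm \<kappa> ^ (\<beta> - 1))"
    using near
  proof eventually_elim
    case (elim \<kappa>)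
    have "(\<Sum>j=0..\<beta> - 2. smul (\<kappa> ^ j) (G' (int j) u)) = (\<Sum>j<\<beta> - 1. smul (\<kappa> ^ j) (G j u))" for u
      unfolding range[symmetric] by (intro sum.cong) (simp_all add: G')
    then show ?case using normB_bound[OF B(2), of \<kappa>] elim B(1) by simp
  qed
  then have bigo: "(\<lambda>\<kappa>. normB \<beta> (\<lambda>u. resolvent (Hop E0 xs V) \<kappa> u - (\<Sum>j=0..\<beta> - 2. smul (\<kappa> ^ j) (G' (int j) u))))
      \<in> O[at 0 within {\<kappa>. Re \<kappa> > 0}](\<lambda>\<kappa>. norm \<kappa> ^ (\<beta> - 1))" by (rule bigoI)
  have ev: "\<forall>\<^sub>F \<kappa> in at 0 within {\<kappa>. Re \<kappa> > 0}. - (\<kappa>\<^sup>2) \<notin> l2_spectrum (Hop E0 xs V) \<and>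
      resolvent (Hop E0 xs V) \<kappa> \<in> Bsp \<beta>"
    using near
  proof eventually_elim
    case (elim \<kappa>)
    then show ?case using not_in_l2_spectrum[OF _ iso C] resolvent_Bsp[OF _ iso C] by blast
  qed
  have coeff: "\<forall>j\<in>{0..\<beta> - 2}. (even j \<longrightarrow> G' (int j) \<in> Bsp (real (j + 1))) \<and> (odd j \<longrightarrow> G' (int j) \<in> Bsp (real j))"
  proof (intro ballI conjI impI)
    fix j assume "j \<in> {0..\<beta> - 2}"
    then have j: "j \<le> \<beta> - 2" "j + 1 \<le> \<beta>" using assms(3) by auto
    show "G' (int j) \<in> Bsp (real (j + 1))" unfolding G'[OF j(1)] using j(2) by (intro G_bounded_op) auto
    \<comment> \<open>Oddness excludes \<open>j = 0\<close>, for which the exponent \<open>j\<close>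
      would fall below the minimum 1 of \<open>G_bounded_op\<close>.\<close>
    assume "odd j"
    then have "1 \<le> j" by (cases j) auto
    then show "G' (int j) \<in> Bsp (real j)" unfolding G'[OF j(1)] using j(2) by (intro G_bounded_op) auto
  qed
  have "bound_projection E0 xs V \<beta> = 0" "resonance_projection E0 xs V \<beta> = 0"
    using bound_projection_zero resonance_projection_zero assms(5,6) by blast+
  then show ?thesis using ev bigo coeff by (intro exI[of _ G']) (auto simp: G'_def)
qed

end
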